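(* Let $D$ be an edge-labeled connected Eulerian digraph (loops and multiple edges allowed) belonging to one of the following two families: (i) bipartite Eulerian digraphs with only one black vertex; (ii) Eulerian fans. Then the genus distribution of the face-oriented embeddings of $D$, i.e. the sequence of coefficients of the genus polynomial $\Gamma_D(x)$, is log-concave.
   Context: All digraphs are finite, connected, edge-labeled, and may have loops and multiple edges. A digraph is Eulerian if every vertex has equal in-degree and out-degree. A digraph is bipartite if its vertices can be properly 2-colored, with colors called black and white; "bipartite with only one black vertex" means it comes with such a coloring in which exactly one vertex is black. A directed forest is a digraph whose underlying undirected (multi)graph is a forest. An Eulerian fan is an Eulerian digraph $D$ having a vertex $u_\bullet$ (called its handle) such that deleting $u_\bullet$ together with all its incident edges leaves a directed forest. A directed map is a cellular embedding of a digraph in a closed connected orientable surface (every connected component of the complement, called a face, is an open disk), considered up to orientation-preserving homeomorphism respecting edge labels and edge orientations. It is face-oriented if for every face all the edges on its boundary are oriented in the same direction around that face. (Combinatorially, a face-oriented embedding of $D$ is a choice, at each vertex, of a cyclic order of the incident edge-ends in which incoming and outgoing ends alternate.) The genus $g(M)$ of an embedding $M$ is the genus of the surface; with $v$ vertices, $e$ edges, $f$ faces one has $v-e+f=2-2g(M)$. The genus polynomial of $D$ is $\Gamma_D(x)=\sum_M x^{g(M)}$, the sum being over all face-oriented embeddings $M$ of $D$; its sequence of coefficients $(a_0,\ldots,a_N)$, where $N$ is the degree of $\Gamma_D$, is the genus distribution of $D$. A finite sequence $(a_0,\ldots,a_N)$ of strictly positive real numbers is log-concave if $a_k^2\ge a_{k-1}a_{k+1}$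 for all $0<k<N$. *)

theory Defs
  imports
    "Graph_Theory.Graph_Theory"
    "HOL-Combinatorics.Permutations"
    "HOL-Combinatorics.Orbits"
    "HOL-Computational_Algebra.Polynomial"
begin

section \<open>Digraphs\<close>

text \<open>
  Digraphs are those of the entry Graph\_Theory: arcs are individual objects, so loops and
  multiple arcs are allowed and the arcs themselves serve as the edge labels.
\<close>

definition eulerian_digraph :: "('a, 'b) pre_digraph \<Rightarrow> bool" where
  "eulerian_digraph D \<longleftrightarrow> (\<forall>v\<in>verts D. in_degree D v = out_degree D v)"

definition proper_two_colouring :: "('a, 'b) pre_digraph \<Rightarrow> 'a set \<Rightarrow> 'a set \<Rightarrow> bool" where
  "proper_two_colouring D black white \<longleftrightarrow>
     black \<union> white = verts D \<and> black \<inter> white = {} \<and>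
     (\<forall>a\<in>arcs D. tail D a \<in> black \<and> head D a \<in> white \<or> tail D a \<in> white \<and> head D a \<in> black)"

definition bipartite_one_black :: "('a, 'b) pre_digraph \<Rightarrow> bool" where
  "bipartite_one_black D \<longleftrightarrow> (\<exists>black white. proper_two_colouring D black white \<and> card black = 1)"

text \<open>
  A dart is an end of an arc: \<open>(a, True)\<close> is the tail end (outgoing) and \<open>(a, False)\<close> the head
  end (incoming). It also stands for the traversal of \<open>a\<close> that starts at this end.
\<close>

definition darts :: "('a, 'b) pre_digraph \<Rightarrow> ('b \<times> bool) set" where
  "darts D = arcs D \<times> UNIV"

definition dart_vert :: "('a, 'b) pre_digraph \<Rightarrow> 'b \<times> bool \<Rightarrow> 'a" where
  "dart_vert D = (\<lambda>(a, out). if out then tail D a else head D a)"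

definition opp :: "'b \<times> bool \<Rightarrow> 'b \<times> bool" where
  "opp = (\<lambda>(a, out). (a, \<not> out))"

definition darts_at :: "('a, 'b) pre_digraph \<Rightarrow> 'a \<Rightarrow> ('b \<times> bool) set" where
  "darts_at D v = {d \<in> darts D. dart_vert D d = v}"

text \<open>The underlying undirected multigraph, each edge being represented by its two traversals.\<close>

definition underlying :: "('a, 'b) pre_digraph \<Rightarrow> ('a, 'b \<times> bool) pre_digraph" where
  "underlying D = \<lparr>verts = verts D, arcs = darts D, tail = dart_vert D, head = dart_vert D \<circ> opp\<rparr>"

text \<open>
  Requiring the edges of a cycle to be distinct only excludes traversing one edge back and forth;
  loops and pairs of parallel or antiparallel arcs do count as cycles. (The library's
  \<^const>\<open>forest\<close> forbids only directed cycles.)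
\<close>

definition directed_forest :: "('a, 'b) pre_digraph \<Rightarrow> bool" where
  "directed_forest D \<longleftrightarrow>
     \<not> (\<exists>p. pre_digraph.cycle (underlying D) p \<and> distinct (map fst p))"

definition eulerian_fan :: "('a, 'b) pre_digraph \<Rightarrow> bool" where
  "eulerian_fan D \<longleftrightarrow>
     eulerian_digraph D \<and> (\<exists>u\<in>verts D. directed_forest (pre_digraph.del_vert D u))"


section \<open>Directed maps\<close>

text \<open>
  Cellular embeddings of a connected digraph in closed connected oriented surfaces, up to
  orientation-preserving homeomorphism respecting labels and orientations of the edges, are
  encoded by rotation systems: the permutation \<open>\<sigma>\<close> of the darts sends each dart to the next one
  around its vertex.
\<close>

definition directed_map :: "('a, 'b) pre_digraph \<Rightarrow> ('b \<times> bool \<Rightarrow> 'b \<times> bool) \<Rightarrow> bool" where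
  "directed_map D \<sigma> \<longleftrightarrow>
     \<sigma> permutes darts D \<and>
     (\<forall>v\<in>verts D. darts_at D v \<noteq> {} \<longrightarrow> cyclic_on \<sigma> (darts_at D v))"

text \<open>
  A face is the set of darts met when walking along its boundary: traverse a dart, then leave
  along the next dart around the vertex reached. The embedding of a single vertex without arcs
  in the sphere has one face, with empty boundary.
\<close>

definition faces :: "('a, 'b) pre_digraph \<Rightarrow> ('b \<times> bool \<Rightarrow> 'b \<times> bool) \<Rightarrow> ('b \<times> bool) set set" where
  "faces D \<sigma> = (if arcs D = {} then {{}} else orbit (\<sigma> \<circ> opp) ` darts D)"

definition face_oriented :: "('a, 'b) pre_digraph \<Rightarrow> ('b \<times> bool \<Rightarrow> 'b \<times> bool) \<Rightarrow> bool" where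
  "face_oriented D \<sigma> \<longleftrightarrow> (\<forall>F\<in>faces D \<sigma>. \<forall>d\<in>F. \<forall>d'\<in>F. snd d = snd d')"

text \<open>
  The solution \<open>g\<close> of \<open>v - e + f = 2 - 2 g\<close>. For directed maps of connected digraphs the Euler
  characteristic is even and at most 2, so neither \<^const>\<open>nat\<close> nor the integer division truncates.
\<close>

definition map_genus :: "('a, 'b) pre_digraph \<Rightarrow> ('b \<times> bool \<Rightarrow> 'b \<times> bool) \<Rightarrow> nat" where
  "map_genus D \<sigma> =
     nat ((2 - (int (card (verts D)) - int (card (arcs D)) + int (card (faces D \<sigma>)))) div 2)"

definition genus_polynomial :: "('a, 'b) pre_digraph \<Rightarrow> real poly" where
  "genus_polynomial D = (\<Sum>\<sigma> | directed_map D \<sigma> \<and> face_oriented D \<sigma>. monom 1 (map_genus D \<sigma>))"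

definition genus_distribution :: "('a, 'b) pre_digraph \<Rightarrow> real list" where
  "genus_distribution D = coeffs (genus_polynomial D)"

definition log_concave :: "real list \<Rightarrow> bool" where
  "log_concave a \<longleftrightarrow>
     (\<forall>k<length a. 0 < a ! k) \<and>
     (\<forall>k. 0 < k \<and> k + 1 < length a \<longrightarrow> a ! (k - 1) * a ! (k + 1) \<le> (a ! k)\<^sup>2)"


section \<open>Face-oriented maps as alternating rotation systems\<close>

lemma finite_directed_maps:
  assumes "fin_digraph D"
  shows "finite {\<sigma>. directed_map D \<sigma> \<and> face_oriented D \<sigma>}"
proof -
  have "finite (darts D)"
    using fin_digraph.finite_arcs[OF assms] by (simp add: darts_def)
  then have "finite {\<sigma>. \<sigma> permutes darts D}" by (rule finite_permutations)
  then show ?thesis by (rule rev_finite_subset) (auto simp: directed_map_def)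
qed

lemma opp_opp [simp]: "opp (opp d) = d"
  by (simp add: opp_def split: prod.splits)

lemma snd_opp [simp]: "snd (opp d) \<longleftrightarrow> \<not> snd d"
  by (simp add: opp_def split: prod.splits)

lemma opp_in_darts_iff [simp]: "opp d \<in> darts D \<longleftrightarrow> d \<in> darts D"
  by (auto simp: opp_def darts_def split: prod.splits)

lemma face_oriented_iff_alternating:
  assumes "fin_digraph D" and "directed_map D \<sigma>"
  shows "face_oriented D \<sigma> \<longleftrightarrow> (\<forall>d\<in>darts D. snd (\<sigma> d) \<noteq> snd d)"
proof (cases "arcs D = {}")
  case True
  then show ?thesis by (simp add: face_oriented_def faces_def darts_def)
next
  case False
  have \<sigma>: "\<sigma> permutes darts D" using assms(2) by (simp add: directed_map_def)
  show ?thesis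
  proof
    assume fo: "face_oriented D \<sigma>"
    show "\<forall>d\<in>darts D. snd (\<sigma> d) \<noteq> snd d"
    proof
      fix d assume d: "d \<in> darts D"
      let ?\<phi> = "\<sigma> \<circ> opp"
      have inj: "inj ?\<phi>"
        by (rule inj_compose[OF permutes_inj[OF \<sigma>]]) (metis injI opp_opp)
      have fin: "finite (darts D)"
        using fin_digraph.finite_arcs[OF assms(1)] by (simp add: darts_def)
      have "(?\<phi> ^^ n) (opp d) \<in> darts D" for n
        by (induction n) (simp_all add: d permutes_in_image[OF \<sigma>])
      then have "{y. \<exists>n. y = (?\<phi> ^^ n) (opp d)} \<subseteq> darts D" by blast
      then have "finite {y. \<exists>n. y = (?\<phi> ^^ n) (opp d)}"
        using fin by (rule finite_subset)
      then obtain n where "0 < n" "(?\<phi> ^^ n) (opp d) = opp d"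
        using funpow_inj_finite[OF inj] by blast
      then have "opp d \<in> orbit ?\<phi> (opp d)"
        unfolding orbit_altdef by (intro CollectI exI[of _ n]) simp
      moreover have "\<sigma> d \<in> orbit ?\<phi> (opp d)"
        using orbit.base[of ?\<phi> "opp d"] by simp
      moreover have "orbit ?\<phi> (opp d) \<in> faces D \<sigma>"
        using False d by (simp add: faces_def)
      ultimately have "snd (\<sigma> d) = snd (opp d)"
        using fo by (auto simp: face_oriented_def)
      then show "snd (\<sigma> d) \<noteq> snd d" by simp
    qed
  next
    assume alt: "\<forall>d\<in>darts D. snd (\<sigma> d) \<noteq> snd d"
    have next_dart: "(\<sigma> \<circ> opp) x \<in> darts D \<and> snd ((\<sigma> \<circ> opp) x) = snd x" if "x \<in> darts D" for x
    proof -
      have "opp x \<in> darts D" using that by simp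
      then have "snd (\<sigma> (opp x)) \<noteq> snd (opp x)" using alt by blast
      then show ?thesis using that by (simp add: permutes_in_image[OF \<sigma>])
    qed
    have *: "x \<in> darts D \<and> snd x = snd d" if "x \<in> orbit (\<sigma> \<circ> opp) d" "d \<in> darts D" for x d
      using that(1)
    proof induction
      case base
      then show ?case using next_dart[OF that(2)] .
    next
      case (step y)
      then show ?case using next_dart[of y] by simp
    qed
    have "snd x = snd y" if "F \<in> faces D \<sigma>" "x \<in> F" "y \<in> F" for F x y
    proof -
      have "F \<in> orbit (\<sigma> \<circ> opp) ` darts D"
        using that(1) False by (simp only: faces_def if_False)
      then obtain d where "F = orbit (\<sigma> \<circ> opp) d" "d \<in> darts D" by (rule imageE)
      then show ?thesis using *[of x d] *[of y d] that by simp
    qed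
    then show "face_oriented D \<sigma>" unfolding face_oriented_def by blast
  qed
qed

end

theory Submission
  imports Defs "HOL-Computational_Algebra.Fundamental_Theorem_Algebra"
begin

text \<open>
  A bipartite digraph with one black vertex is a fan whose forest has no arcs, so let \<open>u\<close> be the
  handle of a fan. Fix the rotations at all other vertices. Contracting the forest preserves the
  faces and turns every tree into one vertex, so up to relabelling the faces of the maps obtained
  by varying the rotation at \<open>u\<close> are the cycles of \<open>p\<close> and \<open>p'\<close>, where \<open>p \<circ> p' \<circ> \<rho>\<close> ranges over
  the full cycles of the \<open>n\<close> arcs leaving \<open>u\<close> and the orbits of \<open>\<rho>\<close> are the sets of arcs that
  lead to the same tree (loops at \<open>u\<close> being fixed points).

  The indicator function of the full cycles is, up to the factor \<open>n\<close>, the alternating sum of the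
  characters of hook shape, and \<open>\<Sum>p. q ^ cyc p\<close> acts on the \<open>k\<close>-th of them by the scalar
  \<open>(q - k) \<cdots> (q - k + n - 1)\<close>. Hence the face polynomial is \<open>g(E)\<close> applied to
  \<open>(q (q + 1) \<cdots> (q + n - 1))\<^sup>2\<close>, where \<open>E\<close> is the shift \<open>q \<mapsto> q - 1\<close> and
  \<open>(1 - t) g(t) = \<Prod>(1 - t ^ \<lambda>)\<close> over the cycle lengths \<open>\<lambda>\<close> of \<open>\<rho>\<close>. Since the roots of \<open>g\<close> lie
  on the unit circle, each linear factor of \<open>g(E)\<close> removes one double real root at the end of the
  progression and keeps the other roots on its axis of symmetry. In the end all roots are
  imaginary, so the genus polynomial has only negative real roots.
\<close>

section \<open>Cycle counts\<close>

text \<open>Characters are replaced by their summands. The summand of a set \<open>S\<close>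
  containing a fixed point \<open>v\<close> is determined up to a scalar by a sign rule under left
  multiplication and an invariance under right multiplication. Convolution with the class function
  \<open>q ^ cyc X g\<close> preserves both, so each summand is an eigenfunction. A pair
  \<open>(p, p')\<close> means convolving twice, which squares the eigenvalue and makes the roots
  double.

  After the surviving double roots are divided out, a root of \<open>(E - \<xi>) f\<close> with
  \<open>\<xi>\<close> on the unit circle equates two moduli, and on each side of the new axis one
  of them is strictly larger.

  All face counts have the parity of the degree \<open>N\<close> of the face polynomial, which is
  therefore \<open>q ^ N\<close> times the genus polynomial at \<open>1 / q ^ 2\<close>; a nonzero
  root \<open>i y\<close> becomes \<open>- 1 / y ^ 2\<close>. That \<open>N\<close> belongs to genus
  \<open>0\<close> follows from the exact degree: among the linear factors of \<open>g(E)\<close>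
  only those for the root \<open>1\<close> of \<open>g\<close>, of multiplicity
  \<open>cyc X \<rho> - 1\<close>, lower the degree, each by one.\<close>

text \<open>Under the product, \<open>y\<close> goes to \<open>p x\<close> and runs through the
  cycle of \<open>x\<close> until \<open>x\<close>, which goes to \<open>p y\<close>: a
  transposition across two cycles splices them into one.\<close>

lemma orbit_comp_transpose:
  assumes p: "permutation p" and xy: "y \<notin> orbit p x"
  shows "orbit (p \<circ> transpose x y) a =
    (if a \<in> orbit p x \<union> orbit p y then orbit p x \<union> orbit p y else orbit p a)"
proof -
  let ?q = "p \<circ> transpose x y" and ?U = "orbit p x \<union> orbit p y"
  have q: "permutation ?q" by (intro permutation_compose p permutation_swap_id)
  have self: "z \<in> orbit p z" "z \<in> orbit ?q z" for z
    using p q by (auto intro: permutation_self_in_orbit)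
  have yx: "x \<notin> orbit p y" using xy self(1) by (metis orbit_swap)
  have eq: "orbit f b = orbit f c" if "permutation f" "b \<in> orbit f c" for f :: "'a \<Rightarrow> 'a" and b c
    using that cyclic_on_orbit' orbit_cyclic_eq3 by metis
  have x1: "b \<in> orbit ?q y" if "b \<in> orbit p x" for b
    using that
  proof induction
    case base
    show ?case by (rule orbit_eqI(1)) simp
  next
    case (step b)
    have "b \<noteq> y" using step.hyps xy by blast
    show ?case
    proof (cases "b = x")
      case True
      show ?thesis by (rule orbit_eqI(1)) (simp add: True)
    next
      case False
      with \<open>b \<noteq> y\<close> show ?thesis by (intro orbit_eqI(2)[OF _ step.IH]) (simp add: transpose_def)
    qed
  qed
  have y1: "b \<in> orbit ?q x" if "b \<in> orbit p y" for b
    using that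
  proof induction
    case base
    show ?case by (rule orbit_eqI(1)) simp
  next
    case (step b)
    have "b \<noteq> x" using step.hyps yx by blast
    show ?case
    proof (cases "b = y")
      case True
      show ?thesis by (rule orbit_eqI(1)) (simp add: True)
    next
      case False
      with \<open>b \<noteq> x\<close> show ?thesis by (intro orbit_eqI(2)[OF _ step.IH]) (simp add: transpose_def)
    qed
  qed
  have "x \<in> orbit ?q y" using x1 self by blast
  then have xyq: "orbit ?q x = orbit ?q y" using eq[OF q] by blast
  have img: "?q b \<in> ?U" if "b \<in> ?U" for b
    using that orbit.intros self by (auto simp: transpose_def intro: orbit.intros)
  have sub: "b \<in> ?U" if "b \<in> orbit ?q c" "c \<in> ?U" for b c
    using that(1) by induction (use that(2) img in auto)
  have U: "orbit ?q x = ?U"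
  proof
    show "orbit ?q x \<subseteq> ?U" using sub[of _ x] self by blast
    show "?U \<subseteq> orbit ?q x" using x1 y1 xyq by blast
  qed
  show ?thesis
  proof (cases "a \<in> ?U")
    case True
    then have "orbit ?q a = orbit ?q x" using U eq[OF q] by blast
    then show ?thesis using True U by simp
  next
    case False
    have *: "b \<in> orbit p a \<Longrightarrow> b \<noteq> x \<and> b \<noteq> y" for b
      using False self by (metis UnI1 UnI2 eq p)
    have a: "a \<noteq> x" "a \<noteq> y" using False self by auto
    have "orbit ?q a = orbit p a"
    proof (rule orbit_cong0[where A = "orbit p a", symmetric])
      show "a \<in> orbit p a" by (rule self)
      show "p \<in> orbit p a \<rightarrow> orbit p a" by (auto intro: orbit.step)
      show "p z = ?q z" if "z \<in> orbit p a" for z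
        using *[OF that] by (simp add: transpose_def)
    qed
    then show ?thesis using False by simp
  qed
qed

definition cyc :: "'a set \<Rightarrow> ('a \<Rightarrow> 'a) \<Rightarrow> nat" where
  "cyc A p = card (orbit p ` A)"

lemma orbit_eq_iff:
  assumes "permutation p"
  shows "orbit p a = orbit p b \<longleftrightarrow> a \<in> orbit p b"
  using assms by (metis cyclic_on_orbit' orbit_cyclic_eq3 permutation_self_in_orbit)

lemma cyc_comp_transpose:
  assumes "finite A" "p permutes A" "x \<in> A" "y \<in> A" "y \<notin> orbit p x"
  shows "cyc A p = Suc (cyc A (p \<circ> transpose x y))"
proof -
  let ?q = "p \<circ> transpose x y" and ?U = "orbit p x \<union> orbit p y"
  have p: "permutation p" using assms(1,2) by (rule permutes_imp_permutation)
  note orb = orbit_comp_transpose[OF p assms(5)]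
  have self: "z \<in> orbit p z" for z using p by (rule permutation_self_in_orbit)
  have ne: "orbit p x \<noteq> orbit p y" using assms(5) self by auto
  have mem: "z \<in> ?U \<longleftrightarrow> orbit p z \<in> {orbit p x, orbit p y}" for z
    using orbit_eq_iff[OF p] by auto
  have "orbit ?q ` A = insert ?U (orbit p ` A - {orbit p x, orbit p y})"
    unfolding orb using mem assms(3) self by (auto simp: image_iff)
  moreover have "?U \<notin> orbit p ` A - {orbit p x, orbit p y}"
  proof
    assume "?U \<in> orbit p ` A - {orbit p x, orbit p y}"
    then obtain z where "orbit p z = ?U" "z \<notin> ?U" using mem by auto
    then show False using self by blast
  qed
  moreover have "card (orbit p ` A - {orbit p x, orbit p y}) = card (orbit p ` A) - 2"
    using ne assms(3,4) by (subst card_Diff_subset) auto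
  moreover have "card {orbit p x, orbit p y} \<le> card (orbit p ` A)"
    using assms(1,3,4) by (intro card_mono) auto
  ultimately show ?thesis
    using assms(1) ne by (simp add: cyc_def)
qed

lemma cyc_insert_fixed:
  assumes "finite A" "p permutes A" "x \<notin> A"
  shows "cyc (insert x A) p = Suc (cyc A p)"
proof -
  have "orbit p x = {x}"
    using permutes_not_in[OF assms(2,3)] by (simp add: orbit_eq_singleton_iff)
  moreover have "{x} \<notin> orbit p ` A"
    using permutes_orbit_subset[OF assms(2)] assms(3) by auto
  ultimately show ?thesis using assms(1) by (simp add: cyc_def)
qed

text \<open>\<open>x\<close> is a fixed point of \<open>p\<close>, and its singleton cycle is merged
  into that of \<open>y\<close>: inserting a point into an existing cycle does not change the count.
  The inductions below that add one point rest on this.\<close>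

lemma cyc_insert_transpose:
  assumes "finite A" "p permutes A" "x \<notin> A" "y \<in> A"
  shows "cyc (insert x A) (p \<circ> transpose x y) = cyc A p"
proof -
  have "orbit p x = {x}"
    using permutes_not_in[OF assms(2,3)] by (simp add: orbit_eq_singleton_iff)
  then have "y \<notin> orbit p x" using assms by auto
  then have "cyc (insert x A) p = Suc (cyc (insert x A) (p \<circ> transpose x y))"
    using assms by (intro cyc_comp_transpose) (auto intro: permutes_subset)
  then show ?thesis using cyc_insert_fixed[OF assms(1-3)] by simp
qed

text \<open>With \<open>y = inv p x\<close>, the product fixes \<open>x\<close> and sends
  \<open>y\<close> to \<open>p x\<close>: the point \<open>x\<close> is cut out of its
  cycle.\<close>

lemma permutes_insert_bypass:
  assumes "p permutes insert x A"
  shows "(p \<circ> transpose x (inv p x)) permutes A"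
proof (rule permutes_superset)
  have "inv p x \<in> insert x A"
    using permutes_inv[OF assms] permutes_in_image by (metis insertI1)
  then show "(p \<circ> transpose x (inv p x)) permutes insert x A"
    using assms by (intro permutes_compose permutes_swap_id) auto
next
  fix z assume "z \<in> insert x A - A"
  then show "(p \<circ> transpose x (inv p x)) z = z"
    using permutes_inverses(1)[OF assms] by auto
qed

lemma sum_permutes_insert:
  assumes "finite A" "x \<notin> A"
  shows "(\<Sum>p | p permutes insert x A. f p) =
    (\<Sum>p | p permutes A. \<Sum>y\<in>insert x A. f (p \<circ> transpose x y))"
proof -
  \<comment> \<open>Passing to inverses turns the left factor \<open>transpose x y\<close> of the
    known decomposition into a right factor.\<close>
  have "(\<Sum>p | p permutes insert x A. f p) = (\<Sum>p | p permutes insert x A. f (inv p))"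
    by (rule sum_permutations_inverse)
  also have "\<dots> = (\<Sum>y\<in>insert x A. \<Sum>p | p permutes A. f (inv (transpose x y \<circ> p)))"
    using assms by (rule sum_over_permutations_insert)
  also have "\<dots> = (\<Sum>p | p permutes A. \<Sum>y\<in>insert x A. f (inv p \<circ> transpose x y))"
    by (subst sum.swap)
      (auto intro!: sum.cong simp: o_inv_distrib permutes_bij bij_swap_iff)
  also have "\<dots> = (\<Sum>p | p permutes A. \<Sum>y\<in>insert x A. f (p \<circ> transpose x y))"
    by (rule sum_permutations_inverse[symmetric])
  finally show ?thesis .
qed

text \<open>Cutting out \<open>x\<close> removes either a fixed point, hence a cycle, or a
  transposition and no cycle; in both cases the two sides change by the same sign.\<close>

lemma sign_cyc:
  assumes "finite A" "p permutes A"
  shows "sign p * (-1) ^ cyc A p = (-1) ^ card A"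
  using assms
proof (induction A arbitrary: p rule: finite_induct)
  case empty
  then show ?case by (simp add: cyc_def)
next
  case (insert x A)
  define y where "y = inv p x"
  define p' where "p' = p \<circ> transpose x y"
  have p': "p' permutes A"
    unfolding p'_def y_def using insert.prems by (rule permutes_insert_bypass)
  have pp: "p = p' \<circ> transpose x y" by (simp add: p'_def comp_assoc)
  have sp: "sign p = sign p' * sign (transpose x y)"
    unfolding pp using insert.hyps(1) p'
    by (intro sign_compose permutes_imp_permutation permutation_swap_id) auto
  have IH: "sign p' * (-1) ^ cyc A p' = (-1) ^ card A" using p' by (rule insert.IH)
  show ?case
  proof (cases "y = x")
    case True
    then have "p = p'" by (simp add: pp)
    then show ?thesis using IH cyc_insert_fixed[OF insert.hyps(1) p' insert.hyps(2)] insert.hyps by simp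
  next
    case False
    have "y \<in> insert x A" using insert.prems unfolding y_def
      by (metis insertI1 permutes_in_image permutes_inv)
    then have "cyc (insert x A) p = cyc A p'"
      unfolding pp using False insert.hyps p' by (intro cyc_insert_transpose) auto
    then show ?thesis using False IH insert.hyps by (simp add: sp sign_swap_id)
  qed
qed

lemma orbit_conj:
  assumes "bij s"
  shows "orbit (s \<circ> g \<circ> inv s) (s a) = s ` orbit g a"
proof -
  have *: "((s \<circ> g \<circ> inv s) ^^ n) (s a) = s ((g ^^ n) a)" for n
    by (induction n) (simp_all add: inv_f_f[OF bij_is_inj[OF assms]])
  show ?thesis unfolding orbit_altdef * by blast
qed

lemma cyc_conj:
  assumes "s permutes A"
  shows "cyc A (s \<circ> g \<circ> inv s) = cyc A g"
proof -
  have "orbit (s \<circ> g \<circ> inv s) ` A = orbit (s \<circ> g \<circ> inv s) ` s ` A"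
    using permutes_image[OF assms] by simp
  also have "\<dots> = (`) s ` orbit g ` A"
    unfolding image_image using permutes_bij[OF assms] by (simp add: orbit_conj)
  finally show ?thesis
    unfolding cyc_def using permutes_inj[OF assms]
    by (simp add: card_image inj_on_def inj_image_eq_iff)
qed

lemma cyclic_on_iff_cyc:
  assumes "finite A" "p permutes A"
  shows "cyclic_on p A \<longleftrightarrow> cyc A p = 1"
proof
  assume "cyclic_on p A"
  then have "A \<noteq> {}" "\<forall>a\<in>A. orbit p a = A" unfolding cyclic_on_alldef by blast+
  then have "orbit p ` A = {A}" by blast
  then show "cyc A p = 1" by (simp add: cyc_def)
next
  assume "cyc A p = 1"
  then obtain C where C: "orbit p ` A = {C}" unfolding cyc_def by (auto simp: card_1_singleton_iff)
  then obtain a where a: "a \<in> A" by auto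
  have "orbit p a = A"
  proof
    show "orbit p a \<subseteq> A" using assms(2) a by (rule permutes_orbit_subset)
    show "A \<subseteq> orbit p a"
    proof
      fix b assume "b \<in> A"
      then have "orbit p b = orbit p a" using C a by blast
      then show "b \<in> orbit p a"
        using permutation_self_in_orbit[OF permutes_imp_permutation[OF assms]] by blast
    qed
  qed
  then show "cyclic_on p A" using a by (auto simp: cyclic_on_def)
qed

section \<open>Hook functions on the symmetric group\<close>

text \<open>
  At most one summand is nonzero. For \<open>k = card S - 1\<close>, the sum over all \<open>S\<close> of size \<open>k + 1\<close> with
  \<open>v \<in> S\<close> is the character of the \<open>k\<close>-th exterior power of the standard representation.
\<close>

definition hook_fun :: "'a \<Rightarrow> 'a set \<Rightarrow> ('a \<Rightarrow> 'a) \<Rightarrow> int" where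
  "hook_fun v S y = (\<Sum>h | h permutes S \<and> (\<forall>r\<in>S - {v}. h r = y r). sign h)"

text \<open>\<open>inv h' \<circ> h\<close> fixes every point of \<open>S\<close> except possibly
  \<open>v\<close>, and then it fixes \<open>v\<close> as well.\<close>

lemma permutes_eqI_except:
  assumes "h permutes S" "h' permutes S" "\<forall>r\<in>S - {v}. h r = h' r"
  shows "h = h'"
proof -
  have "inv h' \<circ> h permutes S" using assms(1,2) by (intro permutes_compose permutes_inv)
  then have "inv h' \<circ> h permutes {v}"
  proof (rule permutes_superset)
    fix x assume "x \<in> S - {v}"
    then show "(inv h' \<circ> h) x = x" using assms(3) permutes_inverses(2)[OF assms(2)] by simp
  qed
  then have "inv h' (h x) = x" for x by (simp add: fun_eq_iff)
  then show ?thesis using permutes_inverses(1)[OF assms(2)] by (metis ext)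
qed

lemma hook_fun_cong:
  assumes "\<And>r. r \<in> S - {v} \<Longrightarrow> y r = y' r"
  shows "hook_fun v S y = hook_fun v S y'"
  unfolding hook_fun_def using assms by (intro sum.cong) auto

lemma hook_fun_eq_sign:
  assumes "h permutes S" "\<forall>r\<in>S - {v}. h r = y r"
  shows "hook_fun v S y = sign h"
proof -
  have "{h. h permutes S \<and> (\<forall>r\<in>S - {v}. h r = y r)} = {h}"
  proof (intro equalityI subsetI)
    fix h' assume h': "h' \<in> {h. h permutes S \<and> (\<forall>r\<in>S - {v}. h r = y r)}"
    then have "h' = h" using assms by (intro permutes_eqI_except[where v = v and S = S]) auto
    then show "h' \<in> {h}" by simp
  qed (use assms in auto)
  then show ?thesis by (simp add: hook_fun_def)
qed

lemma hook_fun_eq_0: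
  assumes "r \<in> S - {v}" "y r \<notin> S"
  shows "hook_fun v S y = 0"
proof -
  have "\<not> (\<forall>r\<in>S - {v}. h r = y r)" if "h permutes S" for h
    using assms permutes_in_image[OF that, of r] by (metis DiffD1)
  then have "{h. h permutes S \<and> (\<forall>r\<in>S - {v}. h r = y r)} = {}" by auto
  then show ?thesis unfolding hook_fun_def by (simp only: sum.empty)
qed

lemma hook_fun_self: "y permutes S \<Longrightarrow> hook_fun v S y = sign y"
  by (rule hook_fun_eq_sign) auto

lemma hook_fun_comp_left:
  assumes "finite S" "s permutes S"
  shows "hook_fun v S (s \<circ> y) = sign s * hook_fun v S y"
proof -
  have [simp]: "s \<circ> (inv s \<circ> h) = h" for h :: "'a \<Rightarrow> 'a"
    using permutes_inverses[OF assms(2)] by (simp add: fun_eq_iff)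
  have "hook_fun v S (s \<circ> y) =
    (\<Sum>h | h permutes S \<and> (\<forall>r\<in>S - {v}. h r = y r). sign (s \<circ> h))"
    unfolding hook_fun_def
    by (rule sum.reindex_bij_witness[of _ "\<lambda>h. s \<circ> h" "\<lambda>h. inv s \<circ> h"])
      (use assms permutes_inverses[OF assms(2)] in
        \<open>auto simp: fun_eq_iff intro!: permutes_compose permutes_inv\<close>)
  also have "\<dots> = (\<Sum>h | h permutes S \<and> (\<forall>r\<in>S - {v}. h r = y r). sign s * sign h)"
    using assms by (intro sum.cong) (auto intro!: sign_compose intro: permutes_imp_permutation)
  finally show ?thesis by (simp add: hook_fun_def sum_distrib_left)
qed

text \<open>By counting, exactly one element of \<open>S\<close> is not a value of \<open>y\<close>
  on \<open>S - {v}\<close>; it must be the value at \<open>v\<close>.\<close>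

lemma hook_fun_extend:
  assumes "finite S" "v \<in> S" "inj_on y (S - {v})" "y ` (S - {v}) \<subseteq> S"
  obtains h where "h permutes S" "\<forall>r\<in>S - {v}. h r = y r"
proof -
  let ?R = "S - {v}"
  have "card (S - y ` ?R) = 1"
    using assms card_image[OF assms(3)] card_gt_0_iff[of S]
    by (auto simp: card_Diff_subset)
  then obtain w where w: "S - y ` ?R = {w}" by (auto simp: card_1_singleton_iff)
  define h where "h = (\<lambda>x. if x = v then w else if x \<in> ?R then y x else x)"
  have "h ` S = insert (h v) (h ` ?R)" using assms(2) by blast
  also have "h ` ?R = y ` ?R" by (intro image_cong) (auto simp: h_def)
  also have "insert (h v) (y ` ?R) = S" using w assms(4) by (auto simp: h_def)
  finally have "h ` S = S" .
  then have "bij_betw h S S" using assms(1) by (simp add: bij_betw_def eq_card_imp_inj_on)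
  then have "h permutes S" by (rule bij_imp_permutes) (use assms(2) in \<open>auto simp: h_def\<close>)
  moreover have "\<forall>r\<in>?R. h r = y r" by (simp add: h_def)
  ultimately show ?thesis by (rule that)
qed

text \<open>The double coset argument behind Young symmetrizers, for the hook with column
  \<open>S\<close> and row \<open>X - (S - {v})\<close>, which share \<open>v\<close>. If
  \<open>y\<close> maps \<open>S - {v}\<close> into \<open>S\<close>, it is a column permutation
  times a row permutation, and the two rules determine \<open>\<Phi> y\<close>. Otherwise some
  transposition of the row, moved across \<open>y\<close>, becomes a transposition of the column, so
  \<open>\<Phi> y = - \<Phi> y\<close>.\<close>

lemma hook_fun_unique:
  fixes \<Phi> :: "('a \<Rightarrow> 'a) \<Rightarrow> 'r :: {idom, ring_char_0}"
  assumes fin: "finite X" and S: "v \<in> S" "S \<subseteq> X"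
    and left: "\<And>s y. s permutes S \<Longrightarrow> y permutes X \<Longrightarrow> \<Phi> (s \<circ> y) = of_int (sign s) * \<Phi> y"
    and right: "\<And>t y. t permutes X - (S - {v}) \<Longrightarrow> y permutes X \<Longrightarrow> \<Phi> (y \<circ> t) = \<Phi> y"
    and y: "y permutes X"
  shows "\<Phi> y = \<Phi> id * of_int (hook_fun v S y)"
proof (cases "y ` (S - {v}) \<subseteq> S")
  case True
  have finS: "finite S" using fin S finite_subset by blast
  obtain h where h: "h permutes S" "\<forall>r\<in>S - {v}. h r = y r"
    using hook_fun_extend[OF finS S(1) permutes_inj_on[OF y] True] .
  have hX: "h permutes X" using h(1) S(2) by (rule permutes_subset)
  have "inv h \<circ> y permutes X" using y hX by (intro permutes_compose permutes_inv)
  then have t: "inv h \<circ> y permutes X - (S - {v})"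
  proof (rule permutes_superset)
    fix x assume "x \<in> X - (X - (S - {v}))"
    then have "h x = y x" using h(2) by auto
    then show "(inv h \<circ> y) x = x" using permutes_inverses(2)[OF h(1)] by (metis comp_apply)
  qed
  have "y = h \<circ> (id \<circ> (inv h \<circ> y))" using permutes_inverses(1)[OF h(1)] by (auto simp: fun_eq_iff)
  then have "\<Phi> y = of_int (sign h) * \<Phi> (id \<circ> (inv h \<circ> y))"
    using left[OF h(1), of "id \<circ> (inv h \<circ> y)"] \<open>inv h \<circ> y permutes X\<close> by simp
  also have "\<Phi> (id \<circ> (inv h \<circ> y)) = \<Phi> id" by (rule right[OF t permutes_id])
  finally show ?thesis using hook_fun_eq_sign[OF h] by simp
next
  case False
  then obtain r where r: "r \<in> S - {v}" "y r \<notin> S" by auto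
  have finS: "finite S" using fin S finite_subset by blast
  let ?T = "inv y ` S"
  have cT: "card ?T = card S"
    using permutes_inj_on[OF permutes_inv[OF y]] by (rule card_image)
  have yT: "a \<in> ?T \<longleftrightarrow> y a \<in> S" for a
    using permutes_inverses[OF y] by (metis image_iff)
  \<comment> \<open>Pigeonhole: \<open>?T\<close> has as many points as \<open>S\<close> but misses
    a point of \<open>S - {v}\<close>, so at least two of its points lie outside
    \<open>S - {v}\<close>.\<close>
  have "?T \<inter> (S - {v}) \<subset> S - {v}" using r yT by auto
  then have "card (?T \<inter> (S - {v})) < card (S - {v})" using finS by (intro psubset_card_mono) auto
  moreover have "card ?T = card (?T \<inter> (S - {v})) + card (?T - (S - {v}))"
    using finS by (intro card_Int_Diff) auto
  moreover have "card (S - {v}) = card S - 1" "card S > 0" using finS S(1) by (auto simp: card_gt_0_iff)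
  ultimately have "2 \<le> card (?T - (S - {v}))" using cT by linarith
  then have "\<not> card (?T - (S - {v})) \<le> Suc 0" by simp
  then obtain a b where ab: "a \<in> ?T - (S - {v})" "b \<in> ?T - (S - {v})" "a \<noteq> b"
    using finS by (auto simp: card_le_Suc0_iff_eq)
  have "y a \<in> X" "y b \<in> X" using ab S(2) yT by blast+
  then have abX: "a \<in> X" "b \<in> X" by (simp_all add: permutes_in_image[OF y])
  have "\<Phi> y = \<Phi> (y \<circ> transpose a b)"
    using ab abX y by (intro right[symmetric] permutes_swap_id) auto
  also have "y \<circ> transpose a b = transpose (y a) (y b) \<circ> y"
    using permutes_inj[OF y] by (auto simp: fun_eq_iff transpose_def inj_eq)
  also have "\<Phi> \<dots> = of_int (sign (transpose (y a) (y b))) * \<Phi> y"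
    using ab yT y by (intro left permutes_swap_id) auto
  also have "sign (transpose (y a) (y b)) = -1"
    using ab(3) permutes_inj[OF y] by (simp add: sign_swap_id inj_eq)
  finally have "2 * \<Phi> y = 0" by simp
  then have "\<Phi> y = 0" by simp
  then show ?thesis using hook_fun_eq_0[where r = r and y = y, OF r] by simp
qed

section \<open>Eigenvalues of convolution with the cycle enumerator\<close>

text \<open>A new point is a fixed point, with factor \<open>q\<close>, or is inserted into a cycle
  in one of \<open>card A\<close> ways, each of which reverses the sign: the total factor is
  \<open>q - card A\<close>.\<close>

lemma sum_sign_cyc:
  fixes q :: "'r :: comm_ring_1"
  assumes "finite S"
  shows "(\<Sum>g | g permutes S. of_int (sign g) * q ^ cyc S g) = pochhammer (q + 1 - of_nat (card S)) (card S)"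
  using assms
proof (induction S rule: finite_induct)
  case empty
  then show ?case by (simp add: cyc_def)
next
  case (insert x A)
  have "(\<Sum>y\<in>insert x A. of_int (sign (g \<circ> transpose x y)) * q ^ cyc (insert x A) (g \<circ> transpose x y)) =
      (q - of_nat (card A)) * (of_int (sign g) * q ^ cyc A g)" if g: "g permutes A" for g
  proof -
    have "of_int (sign (g \<circ> transpose x y)) * q ^ cyc (insert x A) (g \<circ> transpose x y) =
      - (of_int (sign g) * q ^ cyc A g)" if "y \<in> A" for y
    proof -
      have "sign (g \<circ> transpose x y) = sign g * sign (transpose x y)"
        using insert.hyps(1) g by (intro sign_compose permutes_imp_permutation permutation_swap_id) auto
      then have "sign (g \<circ> transpose x y) = - sign g"
        using insert.hyps that by (auto simp: sign_swap_id)
      then show ?thesis using cyc_insert_transpose[OF insert.hyps(1) g insert.hyps(2) that] by simp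
    qed
    then show ?thesis
      using insert.hyps cyc_insert_fixed[OF insert.hyps(1) g insert.hyps(2)]
      by (simp add: algebra_simps)
  qed
  then have "(\<Sum>g | g permutes insert x A. of_int (sign g) * q ^ cyc (insert x A) g) =
     (q - of_nat (card A)) * (\<Sum>g | g permutes A. of_int (sign g) * q ^ cyc A g)"
    using insert.hyps by (simp add: sum_permutes_insert sum_distrib_left)
  also have "\<dots> = (q - of_nat (card A)) * pochhammer (q - of_nat (card A) + 1) (card A)"
    by (simp add: insert.IH algebra_simps)
  finally show ?case using insert.hyps by (simp add: pochhammer_rec)
qed

text \<open>The value is the content product of the hook: \<open>S\<close> supplies the contents
  from \<open>0\<close> down to \<open>1 - card S\<close>, and \<open>Y\<close> those from
  \<open>1\<close> to \<open>card Y\<close>. A point added to the row may be fixed or inserted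
  behind \<open>v\<close> or a row point; behind a point of \<open>S - {v}\<close> it would lead
  that point out of \<open>S\<close> and annihilate \<open>hook_fun\<close>.\<close>

lemma sum_hook_fun_cyc:
  fixes q :: "'r :: comm_ring_1"
  assumes "finite Y" "finite S" "v \<in> S" "S \<inter> Y = {}"
  shows "(\<Sum>g | g permutes S \<union> Y. q ^ cyc (S \<union> Y) g * of_int (hook_fun v S g)) =
    pochhammer (q + 1 - of_nat (card S)) (card S + card Y)"
  using assms(1,4)
proof (induction Y rule: finite_induct)
  case empty
  have "(\<Sum>g | g permutes S. q ^ cyc S g * of_int (hook_fun v S g)) =
        (\<Sum>g | g permutes S. of_int (sign g) * q ^ cyc S g)"
    by (intro sum.cong) (auto simp: hook_fun_self mult.commute)
  then show ?case using sum_sign_cyc[OF assms(2)] by simp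
next
  case (insert x Y)
  let ?A = "S \<union> Y"
  have A: "finite ?A" "x \<notin> ?A" using insert assms(2) by auto
  have cA: "card (?A - (S - {v})) = Suc (card Y)"
  proof -
    have "?A - (S - {v}) = insert v Y" using assms(3) insert.prems by auto
    moreover have "v \<notin> Y" using assms(3) insert.prems by auto
    ultimately show ?thesis using insert.hyps by simp
  qed
  have "(\<Sum>y\<in>insert x ?A. q ^ cyc (insert x ?A) (g \<circ> transpose x y) * of_int (hook_fun v S (g \<circ> transpose x y))) =
      (q + of_nat (Suc (card Y))) * (q ^ cyc ?A g * of_int (hook_fun v S g))" if g: "g permutes ?A" for g
  proof -
    have "q ^ cyc (insert x ?A) (g \<circ> transpose x y) * of_int (hook_fun v S (g \<circ> transpose x y)) =
      (if y \<in> ?A - (S - {v}) then q ^ cyc ?A g * of_int (hook_fun v S g) else 0)" if y: "y \<in> ?A" for y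
    proof (cases "y \<in> S - {v}")
      case True
      have "(g \<circ> transpose x y) y \<notin> S"
        using A(2) permutes_not_in[OF g A(2)] by simp
      then have "hook_fun v S (g \<circ> transpose x y) = 0" using True by (intro hook_fun_eq_0)
      then show ?thesis using True by simp
    next
      case False
      have "hook_fun v S (g \<circ> transpose x y) = hook_fun v S g"
        using False A(2) by (intro hook_fun_cong) (auto simp: transpose_def)
      then show ?thesis using False y cyc_insert_transpose[OF A(1) g A(2) y] by simp
    qed
    then have "(\<Sum>y\<in>?A. q ^ cyc (insert x ?A) (g \<circ> transpose x y) * of_int (hook_fun v S (g \<circ> transpose x y))) =
      (\<Sum>y\<in>?A. if y \<in> ?A - (S - {v}) then q ^ cyc ?A g * of_int (hook_fun v S g) else 0)"
      by (rule sum.cong[OF refl])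
    also have "\<dots> = (\<Sum>y\<in>?A - (S - {v}). q ^ cyc ?A g * of_int (hook_fun v S g))"
      using A(1) by (intro sum.mono_neutral_cong_right) auto
    finally show ?thesis
      using A cyc_insert_fixed[OF A(1) g A(2)] cA by (simp add: algebra_simps)
  qed
  then have "(\<Sum>g | g permutes insert x ?A. q ^ cyc (insert x ?A) g * of_int (hook_fun v S g)) =
     (q + of_nat (Suc (card Y))) * (\<Sum>g | g permutes ?A. q ^ cyc ?A g * of_int (hook_fun v S g))"
    using A by (simp add: sum_permutes_insert sum_distrib_left)
  also have "\<dots> = (q + of_nat (Suc (card Y))) * pochhammer (q + 1 - of_nat (card S)) (card S + card Y)"
    using insert by simp
  also have "\<dots> = pochhammer (q + 1 - of_nat (card S)) (Suc (card S + card Y))"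
    by (simp add: pochhammer_Suc algebra_simps)
  finally show ?case using insert.hyps by simp
qed

text \<open>Conjugation invariance of \<open>cyc X\<close> carries the left sign rule through the
  convolution, and the right invariance is immediate, so \<open>hook_fun_unique\<close> applies. The
  eigenvalue is read off at \<open>id\<close>.\<close>

lemma hook_fun_convolution:
  fixes q :: "'r :: {idom, ring_char_0}"
  assumes fin: "finite X" and S: "v \<in> S" "S \<subseteq> X" and y: "y permutes X"
  shows "(\<Sum>g | g permutes X. q ^ cyc X g * of_int (hook_fun v S (g \<circ> y))) =
    pochhammer (q + 1 - of_nat (card S)) (card X) * of_int (hook_fun v S y)"
proof -
  let ?\<Phi> = "\<lambda>y. \<Sum>g | g permutes X. q ^ cyc X g * of_int (hook_fun v S (g \<circ> y)) :: 'r"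
  have finS: "finite S" using fin S finite_subset by blast
  have "?\<Phi> y = ?\<Phi> id * of_int (hook_fun v S y)"
  proof (rule hook_fun_unique[OF fin S _ _ y])
    fix s y assume s: "s permutes S"
    have sX: "s permutes X" using s S(2) by (rule permutes_subset)
    have "?\<Phi> (s \<circ> y) = (\<Sum>g | g permutes X. q ^ cyc X g * of_int (hook_fun v S (s \<circ> (g \<circ> y))))"
    proof (rule sum.reindex_bij_witness[of _ "\<lambda>g. s \<circ> g \<circ> inv s" "\<lambda>g. inv s \<circ> g \<circ> s"])
      fix g assume "g \<in> {g. g permutes X}"
      then have g: "g permutes X" by simp
      note ss = permutes_inverses[OF sX]
      show "s \<circ> (inv s \<circ> g \<circ> s) \<circ> inv s = g" "inv s \<circ> (s \<circ> g \<circ> inv s) \<circ> s = g"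
        by (auto simp: fun_eq_iff ss)
      show "inv s \<circ> g \<circ> s \<in> {g. g permutes X}" "s \<circ> g \<circ> inv s \<in> {g. g permutes X}"
        using g sX by (auto intro!: permutes_compose permutes_inv)
      have "cyc X (inv s \<circ> g \<circ> s) = cyc X g"
        using cyc_conj[OF permutes_inv[OF sX], of g] permutes_inv_inv[OF sX] by simp
      moreover have "s \<circ> (inv s \<circ> g \<circ> s \<circ> y) = g \<circ> (s \<circ> y)" by (auto simp: fun_eq_iff ss)
      ultimately show "q ^ cyc X (inv s \<circ> g \<circ> s) * of_int (hook_fun v S (s \<circ> (inv s \<circ> g \<circ> s \<circ> y))) =
        q ^ cyc X g * of_int (hook_fun v S (g \<circ> (s \<circ> y)))" by simp
    qed
    then show "?\<Phi> (s \<circ> y) = of_int (sign s) * ?\<Phi> y"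
      by (simp add: hook_fun_comp_left[OF finS s] sum_distrib_left mult_ac)
  next
    fix t y :: "'a \<Rightarrow> 'a" assume t: "t permutes X - (S - {v})"
    have "hook_fun v S (g \<circ> (y \<circ> t)) = hook_fun v S (g \<circ> y)" for g
      using permutes_not_in[OF t] by (intro hook_fun_cong) auto
    then show "?\<Phi> (y \<circ> t) = ?\<Phi> y" by simp
  qed
  also have "?\<Phi> id = pochhammer (q + 1 - of_nat (card S)) (card X)"
    using sum_hook_fun_cyc[of "X - S" S v q] fin finS S
    by (simp add: Un_absorb1 card_Diff_subset card_mono)
  finally show ?thesis .
qed

section \<open>Generating function of the hook values of one permutation\<close>

lemma sign_cyclic_on:
  assumes "finite A" "p permutes A" "cyclic_on p A"
  shows "sign p = - ((-1) ^ card A)"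
  using sign_cyc[OF assms(1,2)] assms(3) cyclic_on_iff_cyc[OF assms(1,2)] by simp

text \<open>A permutation of \<open>S \<union> C\<close> that agrees with \<open>\<rho>\<close> off
  \<open>v\<close> coincides with \<open>\<rho>\<close> on \<open>C\<close>, because
  \<open>v \<notin> C\<close>. It is therefore a permutation of \<open>S\<close> times one full
  cycle of \<open>C\<close>, whose sign is the factor.\<close>

lemma hook_fun_Un_orbit:
  assumes "finite S" "v \<in> S" and \<rho>: "permutation \<rho>" and C: "C = orbit \<rho> x" "S \<inter> C = {}"
  shows "hook_fun v (S \<union> C) \<rho> = - ((-1) ^ card C) * hook_fun v S \<rho>"
proof -
  have cyc: "cyclic_on \<rho> C" unfolding C using \<rho> by (rule cyclic_on_orbit')
  have finC: "finite C" using cyc by (rule finite_cyclic_on)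
  define c where "c = perm_restrict \<rho> C"
  have "\<rho> ` C \<subseteq> C" using cyclic_on_inI[OF cyc] by blast
  moreover have "inj_on \<rho> C"
    using \<rho> by (meson bij_is_inj inj_on_subset permutation_bijective subset_UNIV)
  ultimately have "bij_betw \<rho> C C"
    using finC by (simp add: bij_betw_def endo_inj_surj)
  then have "bij_betw c C C" by (subst bij_betw_cong[of _ _ \<rho>]) (auto simp: c_def perm_restrict_simps)
  then have c: "c permutes C" by (rule bij_imp_permutes) (simp add: c_def perm_restrict_simps)
  have "cyclic_on c C" using cyc by (simp add: c_def cyclic_on_perm_restrict)
  then have sc: "sign c = - ((-1) ^ card C)" using finC c by (intro sign_cyclic_on)
  have cS: "c z = z" "inv c z = z" if "z \<in> S" for z
    using that C(2) permutes_not_in[OF c] permutes_not_in[OF permutes_inv[OF c]] by auto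
  show ?thesis
  proof (cases "\<exists>h. h permutes S \<and> (\<forall>r\<in>S - {v}. h r = \<rho> r)")
    case True
    then obtain h where h: "h permutes S" "\<forall>r\<in>S - {v}. h r = \<rho> r" by blast
    have "h \<circ> c permutes S \<union> C"
      using h(1) c by (intro permutes_compose) (auto intro: permutes_subset)
    moreover have "\<forall>r\<in>S \<union> C - {v}. (h \<circ> c) r = \<rho> r"
    proof
      fix r assume r: "r \<in> S \<union> C - {v}"
      show "(h \<circ> c) r = \<rho> r"
      proof (cases "r \<in> S")
        case True
        then show ?thesis using r h(2) cS by simp
      next
        case False
        then have "r \<in> C" using r by auto
        then have "c r = \<rho> r" "\<rho> r \<in> C" using cyclic_on_inI[OF cyc] by (auto simp: c_def perm_restrict_simps)
        then show ?thesis using C(2) permutes_not_in[OF h(1)] by auto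
      qed
    qed
    ultimately have "hook_fun v (S \<union> C) \<rho> = sign (h \<circ> c)" by (rule hook_fun_eq_sign)
    also have "\<dots> = sign h * sign c"
      using h(1) c assms(1) finC by (intro sign_compose) (auto intro: permutes_imp_permutation)
    finally show ?thesis using sc hook_fun_eq_sign[OF h] by simp
  next
    case False
    have "\<not> (h permutes S \<union> C \<and> (\<forall>r\<in>S \<union> C - {v}. h r = \<rho> r))" for h
    proof
      assume h: "h permutes S \<union> C \<and> (\<forall>r\<in>S \<union> C - {v}. h r = \<rho> r)"
      have "h \<circ> inv c permutes S \<union> C"
        using h c by (intro permutes_compose) (auto intro: permutes_subset permutes_inv)
      then have "h \<circ> inv c permutes S"
      proof (rule permutes_superset)
        fix z assume "z \<in> S \<union> C - S"
        then have z: "z \<in> C" by auto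
        have izC: "inv c z \<in> C" using z permutes_in_image[OF permutes_inv[OF c]] by simp
        then have "inv c z \<noteq> v" using C(2) assms(2) by auto
        then have "h (inv c z) = \<rho> (inv c z)" using h izC by auto
        also have "\<dots> = c (inv c z)" using izC by (simp add: c_def perm_restrict_simps)
        also have "\<dots> = z" by (rule permutes_inverses(1)[OF c])
        finally show "(h \<circ> inv c) z = z" by simp
      qed
      moreover have "\<forall>r\<in>S - {v}. (h \<circ> inv c) r = \<rho> r" using h cS by simp
      ultimately show False using False by blast
    qed
    then have *: "{h. h permutes S \<union> C \<and> (\<forall>r\<in>S \<union> C - {v}. h r = \<rho> r)} = {}" by blast
    have **: "{h. h permutes S \<and> (\<forall>r\<in>S - {v}. h r = \<rho> r)} = {}" using False by blast
    show ?thesis unfolding hook_fun_def * ** by simp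
  qed
qed

text \<open>The exponent is the index \<open>k\<close> of the hook, so that \<open>t\<close> can
  later be read as the shift; the sign \<open>(-1) ^ k\<close> is the one with which that hook
  enters the indicator of the full cycles.\<close>

definition hook_weight :: "'a \<Rightarrow> ('a \<Rightarrow> 'a) \<Rightarrow> 'r :: comm_ring_1 \<Rightarrow> 'a set \<Rightarrow> 'r" where
  "hook_weight v \<rho> t S = (- t) ^ (card S - 1) * of_int (hook_fun v S \<rho>)"

text \<open>Only sets containing all or nothing of the cycle \<open>C\<close> count: otherwise
  \<open>\<rho>\<close> leads some point of \<open>S \<inter> C\<close>, which is not
  \<open>v\<close>, out of \<open>S\<close>. Adding \<open>C\<close> to a set multiplies its weight
  by \<open>- (t ^ card C)\<close>.\<close>

lemma sum_hook_weight_Un_orbit: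
  fixes t :: "'r :: comm_ring_1"
  assumes fin: "finite B" and v: "v \<in> B" and \<rho>: "permutation \<rho>" and C: "C = orbit \<rho> x" "B \<inter> C = {}"
  shows "(\<Sum>S | v \<in> S \<and> S \<subseteq> B \<union> C. hook_weight v \<rho> t S) =
    (\<Sum>S | v \<in> S \<and> S \<subseteq> B. hook_weight v \<rho> t S) * (1 - t ^ card C)"
proof -
  have cyc: "cyclic_on \<rho> C" unfolding C using \<rho> by (rule cyclic_on_orbit')
  have finC: "finite C" using cyc by (rule finite_cyclic_on)
  have vC: "v \<notin> C" using v C(2) by auto
  have C0: "card C > 0" using finC C(1) by (auto simp: card_gt_0_iff orbit_nonempty)
  let ?M = "{S. v \<in> S \<and> S \<subseteq> B}"
  have finM: "finite ?M" using fin by (auto intro: finite_subset[of _ "Pow B"])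
  have zero: "hook_weight v \<rho> t S = 0" if "v \<in> S" "S \<inter> C \<noteq> {}" "\<not> C \<subseteq> S" for S
  proof -
    from that(2) obtain a where a: "a \<in> S" "a \<in> C" by blast
    have "\<exists>r \<in> S \<inter> C. \<rho> r \<notin> S"
    proof (rule ccontr)
      assume "\<not> ?thesis"
      then have cl: "\<rho> r \<in> S" if "r \<in> S" "r \<in> C" for r using that by blast
      have "b \<in> S" if "b \<in> orbit \<rho> a" for b
        using that
      proof induction
        case base
        show ?case using cl a by blast
      next
        case (step b)
        then have "b \<in> C" using a cyc by (metis orbit_cyclic_eq3)
        then show ?case using cl step by blast
      qed
      moreover have "orbit \<rho> a = C" using cyc a(2) by (rule orbit_cyclic_eq3)
      ultimately show False using that(3) by blast
    qed
    then obtain r where r: "r \<in> S" "r \<in> C" "\<rho> r \<notin> S" by blast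
    then have "r \<in> S - {v}" using vC by auto
    then have "hook_fun v S \<rho> = 0" using r(3) by (rule hook_fun_eq_0)
    then show ?thesis by (simp add: hook_weight_def)
  qed
  have w: "hook_weight v \<rho> t (S \<union> C) = - (t ^ card C) * hook_weight v \<rho> t S" if S: "S \<in> ?M" for S
  proof -
    have finS: "finite S" using S fin finite_subset by blast
    have "S \<inter> C = {}" using S C(2) by auto
    moreover have "card S > 0" using finS S by (auto simp: card_gt_0_iff)
    ultimately have "card (S \<union> C) - 1 = (card S - 1) + card C"
      using finS finC by (simp add: card_Un_disjoint)
    moreover have "hook_fun v (S \<union> C) \<rho> = - ((-1) ^ card C) * hook_fun v S \<rho>"
      using finS S \<rho> C(1) \<open>S \<inter> C = {}\<close> by (intro hook_fun_Un_orbit) auto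
    ultimately have "hook_weight v \<rho> t (S \<union> C) =
      - (((-1) ^ card C * (- t) ^ card C) * ((- t) ^ (card S - 1) * of_int (hook_fun v S \<rho>)))"
      by (simp add: hook_weight_def power_add mult_ac)
    also have "(-1) ^ card C * (- t) ^ card C = t ^ card C"
      by (simp flip: power_mult_distrib)
    finally show ?thesis by (simp add: hook_weight_def)
  qed
  have "(\<Sum>S | v \<in> S \<and> S \<subseteq> B \<union> C. hook_weight v \<rho> t S) =
    (\<Sum>S\<in>?M \<union> (\<lambda>S. S \<union> C) ` ?M. hook_weight v \<rho> t S)"
  proof (rule sum.mono_neutral_right)
    show "finite {S. v \<in> S \<and> S \<subseteq> B \<union> C}"
      using fin finC by (auto intro: finite_subset[of _ "Pow (B \<union> C)"])
    show "?M \<union> (\<lambda>S. S \<union> C) ` ?M \<subseteq> {S. v \<in> S \<and> S \<subseteq> B \<union> C}" by auto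
    show "\<forall>S\<in>{S. v \<in> S \<and> S \<subseteq> B \<union> C} - (?M \<union> (\<lambda>S. S \<union> C) ` ?M). hook_weight v \<rho> t S = 0"
    proof
      fix S assume S: "S \<in> {S. v \<in> S \<and> S \<subseteq> B \<union> C} - (?M \<union> (\<lambda>S. S \<union> C) ` ?M)"
      have "S \<inter> C \<noteq> {}" using S by auto
      moreover have "\<not> C \<subseteq> S"
      proof
        assume "C \<subseteq> S"
        then have "S = (S - C) \<union> C" by auto
        moreover have "S - C \<in> ?M" using S vC by auto
        ultimately show False using S by blast
      qed
      ultimately show "hook_weight v \<rho> t S = 0" using S by (intro zero) auto
    qed
  qed
  also have "\<dots> = (\<Sum>S\<in>?M. hook_weight v \<rho> t S) + (\<Sum>S\<in>(\<lambda>S. S \<union> C) ` ?M. hook_weight v \<rho> t S)"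
  proof (rule sum.union_disjoint)
    show "?M \<inter> (\<lambda>S. S \<union> C) ` ?M = {}"
    proof (rule ccontr)
      assume "\<not> ?thesis"
      then obtain S where "S \<union> C \<subseteq> B" by auto
      then have "C = {}" using C(2) by blast
      then show False using C0 by simp
    qed
  qed (use finM in auto)
  also have "(\<Sum>S\<in>(\<lambda>S. S \<union> C) ` ?M. hook_weight v \<rho> t S) = (\<Sum>S\<in>?M. hook_weight v \<rho> t (S \<union> C))"
  proof (subst sum.reindex)
    show "inj_on (\<lambda>S. S \<union> C) ?M" using C(2) by (intro inj_onI) blast
  qed simp
  also have "\<dots> = - (t ^ card C) * (\<Sum>S\<in>?M. hook_weight v \<rho> t S)"
    using w by (simp add: sum_distrib_left)
  finally show ?thesis by (simp add: algebra_simps)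
qed

text \<open>On the cycle of \<open>v\<close>, the set \<open>S\<close> may be left only at
  \<open>v\<close>, so the surviving sets are the segments of the cycle that end at
  \<open>v\<close>. For a segment of \<open>j + 1\<close> points the extension is a full cycle of
  sign \<open>(-1) ^ j\<close>; the weight is \<open>t ^ j\<close> and the sum is geometric.\<close>

lemma sum_hook_weight_orbit:
  fixes t :: "'r :: comm_ring_1"
  assumes \<rho>: "permutation \<rho>"
  shows "(1 - t) * (\<Sum>S | v \<in> S \<and> S \<subseteq> orbit \<rho> v. hook_weight v \<rho> t S) = 1 - t ^ card (orbit \<rho> v)"
proof -
  let ?C = "orbit \<rho> v"
  define l where "l = funpow_dist1 (inv \<rho>) v v"
  \<comment> \<open>The cycle is listed backwards from \<open>v\<close>: \<open>\<rho>\<close> sends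
    \<open>e (Suc i)\<close> to \<open>e i\<close>, so a set that \<open>\<rho>\<close> leaves only
    at \<open>v\<close> is an initial segment of the list.\<close>
  define e where "e i = (inv \<rho> ^^ i) v" for i
  have \<rho>': "permutation (inv \<rho>)" using \<rho> by (rule permutation_inverse)
  have inv: "\<rho> (inv \<rho> z) = z" for z
    using permutation_bijective[OF \<rho>] by (simp add: bij_is_surj surj_f_inv_f)
  have inj: "inj \<rho>" using permutation_bijective[OF \<rho>] by (rule bij_is_inj)
  have self: "v \<in> orbit (inv \<rho>) v" using \<rho>' by (rule permutation_self_in_orbit)
  have orb: "?C = e ` {..<l}"
    using orbit_conv_funpow_dist1[OF self] orbit_inv_eq[OF \<rho>, of v]
    by (simp add: e_def[abs_def] l_def atLeast0LessThan)
  have inj_e: "inj_on e {..<l}"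
    using inj_on_funpow_dist1[OF self] by (simp add: e_def[abs_def] l_def atLeast0LessThan)
  have l: "l > 0" by (simp add: l_def)
  have cardC: "card ?C = l" unfolding orb using inj_e by (simp add: card_image)
  have e0: "e 0 = v" by (simp add: e_def)
  have eS: "\<rho> (e (Suc i)) = e i" for i by (simp add: e_def inv)
  let ?J = "(\<lambda>j. e ` {..j}) ` {..<l}"
  have inj_J: "inj_on (\<lambda>j. e ` {..j}) {..<l}"
  proof (rule inj_onI)
    fix i j assume ij: "i \<in> {..<l}" "j \<in> {..<l}" "e ` {..i} = e ` {..j}"
    moreover from ij have "{..i} \<subseteq> {..<l}" "{..j} \<subseteq> {..<l}" by auto
    ultimately have "{..i} = {..j}" using inj_on_image_eq_iff[OF inj_e] by metis
    then show "i = j" by simp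
  qed
  have card_J: "card (e ` {..j}) = Suc j" if "j < l" for j
  proof -
    have "inj_on e {..j}" using inj_e that by (auto elim: inj_on_subset)
    then show ?thesis by (simp add: card_image)
  qed
  have zero: "hook_weight v \<rho> t S = 0" if S: "v \<in> S" "S \<subseteq> ?C" "S \<notin> ?J" for S
  proof (rule ccontr)
    assume nz: "hook_weight v \<rho> t S \<noteq> 0"
    have cl: "\<rho> r \<in> S" if r: "r \<in> S" "r \<noteq> v" for r
    proof (rule ccontr)
      assume "\<rho> r \<notin> S"
      then have "hook_fun v S \<rho> = 0" using r by (intro hook_fun_eq_0[of r]) auto
      then show False using nz by (simp add: hook_weight_def)
    qed
    define I where "I = {i. i < l \<and> e i \<in> S}"
    have SI: "S = e ` I" using S(2) unfolding orb I_def by auto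
    have I0: "0 \<in> I" using S(1) l e0 by (simp add: I_def)
    have down: "i \<in> I" if "Suc i \<in> I" for i
    proof -
      have "e (Suc i) \<noteq> e 0" using inj_onD[OF inj_e, of "Suc i" 0] that by (auto simp: I_def)
      then have "e i \<in> S" using cl[of "e (Suc i)"] eS that e0 by (auto simp: I_def)
      then show ?thesis using that by (simp add: I_def)
    qed
    have finI: "finite I" by (simp add: I_def)
    define m where "m = Max I"
    have m: "m \<in> I" "i \<le> m" if "i \<in> I" for i
      using I0 finI that unfolding m_def by (auto intro!: Max_in)
    have mI: "m \<in> I" using m(1)[OF I0] .
    have "m - k \<in> I" for k
      by (induction k) (use mI down in \<open>auto simp: diff_Suc split: nat.splits\<close>)
    then have "i \<in> I" if "i \<le> m" for i using that by (metis diff_diff_cancel)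
    then have "I = {..m}" using m(2) by auto
    moreover have "m < l" using mI by (simp add: I_def)
    ultimately show False using S(3) SI by blast
  qed
  have one: "hook_weight v \<rho> t (e ` {..j}) = t ^ j" if j: "j < l" for j
  proof -
    let ?S = "e ` {..j}"
    have vS: "v \<in> ?S" using e0 by (metis atMost_iff image_eqI le0)
    have cl: "\<rho> r \<in> ?S" if "r \<in> ?S - {v}" for r
    proof -
      obtain i where i: "i \<le> j" "r = e i" "i \<noteq> 0" using \<open>r \<in> ?S - {v}\<close> e0 by (metis Diff_iff atMost_iff imageE singletonI)
      then obtain i' where "i = Suc i'" by (cases i) auto
      then show ?thesis using i eS by auto
    qed
    obtain h where h: "h permutes ?S" "\<forall>r\<in>?S - {v}. h r = \<rho> r"
    proof (rule hook_fun_extend)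
      show "inj_on \<rho> (?S - {v})" using inj by (rule inj_on_subset) simp
    qed (use cl vS in auto)
    have ph: "permutation h" using h(1) by (intro permutes_imp_permutation) auto
    have "v \<in> orbit h (e i)" if "i \<le> j" for i
      using that
    proof (induction i)
      case 0
      then show ?case using permutation_self_in_orbit[OF ph] e0 by simp
    next
      case (Suc i)
      have "e (Suc i) \<noteq> v" using inj_onD[OF inj_e, of "Suc i" 0] Suc.prems j e0 by auto
      then have "h (e (Suc i)) = e i" using h(2) Suc.prems eS by simp
      then show ?case using Suc orbit_subset[of v h "e (Suc i)"] by simp
    qed
    then have "v \<in> orbit h s" if "s \<in> ?S" for s using that by auto
    then have "orbit h s = orbit h v" if "s \<in> ?S" for s
      using that orbit_eq_iff[OF ph, of v s] by simp
    then have "orbit h ` ?S = {orbit h v}" using vS by blast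
    then have "cyc ?S h = 1" by (simp add: cyc_def)
    then have "sign h = - ((-1) ^ card ?S)"
      using sign_cyc[of ?S h] h(1) by simp
    then have "hook_fun v ?S \<rho> = (-1) ^ j"
      using hook_fun_eq_sign[OF h] card_J[OF j] by simp
    then show ?thesis
      using card_J[OF j] by (simp add: hook_weight_def flip: power_mult_distrib)
  qed
  have "(\<Sum>S | v \<in> S \<and> S \<subseteq> ?C. hook_weight v \<rho> t S) = (\<Sum>S\<in>?J. hook_weight v \<rho> t S)"
  proof (rule sum.mono_neutral_right)
    show "finite {S. v \<in> S \<and> S \<subseteq> ?C}"
      unfolding orb by (auto intro: finite_subset[of _ "Pow (e ` {..<l})"])
    show "?J \<subseteq> {S. v \<in> S \<and> S \<subseteq> ?C}"
    proof
      fix S assume "S \<in> ?J"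
      then obtain j where "j < l" "S = e ` {..j}" by auto
      moreover have "e 0 \<in> e ` {..j}" by simp
      ultimately show "S \<in> {S. v \<in> S \<and> S \<subseteq> ?C}" unfolding orb e0 by auto
    qed
  qed (use zero in blast)
  also have "\<dots> = (\<Sum>j<l. t ^ j)"
    using inj_J one by (simp add: sum.reindex)
  finally show ?thesis unfolding cardC by (simp add: one_diff_power_eq)
qed

text \<open>Every cycle that avoids \<open>v\<close> contributes a factor; the cycle of
  \<open>v\<close> contributes its factor divided by \<open>1 - t\<close>, hence the multiplication
  on the left. The sum is the polynomial \<open>g\<close> of the overview.\<close>

lemma sum_hook_weight:
  fixes t :: "'r :: comm_ring_1"
  assumes "finite X" "\<rho> permutes X" "v \<in> X"
  shows "(1 - t) * (\<Sum>S | v \<in> S \<and> S \<subseteq> X. hook_weight v \<rho> t S) = (\<Prod>C\<in>orbit \<rho> ` X. 1 - t ^ card C)"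
proof -
  let ?O = "orbit \<rho> ` X" and ?V = "orbit \<rho> v"
  have \<rho>: "permutation \<rho>" using assms(1,2) by (rule permutes_imp_permutation)
  have disj: "C \<inter> C' = {}" if C: "C \<in> range (orbit \<rho>)" "C' \<in> range (orbit \<rho>)" "C \<noteq> C'" for C C'
  proof (rule ccontr)
    assume "C \<inter> C' \<noteq> {}"
    then obtain z where "z \<in> C" "z \<in> C'" by auto
    then have "C = orbit \<rho> z" "C' = orbit \<rho> z" using C orbit_eq_iff[OF \<rho>] by blast+
    then show False using C(3) by simp
  qed
  have fin: "finite C" if "C \<in> range (orbit \<rho>)" for C
    using that cyclic_on_orbit'[OF \<rho>] finite_cyclic_on by blast
  have vV: "v \<in> ?V" using \<rho> by (rule permutation_self_in_orbit)
  have step: "(1 - t) * (\<Sum>S | v \<in> S \<and> S \<subseteq> ?V \<union> \<Union>\<C>. hook_weight v \<rho> t S) =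
    (1 - t ^ card ?V) * (\<Prod>C\<in>\<C>. 1 - t ^ card C)" if "finite \<C>" "\<C> \<subseteq> ?O - {?V}" for \<C>
    using that
  proof (induction \<C> rule: finite_induct)
    case empty
    then show ?case using sum_hook_weight_orbit[OF \<rho>, of t v] by simp
  next
    case (insert C \<C>)
    then obtain x where C: "C = orbit \<rho> x" by auto
    have "finite C'" if "C' \<in> insert ?V \<C>" for C'
      using that insert.prems by (intro fin) auto
    then have "finite (\<Union>(insert ?V \<C>))" using insert.hyps(1) by (intro finite_Union) auto
    then have "finite (?V \<union> \<Union>\<C>)" by simp
    moreover have "(?V \<union> \<Union>\<C>) \<inter> C = {}"
    proof -
      have "C' \<inter> C = {}" if "C' \<in> insert ?V \<C>" for C'
        using that insert.hyps(2) insert.prems by (intro disj) auto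
      then show ?thesis by auto
    qed
    ultimately have "(\<Sum>S | v \<in> S \<and> S \<subseteq> (?V \<union> \<Union>\<C>) \<union> C. hook_weight v \<rho> t S) =
      (\<Sum>S | v \<in> S \<and> S \<subseteq> ?V \<union> \<Union>\<C>. hook_weight v \<rho> t S) * (1 - t ^ card C)"
      using vV \<rho> C by (intro sum_hook_weight_Un_orbit) auto
    moreover have "?V \<union> \<Union>\<C> \<union> C = ?V \<union> \<Union>(insert C \<C>)" by auto
    ultimately have "(1 - t) * (\<Sum>S | v \<in> S \<and> S \<subseteq> ?V \<union> \<Union>(insert C \<C>). hook_weight v \<rho> t S) =
      ((1 - t) * (\<Sum>S | v \<in> S \<and> S \<subseteq> ?V \<union> \<Union>\<C>. hook_weight v \<rho> t S)) * (1 - t ^ card C)"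
      by (simp only: mult.assoc)
    also have "\<dots> = (1 - t ^ card ?V) * (\<Prod>C\<in>\<C>. 1 - t ^ card C) * (1 - t ^ card C)"
      using insert.IH insert.prems by simp
    finally show ?case using insert.hyps by (simp add: mult_ac)
  qed
  have "\<Union>?O = X"
  proof
    show "\<Union>?O \<subseteq> X" by (intro UN_least permutes_orbit_subset[OF assms(2)])
    show "X \<subseteq> \<Union>?O"
    proof
      fix x assume "x \<in> X"
      then show "x \<in> \<Union>?O" using permutation_self_in_orbit[OF \<rho>, of x] by (rule UN_I)
    qed
  qed
  moreover have "insert ?V (?O - {?V}) = ?O" using assms(3) by (intro insert_Diff imageI)
  ultimately have U: "?V \<union> \<Union>(?O - {?V}) = X" by (metis Union_insert)
  have P: "(\<Prod>C\<in>?O. 1 - t ^ card C) = (1 - t ^ card ?V) * (\<Prod>C\<in>?O - {?V}. 1 - t ^ card C)"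
    using assms by (intro prod.remove) auto
  have "finite (?O - {?V})" using assms(1) by simp
  then show ?thesis unfolding P using step[OF _ subset_refl, unfolded U] by blast
qed

text \<open>The left side is \<open>g\<close> at \<open>t = 1\<close>, where \<open>g\<close> has a
  zero of order one less than the number of cycles of \<open>\<rho>\<close>.\<close>

lemma sum_hook_fun_cyclic_on:
  assumes "finite X" "\<rho> permutes X" "v \<in> X"
  shows "(\<Sum>S | v \<in> S \<and> S \<subseteq> X. (-1) ^ (card S - 1) * hook_fun v S \<rho>) =
    (if cyclic_on \<rho> X then int (card X) else 0)"
proof -
  let ?O = "orbit \<rho> ` X"
  \<comment> \<open>The factor \<open>1 - t\<close> can be cancelled for an indeterminate
    \<open>t\<close>; the evaluation at \<open>1\<close> comes afterwards.\<close>
  define t where "t = [:0, 1 :: int:]"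
  define G where "G = (\<Sum>S | v \<in> S \<and> S \<subseteq> X. hook_weight v \<rho> t S)"
  have G1: "poly G 1 = (\<Sum>S | v \<in> S \<and> S \<subseteq> X. (-1) ^ (card S - 1) * hook_fun v S \<rho>)"
    by (simp add: G_def hook_weight_def poly_sum t_def of_int_poly mult.commute)
  have nz: "1 - t \<noteq> 0" by (simp add: t_def one_pCons)
  have "(1 - t) * G = (\<Prod>C\<in>?O. (1 - t) * (\<Sum>i<card C. t ^ i))"
    unfolding G_def sum_hook_weight[OF assms] by (simp add: one_diff_power_eq)
  also have "\<dots> = (1 - t) ^ card ?O * (\<Prod>C\<in>?O. \<Sum>i<card C. t ^ i)"
    by (simp add: prod.distrib)
  also have "card ?O = Suc (card ?O - 1)"
    using assms card_gt_0_iff[of ?O] by auto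
  finally have "(1 - t) * G = (1 - t) * ((1 - t) ^ (card ?O - 1) * (\<Prod>C\<in>?O. \<Sum>i<card C. t ^ i))"
    by (simp add: mult.assoc)
  then have "G = (1 - t) ^ (card ?O - 1) * (\<Prod>C\<in>?O. \<Sum>i<card C. t ^ i)" using nz by simp
  then have G2: "poly G 1 = 0 ^ (card ?O - 1) * (\<Prod>C\<in>?O. int (card C))"
    by (simp add: t_def poly_prod poly_sum)
  have cyc: "cyclic_on \<rho> X \<longleftrightarrow> card ?O = 1"
    using cyclic_on_iff_cyc[OF assms(1,2)] by (simp add: cyc_def)
  show ?thesis
  proof (cases "cyclic_on \<rho> X")
    case True
    then have "?O = {X}" using assms(3) unfolding cyclic_on_alldef by blast
    then show ?thesis using True G2 unfolding G1 by simp
  next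
    case False
    moreover have "card ?O > 0" using assms by (auto simp: card_gt_0_iff)
    ultimately have "card ?O - 1 > 0" using cyc by linarith
    then show ?thesis using False G2 unfolding G1 by simp
  qed
qed

text \<open>The indicator of the full cycles, times \<open>card X\<close>, is replaced by the
  alternating sum of hook functions. Summing first over \<open>p\<close> and then over
  \<open>p'\<close> produces the convolution eigenvalue twice.\<close>

lemma sum_cyclic_products:
  fixes q :: "'r :: {idom, ring_char_0}"
  assumes "finite X" "\<rho> permutes X" "v \<in> X"
  shows "of_nat (card X) * (\<Sum>p | p permutes X. \<Sum>p' | p' permutes X \<and> cyclic_on (p \<circ> p' \<circ> \<rho>) X. q ^ (cyc X p + cyc X p')) =
    (\<Sum>S | v \<in> S \<and> S \<subseteq> X. (-1) ^ (card S - 1) * of_int (hook_fun v S \<rho>) * (pochhammer (q + 1 - of_nat (card S)) (card X))\<^sup>2)"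
proof -
  let ?P = "{p. p permutes X}" and ?S = "{S. v \<in> S \<and> S \<subseteq> X}"
  let ?H = "\<lambda>S. pochhammer (q + 1 - of_nat (card S)) (card X)"
  have finP: "finite ?P" using assms(1) by (rule finite_permutations)
  have "of_nat (card X) * (\<Sum>p | p permutes X. \<Sum>p' | p' permutes X \<and> cyclic_on (p \<circ> p' \<circ> \<rho>) X. q ^ (cyc X p + cyc X p'))
    = (\<Sum>p\<in>?P. \<Sum>p'\<in>?P. q ^ (cyc X p + cyc X p') * of_int (if cyclic_on (p \<circ> p' \<circ> \<rho>) X then int (card X) else 0))"
    unfolding sum_distrib_left
  proof (rule sum.cong[OF refl])
    fix p assume "p \<in> ?P"
    show "(\<Sum>p' | p' permutes X \<and> cyclic_on (p \<circ> p' \<circ> \<rho>) X. of_nat (card X) * q ^ (cyc X p + cyc X p')) =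
      (\<Sum>p'\<in>?P. q ^ (cyc X p + cyc X p') * of_int (if cyclic_on (p \<circ> p' \<circ> \<rho>) X then int (card X) else 0))"
      using finP by (intro sum.mono_neutral_cong_left) auto
  qed
  also have "\<dots> = (\<Sum>p\<in>?P. \<Sum>p'\<in>?P. \<Sum>S\<in>?S. (-1) ^ (card S - 1) * (q ^ cyc X p' * (q ^ cyc X p * of_int (hook_fun v S (p \<circ> (p' \<circ> \<rho>))))))"
  proof (intro sum.cong refl)
    fix p p' assume p: "p \<in> ?P" "p' \<in> ?P"
    then have perm: "p \<circ> p' \<circ> \<rho> permutes X" using assms(2) by (auto intro: permutes_compose)
    note eq = sum_hook_fun_cyclic_on[OF assms(1) perm assms(3), symmetric]
    show "q ^ (cyc X p + cyc X p') * of_int (if cyclic_on (p \<circ> p' \<circ> \<rho>) X then int (card X) else 0) =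
      (\<Sum>S\<in>?S. (-1) ^ (card S - 1) * (q ^ cyc X p' * (q ^ cyc X p * of_int (hook_fun v S (p \<circ> (p' \<circ> \<rho>))))))"
      unfolding eq by (simp add: sum_distrib_left power_add mult_ac comp_assoc)
  qed
  also have "\<dots> = (\<Sum>p'\<in>?P. \<Sum>p\<in>?P. \<Sum>S\<in>?S. (-1) ^ (card S - 1) * (q ^ cyc X p' * (q ^ cyc X p * of_int (hook_fun v S (p \<circ> (p' \<circ> \<rho>))))))"
    by (rule sum.swap)
  also have "\<dots> = (\<Sum>p'\<in>?P. \<Sum>S\<in>?S. \<Sum>p\<in>?P. (-1) ^ (card S - 1) * (q ^ cyc X p' * (q ^ cyc X p * of_int (hook_fun v S (p \<circ> (p' \<circ> \<rho>))))))"
    by (intro sum.cong refl sum.swap)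
  also have "\<dots> = (\<Sum>S\<in>?S. \<Sum>p'\<in>?P. \<Sum>p\<in>?P. (-1) ^ (card S - 1) * (q ^ cyc X p' * (q ^ cyc X p * of_int (hook_fun v S (p \<circ> (p' \<circ> \<rho>))))))"
    by (rule sum.swap)
  also have "\<dots> = (\<Sum>S\<in>?S. (-1) ^ (card S - 1) * of_int (hook_fun v S \<rho>) * (?H S)\<^sup>2)"
  proof (rule sum.cong[OF refl])
    fix S assume S: "S \<in> ?S"
    have "(\<Sum>p\<in>?P. q ^ cyc X p * of_int (hook_fun v S (p \<circ> (p' \<circ> \<rho>)))) = ?H S * of_int (hook_fun v S (p' \<circ> \<rho>))" if "p' \<in> ?P" for p'
      using S that assms by (intro hook_fun_convolution) (auto intro: permutes_compose)
    then have "(\<Sum>p'\<in>?P. \<Sum>p\<in>?P. (-1) ^ (card S - 1) * (q ^ cyc X p' * (q ^ cyc X p * of_int (hook_fun v S (p \<circ> (p' \<circ> \<rho>)))))) =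
        (\<Sum>p'\<in>?P. (-1) ^ (card S - 1) * (q ^ cyc X p' * (?H S * of_int (hook_fun v S (p' \<circ> \<rho>)))))"
      by (simp flip: sum_distrib_left)
    also have "\<dots> = (-1) ^ (card S - 1) * ?H S * (\<Sum>p'\<in>?P. q ^ cyc X p' * of_int (hook_fun v S (p' \<circ> \<rho>)))"
      by (simp add: sum_distrib_left mult_ac)
    also have "(\<Sum>p'\<in>?P. q ^ cyc X p' * of_int (hook_fun v S (p' \<circ> \<rho>))) = ?H S * of_int (hook_fun v S \<rho>)"
      using S assms by (intro hook_fun_convolution) auto
    also have "(-1) ^ (card S - 1) * ?H S * (?H S * of_int (hook_fun v S \<rho>)) =
       (-1) ^ (card S - 1) * of_int (hook_fun v S \<rho>) * (?H S)\<^sup>2"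
      by (simp add: mult_ac power2_eq_square)
    finally show "(\<Sum>p'\<in>?P. \<Sum>p\<in>?P. (-1) ^ (card S - 1) * (q ^ cyc X p' * (q ^ cyc X p * of_int (hook_fun v S (p \<circ> (p' \<circ> \<rho>)))))) =
       (-1) ^ (card S - 1) * of_int (hook_fun v S \<rho>) * (?H S)\<^sup>2" .
  qed
  finally show ?thesis .
qed

section \<open>Roots of shifted polynomials\<close>

lemma poly_eq_prod_proots:
  fixes p :: "complex poly"
  shows "poly p z = lead_coeff p * (\<Prod>w\<in>#proots p. z - w)"
proof -
  have "poly p z = poly (smult (lead_coeff p) (\<Prod>w\<in>#proots p. [:-w, 1:])) z"
    by (simp only: complex_poly_decompose_multiset)
  also have "\<dots> = lead_coeff p * (\<Prod>w\<in>#proots p. poly [:-w, 1:] z)"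
    by (simp add: poly_prod_mset image_mset.compositionality o_def)
  finally show ?thesis by simp
qed

text \<open>Compared factor by factor: at fixed height, the distance to a point of the vertical line
  grows with the distance to the line.\<close>

lemma norm_poly_mono_vertical_roots:
  fixes p :: "complex poly"
  assumes roots: "\<And>w. poly p w = 0 \<Longrightarrow> Re w = c" and "p \<noteq> 0"
    and "\<bar>Re z - c\<bar> \<le> \<bar>Re z' - c\<bar>" "Im z = Im z'"
  shows "norm (poly p z) \<le> norm (poly p z')"
proof -
  have le: "norm (z - w) \<le> norm (z' - w)" if "w \<in># proots p" for w
  proof -
    have "Re w = c" using that assms(2) by (intro roots) simp
    then have "(Re (z - w))\<^sup>2 \<le> (Re (z' - w))\<^sup>2" using assms(3) by (simp add: abs_le_square_iff)
    then show ?thesis using assms(4) by (simp add: cmod_def)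
  qed
  have "norm (\<Prod>w\<in>#A. z - w) \<le> norm (\<Prod>w\<in>#A. z' - w)" if "\<And>w. w \<in># A \<Longrightarrow> norm (z - w) \<le> norm (z' - w)" for A
    using that by (induction A) (auto simp: norm_mult intro!: mult_mono)
  then have "norm (\<Prod>w\<in>#proots p. z - w) \<le> norm (\<Prod>w\<in>#proots p. z' - w)" using le by blast
  then show ?thesis unfolding poly_eq_prod_proots[of p] norm_mult by (rule mult_left_mono) simp
qed

section \<open>Polynomials in the shift operator\<close>

definition shift :: "'r :: comm_ring_1 poly \<Rightarrow> 'r poly" where
  "shift p = pcompose p [:-1, 1:]"

lemma poly_shift [simp]: "poly (shift p) z = poly p (z - 1)"
  by (simp add: shift_def poly_pcompose)

lemma shift_linear [simp]:
  "shift 0 = 0" "shift (p + r) = shift p + shift r" "shift (smult a p) = smult a (shift p)"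
  by (simp_all add: shift_def pcompose_add pcompose_smult)

definition shift_op :: "'r :: comm_ring_1 poly \<Rightarrow> 'r poly \<Rightarrow> 'r poly" where
  "shift_op g f = (\<Sum>j\<le>degree g. smult (coeff g j) ((shift ^^ j) f))"

lemma shift_op_altdef:
  assumes "degree g \<le> N"
  shows "shift_op g f = (\<Sum>j\<le>N. smult (coeff g j) ((shift ^^ j) f))"
  unfolding shift_op_def using assms
  by (intro sum.mono_neutral_left) (auto simp: coeff_eq_0)

lemma shift_op_add: "shift_op (g + h) f = shift_op g f + shift_op h f"
proof -
  have "degree (g + h) \<le> max (degree g) (degree h)" by (rule degree_add_le_max)
  then show ?thesis
    by (simp add: shift_op_altdef[where N = "max (degree g) (degree h)"] smult_add_left sum.distrib)
qed

lemma shift_op_0 [simp]: "shift_op 0 f = 0"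
  by (simp add: shift_op_def)

lemma shift_op_sum: "shift_op (\<Sum>i\<in>A. g i) f = (\<Sum>i\<in>A. shift_op (g i) f)"
  by (induction A rule: infinite_finite_induct) (simp_all add: shift_op_add)

lemma shift_op_smult: "shift_op (smult a g) f = smult a (shift_op g f)"
proof -
  have "smult a (\<Sum>j\<in>A. h j) = (\<Sum>j\<in>A. smult a (h j))" for A and h :: "nat \<Rightarrow> 'a poly"
    by (induction A rule: infinite_finite_induct) (simp_all add: smult_add_right)
  then show ?thesis
    using degree_smult_le[of a g] by (simp add: shift_op_altdef[where N = "degree g"])
qed

lemma shift_op_monom: "shift_op (monom a k) f = smult a ((shift ^^ k) f)"
proof -
  have "shift_op (monom a k) f = (\<Sum>j\<le>k. if j = k then smult a ((shift ^^ k) f) else 0)"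
    unfolding shift_op_altdef[OF degree_monom_le] by (intro sum.cong) auto
  then show ?thesis by simp
qed

lemma shift_sum: "shift (\<Sum>i\<in>A. h i) = (\<Sum>i\<in>A. shift (h i))"
  by (induction A rule: infinite_finite_induct) simp_all

lemma shift_op_pCons: "shift_op (pCons a g) f = smult a f + shift (shift_op g f)"
proof -
  have "shift_op (pCons a g) f = (\<Sum>j\<le>Suc (degree g). smult (coeff (pCons a g) j) ((shift ^^ j) f))"
    by (rule shift_op_altdef) (simp add: degree_pCons_le)
  also have "\<dots> = smult a f + (\<Sum>j\<le>degree g. smult (coeff g j) (shift ((shift ^^ j) f)))"
    by (simp add: sum.atMost_Suc_shift del: sum.atMost_Suc)
  finally show ?thesis by (simp add: shift_op_def shift_sum)
qed

lemma shift_op_linear_mult: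
  "shift_op ([:- a, 1:] * g) f = shift (shift_op g f) - smult a (shift_op g f)"
proof -
  have "[:- a, 1:] * g = smult (- a) g + pCons 0 g" by simp
  then show ?thesis by (simp only: shift_op_add shift_op_smult shift_op_pCons) simp
qed

lemma coeff_shift_degree:
  assumes "degree p \<le> d"
  shows "coeff (shift p) d = coeff p d"
  using assms unfolding shift_def
proof (induction p arbitrary: d)
  case 0
  then show ?case by simp
next
  case (pCons a p)
  show ?case
  proof (cases "p = 0")
    case True
    then show ?thesis by simp
  next
    case False
    then obtain d' where d': "d = Suc d'" "degree p \<le> d'" using pCons.prems by (cases d) auto
    have "degree (pcompose p [:-1, 1:]) \<le> degree p * degree [:-1, 1::'a:]" by (rule degree_pcompose_le)
    then have "degree (pcompose p [:-1, 1:]) < d" using d' by simp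
    then show ?thesis using d' pCons.IH[OF d'(2)] by (simp add: pcompose_pCons coeff_eq_0)
  qed
qed

lemma degree_shift_le: "degree (shift p) \<le> degree p"
proof -
  have "degree (shift p) \<le> degree p * degree [:-1, 1::'a:]"
    unfolding shift_def by (rule degree_pcompose_le)
  then show ?thesis by simp
qed

text \<open>This coefficient is what survives at the top of \<open>shift p - p\<close>; it makes the
  degree drop by exactly one.\<close>

lemma coeff_shift_degree_pred:
  assumes "degree p \<le> Suc d"
  shows "coeff (shift p) d = coeff p d - of_nat (Suc d) * coeff p (Suc d)"
  using assms
proof (induction p arbitrary: d)
  case 0
  then show ?case by simp
next
  case (pCons a p)
  have deg: "degree p \<le> d"
    using pCons.prems by (cases "p = 0") auto
  have *: "shift (pCons a p) = [:a:] + (pCons 0 (shift p) - shift p)"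
    by (simp add: shift_def pcompose_pCons)
  have d0: "coeff (shift p) d = coeff p d" using deg by (rule coeff_shift_degree)
  show ?case
  proof (cases d)
    case 0
    then show ?thesis using d0 by (simp add: *)
  next
    case (Suc d')
    then have "coeff (shift p) d' = coeff p d' - of_nat (Suc d') * coeff p (Suc d')"
      using deg by (intro pCons.IH) simp
    then show ?thesis using Suc d0 by (simp add: * algebra_simps)
  qed
qed

text \<open>The leading terms cancel only for \<open>a = 1\<close>, where the operator is a
  difference operator. The exact degree matters because it fixes the largest number of faces and
  with it the genus.\<close>

lemma degree_shift_diff:
  fixes p :: "'r :: {idom, ring_char_0} poly"
  assumes "degree p > 0"
  shows "degree (shift p - smult a p) = (if a = 1 then degree p - 1 else degree p)"
proof (cases "a = 1")
  case True
  obtain d where d: "degree p = Suc d" using assms by (cases "degree p") auto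
  have "coeff (shift p - p) k = 0" if "k > d" for k
  proof (cases "k = Suc d")
    case True
    then show ?thesis using coeff_shift_degree[of p k] d by simp
  next
    case False
    then have "k > degree p" using that d by simp
    then show ?thesis using degree_shift_le[of p] by (simp add: coeff_eq_0)
  qed
  moreover have "coeff (shift p - p) d \<noteq> 0"
  proof -
    have "coeff p (Suc d) \<noteq> 0" using d by (metis leading_coeff_0_iff nat.distinct(1) degree_0)
    moreover have "coeff (shift p - p) d = - (of_nat (Suc d) * coeff p (Suc d))"
      using coeff_shift_degree_pred[of p d] d by simp
    ultimately show ?thesis using of_nat_neq_0[of d, where 'a = 'r] by (simp del: of_nat_Suc)
  qed
  ultimately have "degree (shift p - p) = d"
    by (intro antisym degree_le le_degree) auto
  then show ?thesis using True d by simp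
next
  case False
  have "lead_coeff p \<noteq> 0" using assms by auto
  moreover have "coeff (shift p - smult a p) (degree p) = (1 - a) * lead_coeff p"
    using coeff_shift_degree[of p "degree p"] by (simp add: algebra_simps)
  ultimately have "coeff (shift p - smult a p) (degree p) \<noteq> 0" using False by simp
  then have "degree p \<le> degree (shift p - smult a p)" by (rule le_degree)
  moreover have "degree (shift p - smult a p) \<le> degree p"
    using degree_shift_le[of p] by (intro degree_diff_le) (auto intro: order.trans[OF degree_smult_le])
  ultimately show ?thesis using False by simp
qed

text \<open>
  The invariant of the root argument: the real roots \<open>0, -1, \<dots>, 1 - b\<close>, each double, are
  symmetric with respect to the line that contains all other roots.
\<close>

definition balanced :: "nat \<Rightarrow> complex poly \<Rightarrow> bool" where
  "balanced b p \<longleftrightarrow> (\<exists>Q. Q \<noteq> 0 \<and> (\<forall>z. poly Q z = 0 \<longrightarrow> Re z = (1 - real b) / 2) \<and>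
     p = (pochhammer [:0, 1:] b)\<^sup>2 * Q)"

lemma poly_pochhammer: "poly (pochhammer p n) x = pochhammer (poly p x) n"
  by (simp add: pochhammer_prod poly_prod)

text \<open>At a root of the remaining factor,
  \<open>(norm (z - 1))\<^sup>2 * norm (poly Q (z - 1))\<close> equals
  \<open>(norm (z + of_nat b))\<^sup>2 * norm (poly Q z)\<close>. The points \<open>1\<close> and
  \<open>- b\<close> are symmetric to the new axis \<open>Re z = (1 - b) / 2\<close>. Moreover
  \<open>z\<close> is farther than \<open>z - 1\<close> from the old axis
  \<open>Re z = - b / 2\<close> exactly when it lies to the right of the new one. Off the new axis
  both factors therefore compare in the same direction, and equality fails.\<close>

lemma balanced_step:
  assumes "balanced (Suc b) p" and \<xi>: "norm \<xi> = 1"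
  shows "balanced b (shift p - smult \<xi> p)"
proof -
  obtain Q where Q: "Q \<noteq> 0" "\<And>z. poly Q z = 0 \<Longrightarrow> Re z = - real b / 2"
    and p: "p = (pochhammer [:0, 1:] (Suc b))\<^sup>2 * Q"
    using assms(1) unfolding balanced_def by auto
  \<comment> \<open>The shifted term has the double zeros \<open>1, 0, \<dots>, 1 - b\<close> and
    the unshifted one \<open>0, \<dots>, - b\<close>; the unshared zeros \<open>1\<close> and
    \<open>- b\<close> stay in \<open>Q'\<close>.\<close>
  define Q' where "Q' = [:-1, 1:]\<^sup>2 * shift Q - smult \<xi> ([:of_nat b, 1:]\<^sup>2 * Q)"
  have "shift p - smult \<xi> p = (pochhammer [:0, 1:] b)\<^sup>2 * Q'"
  proof (rule poly_ext)
    fix z :: complex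
    have A: "pochhammer (z - 1) (Suc b) = (z - 1) * pochhammer z b"
      by (simp add: pochhammer_rec)
    have B: "pochhammer z (Suc b) = (z + of_nat b) * pochhammer z b"
      by (simp add: pochhammer_Suc mult.commute)
    have "poly (shift p - smult \<xi> p) z =
      (pochhammer (z - 1) (Suc b))\<^sup>2 * poly Q (z - 1) - \<xi> * ((pochhammer z (Suc b))\<^sup>2 * poly Q z)"
      by (simp add: p poly_pochhammer)
    also have "\<dots> = (pochhammer z b)\<^sup>2 * ((z - 1)\<^sup>2 * poly Q (z - 1) - \<xi> * ((z + of_nat b)\<^sup>2 * poly Q z))"
      unfolding A B by (simp add: power2_eq_square algebra_simps)
    also have "\<dots> = poly ((pochhammer [:0, 1:] b)\<^sup>2 * Q') z"
      by (simp add: Q'_def poly_pochhammer add.commute)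
    finally show "poly (shift p - smult \<xi> p) z = poly ((pochhammer [:0, 1:] b)\<^sup>2 * Q') z" .
  qed
  moreover have off: "poly Q' z \<noteq> 0" if z: "Re z \<noteq> (1 - real b) / 2" for z
  proof
    assume "poly Q' z = 0"
    then have "(z - 1)\<^sup>2 * poly Q (z - 1) = \<xi> * ((z + of_nat b)\<^sup>2 * poly Q z)"
      by (simp add: Q'_def add.commute)
    then have eq: "(norm (z - 1))\<^sup>2 * norm (poly Q (z - 1)) = (norm (z + of_nat b))\<^sup>2 * norm (poly Q z)"
      using \<xi> by (metis mult_1 norm_mult norm_power)
    have nsq: "(norm (z - 1))\<^sup>2 = (Re z - 1)\<^sup>2 + (Im z)\<^sup>2" "(norm (z + of_nat b))\<^sup>2 = (Re z + real b)\<^sup>2 + (Im z)\<^sup>2"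
      by (simp_all add: cmod_power2)
    have diff: "(Re z + real b)\<^sup>2 - (Re z - 1)\<^sup>2 = (real b + 1) * (2 * Re z + real b - 1)"
      by (simp add: power2_eq_square algebra_simps)
    have key: "x * y < x' * y'" if "x < x'" "y \<le> y'" "0 < y'" "0 \<le> x" for x x' y y' :: real
      using mult_left_mono[OF that(2,4)] mult_strict_right_mono[OF that(1,3)] by linarith
    show False
    proof (cases "Re z > (1 - real b) / 2")
      case True
      then have "(real b + 1) * (2 * Re z + real b - 1) > 0" by (intro mult_pos_pos) (auto simp: field_simps)
      then have 1: "(norm (z - 1))\<^sup>2 < (norm (z + of_nat b))\<^sup>2" using nsq diff by linarith
      have 2: "norm (poly Q (z - 1)) \<le> norm (poly Q z)"
        by (rule norm_poly_mono_vertical_roots[OF Q(2) Q(1)]) (use True in \<open>auto simp: field_simps\<close>)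
      have "poly Q z \<noteq> 0" using Q(2)[of z] True by auto
      then have "(norm (z - 1))\<^sup>2 * norm (poly Q (z - 1)) < (norm (z + of_nat b))\<^sup>2 * norm (poly Q z)"
        using 1 2 by (intro key) auto
      then show False using eq by simp
    next
      case False
      then have less: "Re z < (1 - real b) / 2" using z by simp
      then have "(real b + 1) * (2 * Re z + real b - 1) < 0" by (intro mult_pos_neg) (auto simp: field_simps)
      then have 1: "(norm (z + of_nat b))\<^sup>2 < (norm (z - 1))\<^sup>2" using nsq diff by linarith
      have 2: "norm (poly Q z) \<le> norm (poly Q (z - 1))"
        by (rule norm_poly_mono_vertical_roots[OF Q(2) Q(1)]) (use less in \<open>auto simp: field_simps\<close>)
      have "poly Q (z - 1) \<noteq> 0" using Q(2)[of "z - 1"] less by auto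
      then have "(norm (z + of_nat b))\<^sup>2 * norm (poly Q z) < (norm (z - 1))\<^sup>2 * norm (poly Q (z - 1))"
        using 1 2 by (intro key) auto
      then show False using eq by simp
    qed
  qed
  moreover have "Q' \<noteq> 0"
  proof -
    \<comment> \<open>The witness lies at distance \<open>1\<close> to the right of the axis, where
      \<open>off\<close> excludes a zero.\<close>
    have "poly Q' (of_real ((3 - real b) / 2)) \<noteq> 0" by (rule off) simp
    then show ?thesis by auto
  qed
  ultimately show ?thesis unfolding balanced_def by blast
qed

lemma balanced_pochhammer: "balanced b ((pochhammer [:0, 1:] b)\<^sup>2)"
  unfolding balanced_def by (intro exI[of _ 1]) auto

lemma degree_pochhammer_X: "degree (pochhammer [:0, 1 :: 'r :: idom:] b) = b"
proof (induction b)
  case (Suc b)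
  have "pochhammer [:0, 1 :: 'r:] b \<noteq> 0" using Suc.IH by (cases "b = 0") auto
  moreover have "pochhammer [:0, 1 :: 'r:] (Suc b) = pochhammer [:0, 1:] b * [:of_nat b, 1:]"
    by (simp add: pochhammer_Suc of_nat_poly del: mult_pCons_right)
  ultimately show ?case using Suc.IH by (simp add: degree_mult_eq del: mult_pCons_right)
qed simp

text \<open>Each root of \<open>g\<close>, with multiplicity, costs one of the \<open>n\<close>
  double zeros; \<open>degree g < n\<close> leaves at least one and keeps all intermediate degrees
  positive. Only the root \<open>1\<close> lowers the degree.\<close>

lemma shift_op_balanced:
  assumes "g \<noteq> 0" "\<And>z. poly g z = 0 \<Longrightarrow> norm z = 1" "degree g < n"
  defines "f \<equiv> (pochhammer [:0, 1:] n)\<^sup>2"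
  shows "balanced (n - degree g) (shift_op g f)" "degree (shift_op g f) = 2 * n - order 1 g"
proof -
  have "pochhammer [:0, 1 :: complex:] n \<noteq> 0"
    using degree_pochhammer_X[of n, where 'r = complex] assms(3) by (metis degree_0 not_less_zero)
  then have f0: "f \<noteq> 0" "degree f = 2 * n"
    using degree_pochhammer_X[of n, where 'r = complex] by (simp_all add: f_def degree_power_eq)
  have *: "balanced (n - size A) (shift_op (\<Prod>x\<in>#A. [:-x, 1:]) f) \<and>
      degree (shift_op (\<Prod>x\<in>#A. [:-x, 1:]) f) = 2 * n - count A 1"
    if "\<And>x. x \<in># A \<Longrightarrow> norm x = 1" "size A < n" for A
    using that
  proof (induction A)
    case empty
    have "shift_op 1 f = f" by (simp add: shift_op_def)
    then show ?case using f0 balanced_pochhammer by (simp add: f_def)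
  next
    case (add x A)
    let ?h = "shift_op (\<Prod>x\<in>#A. [:-x, 1:]) f"
    have IH: "balanced (n - size A) ?h" "degree ?h = 2 * n - count A 1" using add by auto
    have "n - size A = Suc (n - size (add_mset x A))" using add.prems(2) by simp
    then have "balanced (n - size (add_mset x A)) (shift ?h - smult x ?h)"
      using IH(1) add.prems(1) by (intro balanced_step) auto
    moreover have "count A 1 \<le> size A" by (rule count_le_size)
    then have "degree ?h > 0" using IH(2) add.prems(2) by simp
    then have "degree (shift ?h - smult x ?h) = 2 * n - count (add_mset x A) 1"
      using IH(2) by (auto simp: degree_shift_diff)
    ultimately show ?case by (simp only: image_mset_add_mset prod_mset.add_mset shift_op_linear_mult)
  qed
  define A where "A = proots g"
  have g: "g = smult (lead_coeff g) (\<Prod>x\<in>#A. [:-x, 1:])" by (simp add: A_def complex_poly_decompose_multiset)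
  have sz: "size A = degree g" by (simp add: A_def size_proots_complex)
  have norm1: "norm x = 1" if "x \<in># A" for x using that assms(1,2) by (simp add: A_def)
  have cnt: "count A 1 = order 1 g" using assms(1) by (simp add: A_def)
  have H: "balanced (n - degree g) (shift_op (\<Prod>x\<in>#A. [:-x, 1:]) f)"
      "degree (shift_op (\<Prod>x\<in>#A. [:-x, 1:]) f) = 2 * n - order 1 g"
    using *[of A] norm1 sz cnt assms(3) by auto
  have eq: "shift_op g f = smult (lead_coeff g) (shift_op (\<Prod>x\<in>#A. [:-x, 1:]) f)"
    by (subst g) (simp only: shift_op_smult)
  show "degree (shift_op g f) = 2 * n - order 1 g" using H(2) assms(1) by (simp add: eq)
  obtain Q where Q: "Q \<noteq> 0" "\<forall>z. poly Q z = 0 \<longrightarrow> Re z = (1 - real (n - degree g)) / 2"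
     "shift_op (\<Prod>x\<in>#A. [:-x, 1:]) f = (pochhammer [:0, 1:] (n - degree g))\<^sup>2 * Q"
    using H(1) unfolding balanced_def by blast
  show "balanced (n - degree g) (shift_op g f)"
    unfolding balanced_def eq using Q assms(1)
    by (intro exI[of _ "smult (lead_coeff g) Q"]) auto
qed

text \<open>The roots of each \<open>1 - t ^ m\<close> are roots of unity, and \<open>1\<close> is a
  simple one; division by \<open>1 - t\<close> removes one root \<open>1\<close> from the
  product.\<close>

lemma quotient_prod_one_minus_power:
  fixes g :: "complex poly"
  assumes "finite \<O>" "\<O> \<noteq> {}" "\<And>C. C \<in> \<O> \<Longrightarrow> m C > 0"
    and g: "(1 - [:0, 1:]) * g = (\<Prod>C\<in>\<O>. 1 - [:0, 1:] ^ m C)"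
  shows "g \<noteq> 0" "degree g = (\<Sum>C\<in>\<O>. m C) - 1" "order 1 g = card \<O> - 1"
    "\<And>z. poly g z = 0 \<Longrightarrow> norm z = 1"
proof -
  let ?t = "[:0, 1 :: complex:]"
  have nz: "1 - ?t ^ m C \<noteq> 0" "degree (1 - ?t ^ m C) = m C" "order 1 (1 - ?t ^ m C) = 1" if "C \<in> \<O>" for C
  proof -
    have mon: "?t ^ m C = monom 1 (m C)" by (simp add: monom_altdef)
    have "coeff (1 - ?t ^ m C) (m C) = -1" using assms(3)[OF that] by (simp add: mon)
    then show 1: "1 - ?t ^ m C \<noteq> 0" by auto
    have "degree (1 - ?t ^ m C) \<le> m C" unfolding mon by (intro degree_diff_le) (auto simp: degree_monom_le)
    moreover have "m C \<le> degree (1 - ?t ^ m C)" using \<open>coeff (1 - ?t ^ m C) (m C) = -1\<close> by (intro le_degree) simp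
    ultimately show "degree (1 - ?t ^ m C) = m C" by simp
    \<comment> \<open>The derivative at \<open>1\<close> is \<open>- m C\<close>, so the root
      \<open>1\<close> is simple.\<close>
    have "poly (pderiv (1 - ?t ^ m C)) 1 \<noteq> 0"
      using assms(3)[OF that] by (simp add: mon pderiv_diff pderiv_monom poly_monom)
    moreover have "poly (1 - ?t ^ m C) 1 = 0" by simp
    ultimately show "order 1 (1 - ?t ^ m C) = 1" using 1
      by (metis One_nat_def order_pderiv order_root pderiv_0 poly_0 order_0I)
  qed
  have P: "(\<Prod>C\<in>\<O>. 1 - ?t ^ m C) \<noteq> 0" using assms(1) nz by simp
  then show g0: "g \<noteq> 0" using g by auto
  have lin: "1 - ?t = smult (-1) [:-1, 1:]" by (simp add: one_pCons)
  have lin0: "1 - ?t \<noteq> 0" by (simp add: one_pCons)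
  have degP: "degree (\<Prod>C\<in>\<O>. 1 - ?t ^ m C) = (\<Sum>C\<in>\<O>. m C)"
    using nz by (subst degree_prod_eq_sum_degree) auto
  have "degree (1 - ?t) = 1" by (simp add: one_pCons)
  then have "Suc (degree g) = degree ((1 - ?t) * g)" using lin0 g0 by (simp add: degree_mult_eq)
  then show "degree g = (\<Sum>C\<in>\<O>. m C) - 1" unfolding g degP by simp
  have ordP: "order 1 (\<Prod>C\<in>A. 1 - ?t ^ m C) = card A" if "finite A" "A \<subseteq> \<O>" for A
    using that
  proof (induction A rule: finite_induct)
    case empty
    show ?case by (simp add: order_0I)
  next
    case (insert C A)
    have "(1 - ?t ^ m C) * (\<Prod>C\<in>A. 1 - ?t ^ m C) \<noteq> 0"
      using insert.prems insert.hyps nz(1) by auto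
    from order_mult[OF this] show ?case using insert nz(3) by simp
  qed
  have "order 1 (1 - ?t) = 1"
  proof -
    have "order 1 ([:-1, 1:] ^ 1 :: complex poly) = 1" by (rule order_power_n_n)
    then show ?thesis unfolding lin by (subst order_smult) auto
  qed
  then have "Suc (order 1 g) = order 1 ((1 - ?t) * g)" using lin0 g0 by (subst order_mult) auto
  then show "order 1 g = card \<O> - 1" unfolding g using ordP[OF assms(1)] by simp
  fix z assume "poly g z = 0"
  then have "poly ((1 - ?t) * g) z = 0" by simp
  then obtain C where C: "C \<in> \<O>" "z ^ m C = 1" unfolding g using assms(1) by (auto simp: poly_prod)
  then have "norm z ^ m C = 1 ^ m C" by (metis norm_one norm_power power_one)
  from power_eq_imp_eq_base[OF this _ _ assms(3)[OF C(1)]] show "norm z = 1" by simp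
qed

section \<open>Log-concavity\<close>

definition cyclic_pairs :: "'a set \<Rightarrow> ('a \<Rightarrow> 'a) \<Rightarrow> (('a \<Rightarrow> 'a) \<times> ('a \<Rightarrow> 'a)) set" where
  "cyclic_pairs X \<rho> = {(p, p'). p permutes X \<and> p' permutes X \<and> cyclic_on (p \<circ> p' \<circ> \<rho>) X}"

definition cyc_poly :: "'a set \<Rightarrow> ('a \<Rightarrow> 'a) \<Rightarrow> complex poly" where
  "cyc_poly X \<rho> = (\<Sum>(p, p')\<in>cyclic_pairs X \<rho>. monom 1 (cyc X p + cyc X p'))"

lemma finite_cyclic_pairs:
  assumes "finite X"
  shows "finite (cyclic_pairs X \<rho>)"
proof -
  have "cyclic_pairs X \<rho> \<subseteq> {p. p permutes X} \<times> {p. p permutes X}"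
    by (auto simp: cyclic_pairs_def)
  then show ?thesis using finite_permutations[OF assms] finite_subset by blast
qed

lemma poly_shift_funpow: "poly ((shift ^^ k) f) z = poly f (z - of_nat k)"
  by (induction k arbitrary: z) (simp_all add: algebra_simps)

text \<open>Shifting \<open>k\<close> times turns \<open>pochhammer q n\<close> into
  \<open>pochhammer (q - k) n\<close>, which is the eigenvalue for \<open>k = card S - 1\<close>.
  What is left in each summand is the coefficient of the weight at \<open>t ^ k\<close>.\<close>

lemma cyc_poly_eq_shift_op:
  assumes "finite X" "\<rho> permutes X" "v \<in> X"
  shows "of_nat (card X) * cyc_poly X \<rho> =
    shift_op (\<Sum>S | v \<in> S \<and> S \<subseteq> X. hook_weight v \<rho> [:0, 1:] S) ((pochhammer [:0, 1:] (card X))\<^sup>2)"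
proof -
  let ?P = "{p. p permutes X}" and ?S = "{S. v \<in> S \<and> S \<subseteq> X}" and ?q = "[:0, 1 :: complex:]"
  let ?n = "card X"
  have finP: "finite ?P" using assms(1) by (rule finite_permutations)
  have "cyclic_pairs X \<rho> = (SIGMA p:?P. {p'. p' permutes X \<and> cyclic_on (p \<circ> p' \<circ> \<rho>) X})"
    by (auto simp: cyclic_pairs_def)
  moreover have "finite {p'. p' permutes X \<and> cyclic_on (p \<circ> p' \<circ> \<rho>) X}" for p
    using finP by (rule rev_finite_subset) auto
  ultimately have "cyc_poly X \<rho> =
    (\<Sum>p | p permutes X. \<Sum>p' | p' permutes X \<and> cyclic_on (p \<circ> p' \<circ> \<rho>) X. ?q ^ (cyc X p + cyc X p'))"
    using finP by (simp add: cyc_poly_def sum.Sigma monom_altdef)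
  then have "of_nat ?n * cyc_poly X \<rho> = (\<Sum>S\<in>?S. (-1) ^ (card S - 1) * of_int (hook_fun v S \<rho>) *
      (pochhammer (?q + 1 - of_nat (card S)) ?n)\<^sup>2)"
    by (simp only: sum_cyclic_products[OF assms])
  also have "\<dots> = (\<Sum>S\<in>?S. shift_op (hook_weight v \<rho> ?q S) ((pochhammer ?q ?n)\<^sup>2))"
  proof (rule sum.cong[OF refl])
    fix S assume S: "S \<in> ?S"
    then have "card S > 0" using assms(1) finite_subset[of S X] by (auto simp: card_gt_0_iff)
    then have cS: "of_nat (card S) = (1 + of_nat (card S - 1) :: complex)"
      by (metis Suc_pred' add.commute of_nat_1 of_nat_add plus_1_eq_Suc)
    have "hook_weight v \<rho> ?q S = monom ((-1) ^ (card S - 1) * of_int (hook_fun v S \<rho>)) (card S - 1)"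
    proof -
      have "(- ?q) ^ (card S - 1) = monom ((-1) ^ (card S - 1)) (card S - 1)"
        by (simp add: monom_altdef flip: smult_minus_left mult_smult_left) (simp flip: smult_power)
      then show ?thesis by (simp add: hook_weight_def of_int_poly smult_monom mult.commute)
    qed
    then have "shift_op (hook_weight v \<rho> ?q S) ((pochhammer ?q ?n)\<^sup>2) =
       smult ((-1) ^ (card S - 1) * of_int (hook_fun v S \<rho>)) ((shift ^^ (card S - 1)) ((pochhammer ?q ?n)\<^sup>2))"
      by (simp only: shift_op_monom)
    also have "\<dots> = (-1) ^ (card S - 1) * of_int (hook_fun v S \<rho>) * (pochhammer (?q + 1 - of_nat (card S)) ?n)\<^sup>2"
      by (rule poly_ext) (simp add: poly_shift_funpow poly_pochhammer cS)
    finally show "(-1) ^ (card S - 1) * of_int (hook_fun v S \<rho>) * (pochhammer (?q + 1 - of_nat (card S)) ?n)\<^sup>2 =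
      shift_op (hook_weight v \<rho> ?q S) ((pochhammer ?q ?n)\<^sup>2)" by simp
  qed
  finally show ?thesis by (simp only: shift_op_sum)
qed

text \<open>\<open>g\<close> has degree \<open>card X - 1\<close>, so exactly one double zero of the
  progression remains: it is \<open>0\<close>, and its axis is the imaginary one. The multiplicity
  \<open>cyc X \<rho> - 1\<close> of the root \<open>1\<close> of \<open>g\<close> is the loss of
  degree from \<open>2 * card X\<close>.\<close>

lemma cyc_poly_roots:
  assumes "finite X" "X \<noteq> {}" "\<rho> permutes X"
  shows "cyc_poly X \<rho> \<noteq> 0" "degree (cyc_poly X \<rho>) = 2 * card X + 1 - cyc X \<rho>"
    "\<And>z. poly (cyc_poly X \<rho>) z = 0 \<Longrightarrow> Re z = 0"
proof -
  obtain v where v: "v \<in> X" using assms(2) by auto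
  define g where "g = (\<Sum>S | v \<in> S \<and> S \<subseteq> X. hook_weight v \<rho> [:0, 1 :: complex:] S)"
  let ?R = "shift_op g ((pochhammer [:0, 1:] (card X))\<^sup>2)"
  have R: "of_nat (card X) * cyc_poly X \<rho> = ?R"
    unfolding g_def by (rule cyc_poly_eq_shift_op[OF assms(1,3) v])
  have \<rho>: "permutation \<rho>" using assms(1,3) by (rule permutes_imp_permutation)
  have n: "card X > 0" using assms(1,2) by (simp add: card_gt_0_iff)
  have "card C > 0" if "C \<in> orbit \<rho> ` X" for C
    using that finite_subset[OF permutes_orbit_subset[OF assms(3)] assms(1)]
    by (auto simp: card_gt_0_iff orbit_nonempty)
  note Q = quotient_prod_one_minus_power[OF _ _ this sum_hook_weight[OF assms(1,3) v, of "[:0, 1 :: complex:]"], folded g_def]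
  have fin: "finite (orbit \<rho> ` X)" "orbit \<rho> ` X \<noteq> {}" using assms(1,2) by auto
  have "(\<Sum>C\<in>orbit \<rho> ` X. card C) = card (\<Union>(orbit \<rho> ` X))"
  proof (rule card_Union_disjoint[symmetric])
    show "pairwise disjnt (orbit \<rho> ` X)"
    proof (rule pairwiseI)
      fix C C' assume C: "C \<in> orbit \<rho> ` X" "C' \<in> orbit \<rho> ` X" "C \<noteq> C'"
      have "z \<notin> C'" if "z \<in> C" for z
      proof
        assume "z \<in> C'"
        then have "C = orbit \<rho> z" "C' = orbit \<rho> z" using C that orbit_eq_iff[OF \<rho>] by blast+
        then show False using C(3) by simp
      qed
      then show "disjnt C C'" by (auto simp: disjnt_def)
    qed
    show "finite C" if "C \<in> orbit \<rho> ` X" for C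
      using that finite_subset[OF permutes_orbit_subset[OF assms(3)] assms(1)] by blast
  qed
  also have "\<Union>(orbit \<rho> ` X) = X"
  proof
    show "\<Union>(orbit \<rho> ` X) \<subseteq> X" by (intro UN_least permutes_orbit_subset[OF assms(3)])
    show "X \<subseteq> \<Union>(orbit \<rho> ` X)"
    proof
      fix x assume "x \<in> X"
      then show "x \<in> \<Union>(orbit \<rho> ` X)" using permutation_self_in_orbit[OF \<rho>, of x] by (rule UN_I)
    qed
  qed
  finally have sum: "(\<Sum>C\<in>orbit \<rho> ` X. card C) = card X" .
  have dg: "degree g = card X - 1" using Q(2)[OF fin] sum by simp
  have bal: "balanced (card X - degree g) ?R" "degree ?R = 2 * card X - order 1 g"
    using Q(1,4)[OF fin] dg n by (intro shift_op_balanced; simp)+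
  have "card X - degree g = 1" using dg n by simp
  then obtain P where P: "P \<noteq> 0" "\<And>z. poly P z = 0 \<Longrightarrow> Re z = 0" "?R = [:0, 1:]\<^sup>2 * P"
    using bal(1) unfolding balanced_def by auto
  have R0: "?R \<noteq> 0" using P(1,3) by simp
  then show "cyc_poly X \<rho> \<noteq> 0" using R by auto
  have smul: "of_nat (card X) * cyc_poly X \<rho> = smult (of_nat (card X)) (cyc_poly X \<rho>)"
    by (simp add: of_nat_poly)
  have "degree (cyc_poly X \<rho>) = degree ?R"
    unfolding R[symmetric] smul using n by simp
  moreover have "order 1 g = cyc X \<rho> - 1" using Q(3)[OF fin] by (simp add: cyc_def)
  moreover have "cyc X \<rho> > 0" using fin by (simp add: cyc_def card_gt_0_iff)
  moreover have "cyc X \<rho> \<le> card X" using assms(1) by (simp add: cyc_def card_image_le)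
  ultimately show "degree (cyc_poly X \<rho>) = 2 * card X + 1 - cyc X \<rho>" using bal(2) by simp
  fix z assume "poly (cyc_poly X \<rho>) z = 0"
  then have "poly ?R z = 0" unfolding R[symmetric] by simp
  then show "Re z = 0" using P(2) unfolding P(3) by auto
qed

text \<open>Cancelling \<open>1 - t\<close> recovers \<open>g\<close> from the orbits. For this
  reason all classes of maps share one polynomial.\<close>

lemma cyc_poly_cong:
  assumes "finite X" "\<rho> permutes X" "\<rho>' permutes X" "orbit \<rho> ` X = orbit \<rho>' ` X"
  shows "cyc_poly X \<rho> = cyc_poly X \<rho>'"
proof (cases "X = {}")
  case True
  then show ?thesis using assms by simp
next
  case False
  then obtain v where v: "v \<in> X" by auto
  let ?g = "\<lambda>\<rho>. \<Sum>S | v \<in> S \<and> S \<subseteq> X. hook_weight v \<rho> [:0, 1 :: complex:] S"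
  have "(1 - [:0, 1:]) * ?g \<rho> = (1 - [:0, 1:]) * ?g \<rho>'"
    unfolding sum_hook_weight[OF assms(1,2) v] sum_hook_weight[OF assms(1,3) v] assms(4) ..
  moreover have "1 - [:0, 1 :: complex:] \<noteq> 0" by (simp add: one_pCons)
  ultimately have "?g \<rho> = ?g \<rho>'" by simp
  then have "of_nat (card X) * cyc_poly X \<rho> = of_nat (card X) * cyc_poly X \<rho>'"
    unfolding cyc_poly_eq_shift_op[OF assms(1,2) v] cyc_poly_eq_shift_op[OF assms(1,3) v] by simp
  moreover have "card X > 0" using assms(1) False by (simp add: card_gt_0_iff)
  ultimately show ?thesis by simp
qed

section \<open>Sums of monomials and the parity of cycle counts\<close>

lemma coeff_sum_monom:
  assumes "finite I"
  shows "coeff (\<Sum>i\<in>I. monom 1 (e i)) k = of_nat (card {i\<in>I. e i = k})"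
proof -
  have "coeff (\<Sum>i\<in>I. monom 1 (e i)) k = (\<Sum>i\<in>I. if e i = k then 1 else 0)"
    by (simp add: coeff_sum)
  also have "\<dots> = of_nat (card {i\<in>I. e i = k})"
    using assms by (simp add: sum.If_cases Int_def)
  finally show ?thesis .
qed

lemma degree_sum_monom_ge:
  assumes "finite I" "i \<in> I"
  shows "e i \<le> degree (\<Sum>i\<in>I. monom (1 :: 'r :: ring_char_0) (e i))"
proof (rule le_degree)
  have "card {j\<in>I. e j = e i} \<noteq> 0" using assms by auto
  then show "coeff (\<Sum>i\<in>I. monom (1 :: 'r) (e i)) (e i) \<noteq> 0"
    by (simp add: coeff_sum_monom[OF assms(1)])
qed

lemma degree_sum_monom_attained:
  assumes "finite I" "(\<Sum>i\<in>I. monom (1 :: 'r :: ring_char_0) (e i)) \<noteq> 0"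
  obtains i where "i \<in> I" "e i = degree (\<Sum>i\<in>I. monom (1 :: 'r) (e i))"
proof -
  have "lead_coeff (\<Sum>i\<in>I. monom (1 :: 'r) (e i)) \<noteq> 0" using assms(2) by simp
  then have "card {i\<in>I. e i = degree (\<Sum>i\<in>I. monom (1 :: 'r) (e i))} \<noteq> 0"
    unfolding coeff_sum_monom[OF assms(1)] by simp
  then show ?thesis using that by (auto simp: card_eq_0_iff)
qed

text \<open>The full cycles of \<open>X\<close> all have the same sign, so
  \<open>sign p * sign p'\<close> is the same for all pairs, and signs determine cycle counts modulo
  \<open>2\<close>.\<close>

lemma cyclic_pairs_parity:
  assumes "finite X" "\<rho> permutes X" "(p, p') \<in> cyclic_pairs X \<rho>" "(r, r') \<in> cyclic_pairs X \<rho>"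
  shows "even (cyc X p + cyc X p' + (cyc X r + cyc X r'))"
proof -
  have *: "(-1) ^ (cyc X p + cyc X p') = - ((-1) ^ card X) * sign \<rho>" if "(p, p') \<in> cyclic_pairs X \<rho>" for p p'
  proof -
    have perm: "p permutes X" "p' permutes X" "cyclic_on (p \<circ> p' \<circ> \<rho>) X"
      using that by (auto simp: cyclic_pairs_def)
    have "p \<circ> p' \<circ> \<rho> permutes X" using perm assms(2) by (auto intro: permutes_compose)
    then have "sign (p \<circ> p' \<circ> \<rho>) = - ((-1) ^ card X)" using assms(1) perm(3) by (intro sign_cyclic_on)
    moreover have "sign (p \<circ> p' \<circ> \<rho>) = sign p * sign p' * sign \<rho>"
      using perm assms(1,2) by (simp add: sign_compose permutation_compose permutes_imp_permutation)
    moreover have "sign p = (-1) ^ card X * (-1) ^ cyc X p" "sign p' = (-1) ^ card X * (-1) ^ cyc X p'"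
      using sign_cyc[OF assms(1) perm(1)] sign_cyc[OF assms(1) perm(2)]
      by (metis (no_types, lifting) left_minus_one_mult_self mult.commute)+
    ultimately have "(-1) ^ (cyc X p + cyc X p') * sign \<rho> = - ((-1) ^ card X :: int)"
      by (simp add: power_add mult_ac)
    then have "(-1) ^ (cyc X p + cyc X p') * (sign \<rho> * sign \<rho>) = - ((-1) ^ card X) * sign \<rho>"
      by (simp only: flip: mult.assoc)
    then show ?thesis by simp
  qed
  have "(-1 :: int) ^ (cyc X p + cyc X p') = (-1) ^ (cyc X r + cyc X r')"
    using *[OF assms(3)] *[OF assms(4)] by simp
  then have "(-1 :: int) ^ (cyc X p + cyc X p' + (cyc X r + cyc X r')) = 1"
    by (simp add: power_add) (metis minus_one_mult_self power_add mult.commute)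
  then show ?thesis by (metis neg_one_odd_power one_neq_neg_one)
qed

lemma cyc_poly_exponent:
  assumes "finite X" "X \<noteq> {}" "\<rho> permutes X" "(p, p') \<in> cyclic_pairs X \<rho>"
  shows "cyc X p + cyc X p' \<le> degree (cyc_poly X \<rho>)"
    and "even (cyc X p + cyc X p' + degree (cyc_poly X \<rho>))"
proof -
  let ?e = "\<lambda>(p, p'). cyc X p + cyc X p'"
  have eq: "cyc_poly X \<rho> = (\<Sum>pp\<in>cyclic_pairs X \<rho>. monom 1 (?e pp))"
    unfolding cyc_poly_def by (intro sum.cong) auto
  note fin = finite_cyclic_pairs[OF assms(1), of \<rho>]
  show "cyc X p + cyc X p' \<le> degree (cyc_poly X \<rho>)"
    unfolding eq using degree_sum_monom_ge[OF fin assms(4), of ?e] by simp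
  obtain rr where rr: "rr \<in> cyclic_pairs X \<rho>" "?e rr = degree (cyc_poly X \<rho>)"
    using degree_sum_monom_attained[OF fin, of ?e] cyc_poly_roots(1)[OF assms(1-3)] unfolding eq by metis
  then show "even (cyc X p + cyc X p' + degree (cyc_poly X \<rho>))"
    using cyclic_pairs_parity[OF assms(1,3,4), of "fst rr" "snd rr"] by (simp add: split_beta)
qed

section \<open>From the location of roots to log-concavity\<close>

text \<open>\<open>b\<close> lists the coefficients after multiplication by \<open>X + s\<close>.
  Besides the given inequalities the mixed terms need
  \<open>a k * a (k + 3) \<le> a (k + 1) * a (k + 2)\<close>. This is the product of two consecutive
  inequalities with a common factor cancelled, which is possible because there are no internal
  zeros.\<close>

lemma log_concave_coeffs_mult_linear:
  fixes a :: "nat \<Rightarrow> real"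
  assumes pos: "\<And>k. k \<le> d \<Longrightarrow> 0 < a k" "\<And>k. k > d \<Longrightarrow> a k = 0"
    and lc: "\<And>k. a k * a (k + 2) \<le> (a (k + 1))\<^sup>2" and s: "s > 0"
  defines "b \<equiv> \<lambda>k. s * a k + (case k of 0 \<Rightarrow> 0 | Suc j \<Rightarrow> a j)"
  shows "b k * b (k + 2) \<le> (b (k + 1))\<^sup>2"
proof -
  have nn: "0 \<le> a k" for k using pos by (metis le_less not_le)
  have cross: "a k * a (k + 3) \<le> a (k + 1) * a (k + 2)" for k
  proof (cases "k + 3 \<le> d")
    case True
    then have p: "0 < a (k + 1) * a (k + 2)" using pos(1) by simp
    have "(a k * a (k + 2)) * (a (k + 1) * a (k + 3)) \<le> (a (k + 1))\<^sup>2 * (a (k + 2))\<^sup>2"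
      using lc[of k] lc[of "k + 1"] nn by (intro mult_mono) (auto simp: numeral_eq_Suc)
    then have "(a k * a (k + 3)) * (a (k + 1) * a (k + 2)) \<le> (a (k + 1) * a (k + 2)) * (a (k + 1) * a (k + 2))"
      by (simp add: power2_eq_square mult_ac)
    then show ?thesis using p by (rule mult_right_le_imp_le)
  next
    case False
    then show ?thesis using pos(2) nn by simp
  qed
  show ?thesis
  proof (cases k)
    case 0
    have "s * a 0 * a 1 \<ge> 0" "a 0 * a 0 \<ge> 0" using s nn by auto
    moreover have "s * s * (a 0 * a 2) \<le> s * s * (a 1)\<^sup>2"
      using lc[of 0] s by (intro mult_left_mono) (auto simp: numeral_eq_Suc)
    ultimately show ?thesis unfolding 0 b_def
      by (simp add: power2_eq_square algebra_simps numeral_2_eq_2)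
        (use zero_le_square[of "a 0"] in linarith)
  next
    case (Suc j)
    have "s * s * (a (j + 1) * a (j + 3)) \<le> s * s * (a (j + 2))\<^sup>2"
      using lc[of "j + 1"] s by (intro mult_left_mono) (auto simp: numeral_eq_Suc)
    moreover have "a j * a (j + 2) \<le> (a (j + 1))\<^sup>2" by (rule lc)
    moreover have "s * (a j * a (j + 3)) \<le> s * (a (j + 1) * a (j + 2))"
      using cross[of j] s by (intro mult_left_mono) auto
    ultimately show ?thesis unfolding Suc b_def
      by (simp add: power2_eq_square algebra_simps numeral_eq_Suc)
  qed
qed

text \<open>A weak form of Newton's inequalities. A complex root exists and is real and negative by
  assumption, so one factor \<open>X + s\<close> with \<open>s > 0\<close> can be split off at a
  time.\<close>

lemma log_concave_if_neg_real_roots: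
  fixes p :: "real poly"
  assumes "lead_coeff p > 0"
    and "\<And>z. poly (map_poly complex_of_real p) z = 0 \<Longrightarrow> z \<in> \<real> \<and> Re z < 0"
  shows "log_concave (coeffs p)"
proof -
  have "(\<forall>k\<le>degree p. 0 < coeff p k) \<and> (\<forall>k. coeff p k * coeff p (k + 2) \<le> (coeff p (k + 1))\<^sup>2)"
    using assms
  proof (induction "degree p" arbitrary: p)
    case 0
    then show ?case by (auto simp: coeff_eq_0)
  next
    case (Suc d)
    have deg: "degree (map_poly complex_of_real p) = degree p" by (rule degree_map_poly) simp
    then have "\<not> constant (poly (map_poly complex_of_real p))"
      using Suc.hyps(2) by (simp add: constant_degree)
    then obtain z where "poly (map_poly complex_of_real p) z = 0"
      using fundamental_theorem_of_algebra by blast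
    moreover from this have z: "z \<in> \<real>" "Re z < 0" using Suc.prems(2) by auto
    moreover define x where "x = Re z"
    ultimately have zx: "z = of_real x" "x < 0" by (auto simp: x_def)
    have ev: "poly (map_poly complex_of_real q) (of_real y) = of_real (poly q y)" for q y
      by (induction q) (simp_all add: map_poly_pCons)
    have "poly p x = 0" using \<open>poly (map_poly complex_of_real p) z = 0\<close> unfolding zx ev by simp
    then obtain q where q: "p = [:- x, 1:] * q" by (metis dvd_def poly_eq_0_iff_dvd)
    have "p \<noteq> 0" using Suc.hyps(2) by auto
    then have q0: "q \<noteq> 0" using q by auto
    have "degree p = degree [:- x, 1:] + degree q" unfolding q using q0 by (intro degree_mult_eq) auto
    then have dq: "degree q = d" using Suc.hyps(2) by simp
    have "lead_coeff p = lead_coeff q" unfolding q lead_coeff_mult by simp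
    then have lq: "lead_coeff q > 0" using Suc.prems(1) by simp
    have mp: "map_poly complex_of_real p = [:- of_real x, 1:] * map_poly complex_of_real q"
      unfolding q by (intro poly_eqI) (simp add: coeff_map_poly coeff_pCons split: nat.splits)
    have IH: "\<forall>k\<le>degree q. 0 < coeff q k" "\<forall>k. coeff q k * coeff q (k + 2) \<le> (coeff q (k + 1))\<^sup>2"
      using Suc.hyps(1)[of q] dq lq Suc.prems(2) unfolding mp by auto
    have cp: "coeff p k = (- x) * coeff q k + (case k of 0 \<Rightarrow> 0 | Suc j \<Rightarrow> coeff q j)" for k
      unfolding q by (simp add: coeff_pCons split: nat.splits)
    have "0 < coeff p k" if "k \<le> degree p" for k
    proof -
      have nn: "0 \<le> coeff q k" for k using IH(1) by (metis coeff_eq_0 le_less not_le)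
      show ?thesis
      proof (cases "k \<le> d")
        case True
        then have "0 < (- x) * coeff q k" using IH(1) dq zx(2) by (intro mult_pos_pos) auto
        moreover have "0 \<le> (case k of 0 \<Rightarrow> 0 | Suc j \<Rightarrow> coeff q j)" using nn by (simp split: nat.splits)
        ultimately show ?thesis unfolding cp by linarith
      next
        case False
        then have "k = Suc d" using that Suc.hyps(2) by simp
        then show ?thesis unfolding cp using IH(1) dq by (simp add: coeff_eq_0)
      qed
    qed
    moreover have "coeff p k * coeff p (k + 2) \<le> (coeff p (k + 1))\<^sup>2" for k
      unfolding cp using IH dq zx(2)
      by (intro log_concave_coeffs_mult_linear[where d = d]) (auto simp: coeff_eq_0)
    ultimately show ?case by blast
  qed
  note * = this
  have "p \<noteq> 0" using assms(1) by auto
  show ?thesis unfolding log_concave_def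
  proof (intro conjI allI impI)
    fix k assume "k < length (coeffs p)"
    then show "0 < coeffs p ! k" using * \<open>p \<noteq> 0\<close> by (simp add: length_coeffs coeffs_nth)
  next
    fix k assume k: "0 < k \<and> k + 1 < length (coeffs p)"
    then obtain j where j: "k = Suc j" by (cases k) auto
    show "coeffs p ! (k - 1) * coeffs p ! (k + 1) \<le> (coeffs p ! k)\<^sup>2"
      using k *[THEN conjunct2, rule_format, of j] \<open>p \<noteq> 0\<close>
      by (simp add: length_coeffs coeffs_nth j)
  qed
qed

text \<open>If \<open>w ^ 2 = 1 / z\<close>, the two polynomials satisfy
  \<open>P w = w ^ N * G z\<close>, since every \<open>N - e i\<close> is even. A zero
  \<open>z\<close> of \<open>G\<close> thus gives an imaginary \<open>w\<close>, and
  \<open>1 / w ^ 2\<close> is negative.\<close>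

lemma log_concave_if_imaginary_roots:
  fixes e :: "'i \<Rightarrow> nat"
  assumes fin: "finite I" "I \<noteq> {}"
    and roots: "\<And>z. poly (\<Sum>i\<in>I. monom (1 :: complex) (e i)) z = 0 \<Longrightarrow> Re z = 0"
    and deg: "degree (\<Sum>i\<in>I. monom (1 :: complex) (e i)) = N"
    and even: "\<And>i. i \<in> I \<Longrightarrow> even (e i + N)"
  shows "log_concave (coeffs (\<Sum>i\<in>I. monom 1 ((N - e i) div 2)))"
proof (rule log_concave_if_neg_real_roots)
  let ?P = "\<Sum>i\<in>I. monom (1 :: complex) (e i)" and ?G = "\<Sum>i\<in>I. monom (1 :: real) ((N - e i) div 2)"
  obtain i0 where "i0 \<in> I" using fin by auto
  have le: "e i \<le> N" if "i \<in> I" for i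
    using degree_sum_monom_ge[OF fin(1) that, of e, where 'r = complex] deg by simp
  have "coeff ?G ((N - e i0) div 2) \<noteq> 0"
    using \<open>i0 \<in> I\<close> fin by (auto simp: coeff_sum_monom[OF fin(1)])
  then have "?G \<noteq> 0" by (metis coeff_0)
  then have "lead_coeff ?G \<noteq> 0" by simp
  moreover have "lead_coeff ?G \<ge> 0" by (simp only: coeff_sum_monom[OF fin(1)] of_nat_0_le_iff)
  ultimately show "lead_coeff ?G > 0" by linarith
  have "map_poly complex_of_real ?G = (\<Sum>i\<in>I. monom 1 ((N - e i) div 2))"
    by (rule poly_eqI) (simp add: coeff_map_poly coeff_sum_monom[OF fin(1)])
  then have ev: "poly (map_poly complex_of_real ?G) z = (\<Sum>i\<in>I. z ^ ((N - e i) div 2))" for z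
    by (simp add: poly_sum poly_monom)
  have evP: "poly ?P z = (\<Sum>i\<in>I. z ^ e i)" for z by (simp add: poly_sum poly_monom)
  fix z assume z: "poly (map_poly complex_of_real ?G) z = 0"
  have "?P \<noteq> 0"
  proof -
    have "coeff ?P (e i0) \<noteq> 0" using \<open>i0 \<in> I\<close> fin by (auto simp: coeff_sum_monom[OF fin(1)])
    then show ?thesis by (metis coeff_0)
  qed
  then obtain i1 where i1: "i1 \<in> I" "e i1 = N"
    using degree_sum_monom_attained[OF fin(1), of e, where 'r = complex] deg by metis
  \<comment> \<open>The exponent \<open>N\<close> occurs, so \<open>G\<close> has a nonzero constant
    term.\<close>
  have z0: "z \<noteq> 0"
  proof
    assume "z = 0"
    then have "poly (map_poly complex_of_real ?G) z = of_real (coeff ?G 0)"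
      by (simp add: poly_0_coeff_0 coeff_map_poly)
    moreover have "coeff ?G 0 \<noteq> 0" using i1 fin by (auto simp: coeff_sum_monom[OF fin(1)])
    ultimately show False using z by simp
  qed
  define w where "w = csqrt (inverse z)"
  have w2: "w\<^sup>2 = inverse z" by (simp add: w_def)
  have w0: "w \<noteq> 0" using w2 z0 by auto
  have zw: "z = inverse (w\<^sup>2)" by (simp add: w2)
  have "w ^ N * z ^ ((N - e i) div 2) = w ^ e i" if i: "i \<in> I" for i
  proof -
    have "even (N - e i)" using even[OF i] le[OF i] by simp
    then have "w ^ (N - e i) = (w\<^sup>2) ^ ((N - e i) div 2)" by (simp flip: power_mult)
    moreover have "w ^ N = w ^ e i * w ^ (N - e i)" using le[OF i] by (simp flip: power_add)
    ultimately show ?thesis using w0 by (simp add: zw power_inverse)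
  qed
  then have "poly ?P w = w ^ N * poly (map_poly complex_of_real ?G) z"
    by (simp add: evP ev sum_distrib_left)
  then have "Re w = 0" using z roots[of w] by simp
  then have "w\<^sup>2 = of_real (- (Im w)\<^sup>2)" "Im w \<noteq> 0"
    using w0 by (auto simp: complex_eq_iff power2_eq_square)
  then have "z = of_real (- inverse ((Im w)\<^sup>2))" "Im w \<noteq> 0" by (auto simp: zw)
  then show "z \<in> \<real> \<and> Re z < 0" by auto
qed

section \<open>Contraction of the forest\<close>

text \<open>The first transposition splices the cycles of \<open>z\<close> and \<open>y\<close> in
  such a way that \<open>y\<close> precedes \<open>z\<close>; the second cuts \<open>z\<close> out.
  On the remaining points the two cycles are merged and nothing else changes.\<close>

lemma contract_orbit:
  assumes fin: "finite A" and R: "R permutes A" and z: "z \<in> A" and y: "y \<in> A" "y \<notin> orbit R z"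
  defines "R' \<equiv> R \<circ> transpose y (inv R z) \<circ> transpose z y"
  shows "R' permutes A - {z}"
    and "\<And>a b. a \<in> A - {z} \<Longrightarrow> b \<in> A - {z} \<Longrightarrow> b \<in> orbit R' a \<longleftrightarrow>
      b \<in> orbit R a \<or> a \<in> orbit R z \<union> orbit R y \<and> b \<in> orbit R z \<union> orbit R y"
    and "cyc A R = Suc (cyc (A - {z}) R')"
proof -
  have pR: "permutation R" using fin R by (rule permutes_imp_permutation)
  have self: "x \<in> orbit R x" for x using pR by (rule permutation_self_in_orbit)
  have yz: "y \<noteq> z" using y(2) self by auto
  have A: "A = insert z (A - {z})" using z by auto
  have finA: "finite (A - {z})" using fin by simp
  define r where "r = inv R z"
  have Rr: "R r = z" unfolding r_def by (rule permutes_inverses(1)[OF R])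
  have rA: "r \<in> A" unfolding r_def using z permutes_in_image[OF permutes_inv[OF R]] by simp
  have "z \<in> orbit R r" using Rr orbit.base[of R r] by simp
  then have Or: "orbit R r = orbit R z" using orbit_eq_iff[OF pR] by metis
  have "r \<notin> orbit R y"
  proof
    assume "r \<in> orbit R y"
    then have "orbit R y = orbit R z" using Or orbit_eq_iff[OF pR] by metis
    then show False using y(2) self[of y] by simp
  qed
  note merge = orbit_comp_transpose[OF pR this]
  define R1 where "R1 = R \<circ> transpose y r"
  have R1: "R1 permutes A" unfolding R1_def using R y rA by (intro permutes_compose permutes_swap_id)
  have pR1: "permutation R1" using fin R1 by (rule permutes_imp_permutation)
  have R1y: "R1 y = z" by (simp add: R1_def Rr)
  have R'_eq: "R' = R1 \<circ> transpose z y" by (simp add: R'_def R1_def r_def)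
  have iy: "inv R1 z = y" using R1y permutes_inverses(2)[OF R1] by metis
  show R': "R' permutes A - {z}"
    using permutes_insert_bypass[of R1 z "A - {z}"] R1 A unfolding iy R'_eq by simp
  have pR': "permutation R'" using finA R' by (rule permutes_imp_permutation)
  have R1_eq: "R1 = R' \<circ> transpose z y" by (simp add: R'_eq comp_assoc)
  have "orbit R' z = {z}" using permutes_not_in[OF R', of z] by (simp add: orbit_eq_singleton_iff)
  then have "y \<notin> orbit R' z" using yz by simp
  note split = orbit_comp_transpose[OF pR' this, folded R1_eq, unfolded \<open>orbit R' z = {z}\<close>]
  have "cyc A R1 = cyc (A - {z}) R'"
    using cyc_insert_transpose[OF finA R', of z y] A y(1) yz unfolding R1_eq by simp
  moreover have "cyc A R = Suc (cyc A R1)"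
    unfolding R1_def using fin R y(1) rA \<open>r \<notin> orbit R y\<close> by (rule cyc_comp_transpose)
  ultimately show "cyc A R = Suc (cyc (A - {z}) R')" by simp
  fix a b assume ab: "a \<in> A - {z}" "b \<in> A - {z}"
  have "b \<in> orbit R' a \<longleftrightarrow> b \<in> orbit R1 a"
    using split[of a] ab orbit_eq_iff[OF pR', of a y] by auto
  also have "\<dots> \<longleftrightarrow> b \<in> orbit R a \<or> a \<in> orbit R z \<union> orbit R y \<and> b \<in> orbit R z \<union> orbit R y"
  proof -
    have "b \<in> orbit R a \<Longrightarrow> a \<in> orbit R z \<union> orbit R y \<Longrightarrow> b \<in> orbit R z \<union> orbit R y"
      by (metis Un_iff orbit_eq_iff[OF pR])
    then show ?thesis using merge[of a] unfolding R1_def[symmetric] Or by auto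
  qed
  finally show "b \<in> orbit R' a \<longleftrightarrow>
      b \<in> orbit R a \<or> a \<in> orbit R z \<union> orbit R y \<and> b \<in> orbit R z \<union> orbit R y" .
qed

definition bypass :: "('a \<Rightarrow> 'a) \<Rightarrow> 'a \<Rightarrow> 'a \<Rightarrow> 'a" where
  "bypass p z = p \<circ> transpose z (inv p z)"

lemma bypass_permutes:
  assumes "p permutes A" "z \<in> A"
  shows "bypass p z permutes A - {z}"
  unfolding bypass_def using assms by (intro permutes_insert_bypass) (simp add: insert_absorb)

lemma bypass_apply:
  assumes "p permutes A" "a \<noteq> z"
  shows "bypass p z a = (if p a = z then p z else p a)"
proof -
  have "a = inv p z \<longleftrightarrow> p a = z" using permutes_inverses[OF assms(1)] by metis
  then show ?thesis using assms(2) by (auto simp: bypass_def transpose_def)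
qed

lemma comp_transpose_eq:
  assumes "inj p"
  shows "p \<circ> transpose a b = transpose (p a) (p b) \<circ> p"
  using assms by (auto simp: fun_eq_iff transpose_def inj_eq)

text \<open>As \<open>\<pi>\<close> fixes \<open>z\<close>, cutting \<open>z\<close> out of
  \<open>p\<close> also cuts it out of the product. Because \<open>p z \<noteq> z\<close>, the point
  \<open>z\<close> is not a cycle of its own, so no cycle is lost.\<close>

lemma cyc_comp_bypass:
  assumes fin: "finite A" and p: "p permutes A" and z: "z \<in> A" "p z \<noteq> z" and \<pi>: "\<pi> permutes A - {z}"
  shows "cyc A (\<pi> \<circ> p) = cyc (A - {z}) (\<pi> \<circ> bypass p z)"
    and "cyc A (p \<circ> \<pi>) = cyc (A - {z}) (bypass p z \<circ> \<pi>)"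
proof -
  let ?y = "inv p z"
  have A: "insert z (A - {z}) = A" using z by auto
  have finA: "finite (A - {z})" using fin by simp
  have b: "bypass p z permutes A - {z}" using p z(1) by (rule bypass_permutes)
  have p_eq: "p = bypass p z \<circ> transpose z ?y" by (simp add: bypass_def comp_assoc)
  have "?y \<noteq> z" using z(2) permutes_inverses(1)[OF p] by metis
  moreover have "?y \<in> A" using z(1) permutes_in_image[OF permutes_inv[OF p]] by simp
  ultimately have y: "?y \<in> A - {z}" by simp
  have "cyc (insert z (A - {z})) (\<pi> \<circ> bypass p z \<circ> transpose z ?y) = cyc (A - {z}) (\<pi> \<circ> bypass p z)"
    using finA y b \<pi> by (intro cyc_insert_transpose permutes_compose) auto
  moreover have "\<pi> \<circ> bypass p z \<circ> transpose z ?y = \<pi> \<circ> p" by (metis p_eq comp_assoc)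
  ultimately show "cyc A (\<pi> \<circ> p) = cyc (A - {z}) (\<pi> \<circ> bypass p z)" unfolding A by simp
  have iz: "inv \<pi> z = z" using permutes_not_in[OF permutes_inv[OF \<pi>], of z] by simp
  have "inv \<pi> ?y \<in> A - {z}" using y permutes_in_image[OF permutes_inv[OF \<pi>]] by blast
  then have "cyc (insert z (A - {z})) (bypass p z \<circ> \<pi> \<circ> transpose z (inv \<pi> ?y)) = cyc (A - {z}) (bypass p z \<circ> \<pi>)"
    using finA b \<pi> by (intro cyc_insert_transpose permutes_compose) auto
  moreover have "\<pi> \<circ> transpose z (inv \<pi> ?y) = transpose z ?y \<circ> \<pi>"
    using permutes_inverses(1)[OF \<pi>] permutes_not_in[OF \<pi>, of z]
    by (simp add: comp_transpose_eq[OF permutes_inj[OF \<pi>]])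
  then have "bypass p z \<circ> \<pi> \<circ> transpose z (inv \<pi> ?y) = p \<circ> \<pi>"
    by (metis p_eq comp_assoc)
  ultimately show "cyc A (p \<circ> \<pi>) = cyc (A - {z}) (bypass p z \<circ> \<pi>)" unfolding A by simp
qed

text \<open>Cutting \<open>z\<close> out of both factors is a contraction of \<open>R\<close> with
  \<open>y = inv \<alpha> z\<close>: the transposition from \<open>\<beta>\<close>, moved to the
  right through \<open>inv w \<circ> \<alpha>\<close>, becomes the splicing one of
  \<open>contract_orbit\<close>, and that from \<open>\<alpha>\<close> cuts out
  \<open>z\<close>.\<close>

lemma bypass_comp:
  assumes \<alpha>: "\<alpha> permutes A" and \<beta>: "\<beta> permutes A" and w: "w permutes X" and z: "z \<notin> X"
  defines "R \<equiv> \<beta> \<circ> inv w \<circ> \<alpha>"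
  shows "bypass \<beta> z \<circ> inv w \<circ> bypass \<alpha> z = R \<circ> transpose (inv \<alpha> z) (inv R z) \<circ> transpose z (inv \<alpha> z)"
proof -
  let ?y = "inv \<alpha> z" and ?g = "inv w \<circ> \<alpha>"
  have wz: "inv w z = z" using permutes_not_in[OF permutes_inv[OF w] z] .
  have bij: "bij \<alpha>" "bij \<beta>" "bij (inv w)" using \<alpha> \<beta> permutes_inv[OF w] by (auto intro: permutes_bij)
  have 1: "?g ?y = z" using wz permutes_inverses(1)[OF \<alpha>] by simp
  have 2: "?g (inv R z) = inv \<beta> z"
  proof -
    have "bij R" unfolding R_def using bij by (intro bij_comp)
    then have "R (inv R z) = z" by (simp add: bij_is_surj surj_f_inv_f)
    then have "\<beta> (?g (inv R z)) = z" by (simp add: R_def)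
    then show ?thesis using permutes_inverses(2)[OF \<beta>] by metis
  qed
  have "inj ?g" using bij by (intro bij_is_inj bij_comp)
  then have 3: "transpose z (inv \<beta> z) \<circ> ?g = ?g \<circ> transpose ?y (inv R z)"
    using comp_transpose_eq[of ?g ?y "inv R z"] unfolding 1 2 by simp
  have "bypass \<beta> z \<circ> inv w \<circ> bypass \<alpha> z = \<beta> \<circ> (transpose z (inv \<beta> z) \<circ> ?g) \<circ> transpose z ?y"
    by (simp add: bypass_def comp_assoc)
  also have "\<dots> = R \<circ> transpose ?y (inv R z) \<circ> transpose z ?y"
    unfolding 3 by (simp add: R_def comp_assoc)
  finally show ?thesis .
qed

section \<open>Forest components and their contraction\<close>

locale fan_handle = fin_digraph D for D :: "('a, 'b) pre_digraph" +
  fixes u :: 'a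
  assumes u_in_verts: "u \<in> verts D"
    and forest: "directed_forest (pre_digraph.del_vert D u)"
begin

text \<open>Undirected adjacency through the arcs of \<open>Z\<close> that avoid the handle;
  \<open>Z\<close> will be the set of deleted arcs, and the classes of the closure are the parts of
  trees contracted to one vertex.\<close>

definition link :: "'b set \<Rightarrow> ('a \<times> 'a) set" where
  "link Z = {(x, y). \<exists>a\<in>Z. tail D a \<noteq> u \<and> head D a \<noteq> u \<and>
    (x = tail D a \<and> y = head D a \<or> x = head D a \<and> y = tail D a)}"

abbreviation linked :: "'b set \<Rightarrow> 'a \<Rightarrow> 'a \<Rightarrow> bool" where
  "linked Z x y \<equiv> (x, y) \<in> (link Z)\<^sup>*"

lemma linked_sym: "linked Z x y \<Longrightarrow> linked Z y x"
  using sym_rtrancl[of "link Z"] by (auto simp: link_def sym_def)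

lemma linked_trans: "linked Z x y \<Longrightarrow> linked Z y w \<Longrightarrow> linked Z x w"
  by (rule rtrancl_trans)

lemma linked_mono: "linked Z x y \<Longrightarrow> Z \<subseteq> Z' \<Longrightarrow> linked Z' x y"
  by (rule subsetD[OF rtrancl_mono]) (auto simp: link_def)

lemma link_insert:
  assumes "tail D z \<noteq> u" "head D z \<noteq> u"
  shows "link (insert z Z) = insert (tail D z, head D z) (insert (head D z, tail D z) (link Z))"
  using assms by (auto simp: link_def)

lemma link_insert_handle:
  assumes "tail D z = u \<or> head D z = u"
  shows "link (insert z Z) = link Z"
  using assms by (auto simp: link_def)

lemma linked_insert:
  assumes "tail D z \<noteq> u" "head D z \<noteq> u"
  shows "linked (insert z Z) x y \<longleftrightarrow> linked Z x y \<or>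
    (linked Z (tail D z) x \<or> linked Z (head D z) x) \<and> (linked Z (tail D z) y \<or> linked Z (head D z) y)"
  unfolding link_insert[OF assms] rtrancl_insert
  using linked_sym linked_trans by blast

text \<open>A connection of the two ends by arcs of \<open>Z\<close> would close up with
  \<open>z\<close> to a cycle of the forest.\<close>

lemma forest_not_linked:
  assumes Z: "Z \<subseteq> arcs D" and z: "z \<in> arcs D" "z \<notin> Z" "tail D z \<noteq> u" "head D z \<noteq> u"
  shows "\<not> linked Z (tail D z) (head D z)"
proof
  assume "linked Z (tail D z) (head D z)"
  then have l: "linked Z (head D z) (tail D z)" by (rule linked_sym)
  define H where "H = underlying (del_vert u)"
  have H: "verts H = verts D - {u}" "arcs H = {a \<in> arcs D. tail D a \<noteq> u \<and> head D a \<noteq> u} \<times> UNIV"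
    "\<And>a. tail H (a, True) = tail D a" "\<And>a. tail H (a, False) = head D a"
    "\<And>a. head H (a, True) = head D a" "\<And>a. head H (a, False) = tail D a"
    by (auto simp: H_def underlying_def darts_def dart_vert_def opp_def del_vert_simps)
  interpret H: wf_digraph H
  proof
    fix e assume "e \<in> arcs H"
    then show "tail H e \<in> verts H" "head H e \<in> verts H"
      by (cases e; cases "snd e"; auto simp: H)+
  qed
  have "\<exists>p. H.awalk (head D z) p y \<and> fst ` set p \<subseteq> Z" if "linked Z (head D z) y" for y
    using that
  proof (induction rule: rtrancl_induct)
    case base
    have "H.awalk (head D z) [] (head D z)" using z by (simp add: H.awalk_Nil_iff H)
    then show ?case by (intro exI[of _ "[]"]) simp
  next
    case (step x y)
    then obtain p where p: "H.awalk (head D z) p x" "fst ` set p \<subseteq> Z" by blast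
    from step(2) obtain a where a: "a \<in> Z" "tail D a \<noteq> u" "head D a \<noteq> u"
      "x = tail D a \<and> y = head D a \<or> x = head D a \<and> y = tail D a"
      by (auto simp: link_def)
    then obtain d where d: "fst d = a" "tail H d = x" "head H d = y" "d \<in> arcs H"
    proof (cases "x = tail D a \<and> y = head D a")
      case True
      then show ?thesis using a Z that[of "(a, True)"] by (auto simp: H)
    next
      case False
      then show ?thesis using a Z that[of "(a, False)"] by (auto simp: H)
    qed
    have "H.awalk x [d] y" using H.arc_implies_awalk[OF d(4)] d by simp
    then have "H.awalk (head D z) (p @ [d]) y" using p(1) by (intro H.awalk_appendI)
    then show ?case using p(2) d(1) a(1) by (intro exI[of _ "p @ [d]"]) auto
  qed
  from this[OF l] obtain p where p: "H.awalk (head D z) p (tail D z)" "fst ` set p \<subseteq> Z" by blast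
  \<comment> \<open>The walk is shortened to a path because a cycle must not repeat an edge, not
    even in the opposite direction.\<close>
  define p' where "p' = H.awalk_to_apath p"
  have ap: "H.apath (head D z) p' (tail D z)" unfolding p'_def using p(1) by (rule H.apath_awalk_to_apath)
  have sub: "fst ` set p' \<subseteq> Z" using p(2) H.awalk_to_apath_subset[OF p(1)] unfolding p'_def by auto
  have ends: "tail H d \<in> set (H.awalk_verts x p) \<and> head H d \<in> set (H.awalk_verts x p)"
    if "H.cas x p y" "d \<in> set p" for d x p y
    using that
  proof (induction p arbitrary: x)
    case (Cons e p)
    have "head H e \<in> set (H.awalk_verts (head H e) p)"
      using Cons.prems(1) by (cases p) auto
    then show ?case using Cons by auto
  qed simp
  \<comment> \<open>Using the first edge again, in either direction, would return to the first
    vertex of the path.\<close>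
  have "distinct (map fst p)" if "H.apath x p y" for x p y
    using that
  proof (induction p arbitrary: x)
    case (Cons d p)
    then have d: "tail H d = x" "H.apath (head H d) p y" "x \<notin> set (H.awalk_verts (head H d) p)"
      by (auto simp: H.apath_Cons_iff)
    have "fst d \<noteq> fst d'" if d': "d' \<in> set p" for d'
    proof
      assume eq: "fst d = fst d'"
      have "tail H d' \<in> set (H.awalk_verts (head H d) p)" "head H d' \<in> set (H.awalk_verts (head H d) p)"
        using ends[OF _ d'] d(2) by (auto simp: H.apath_def H.awalk_def)
      moreover have "x = tail H d' \<or> x = head H d'"
        using eq d(1) by (cases d; cases d'; cases "snd d"; cases "snd d'") (auto simp: H)
      ultimately show False using d(3) by auto
    qed
    then show ?case using Cons.IH[OF d(2)] by auto
  qed simp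
  from this[OF ap] have dist: "distinct (map fst p')" .
  have zH: "(z, True) \<in> arcs H" using z by (simp add: H)
  have "H.awalk (tail D z) ((z, True) # p') (tail D z)"
    using ap zH by (simp add: H.awalk_Cons_iff H H.apath_def)
  moreover have "distinct (tl (H.awalk_verts (tail D z) ((z, True) # p')))"
    using ap by (simp add: H H.apath_def)
  ultimately have "H.cycle ((z, True) # p')" unfolding H.cycle_def by blast
  moreover have "distinct (map fst ((z, True) # p'))" using dist sub z(2) by auto
  ultimately show False using forest unfolding directed_forest_def H_def by blast
qed

abbreviation "X \<equiv> out_arcs D u"

text \<open>
  In a face-oriented map, \<open>\<alpha> a\<close> is the arc that follows \<open>a\<close> around its head and \<open>\<beta> a\<close> the arc that
  follows \<open>a\<close> around its tail; the cycles of \<open>\<alpha>\<close> and of \<open>\<beta>\<close> are the faces of the two orientations.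
\<close>

definition map_pairs :: "(('b \<Rightarrow> 'b) \<times> ('b \<Rightarrow> 'b)) set" where
  "map_pairs = {(\<alpha>, \<beta>). \<alpha> permutes arcs D \<and> \<beta> permutes arcs D \<and>
     (\<forall>a\<in>arcs D. tail D (\<alpha> a) = head D a) \<and> (\<forall>a\<in>arcs D. head D (\<beta> a) = tail D a) \<and>
     (\<forall>v\<in>verts D. in_arcs D v \<noteq> {} \<longrightarrow> cyclic_on (\<beta> \<circ> \<alpha>) (in_arcs D v))}"

lemma X_iff: "a \<in> X \<longleftrightarrow> a \<in> arcs D \<and> tail D a = u"
  by (auto simp: out_arcs_def)

text \<open>
  Fix the rotations away from the handle and delete, one by one, the arcs that do not leave the
  handle; then \<open>\<beta> \<circ> inv w \<circ> \<alpha>\<close>, which rotates the incoming arcs of each vertex other than the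
  handle, has its orbits merged along the arcs of the forest.
\<close>

definition contraction :: "('b \<Rightarrow> 'b) \<Rightarrow> ('b \<Rightarrow> 'b) \<Rightarrow> ('b \<Rightarrow> 'b) \<Rightarrow> 'b set \<Rightarrow> ('b \<Rightarrow> 'b) \<Rightarrow> ('b \<Rightarrow> 'b) \<Rightarrow> bool" where
  "contraction \<alpha> \<beta> w Z \<alpha>' \<beta>' \<longleftrightarrow> \<alpha>' permutes arcs D - Z \<and> \<beta>' permutes arcs D - Z \<and>
    (\<forall>\<pi>. \<pi> permutes X \<longrightarrow> cyc (arcs D) (\<pi> \<circ> \<alpha>) = cyc (arcs D - Z) (\<pi> \<circ> \<alpha>')) \<and>
    (\<forall>\<pi>. \<pi> permutes X \<longrightarrow> cyc (arcs D) (\<beta> \<circ> \<pi>) = cyc (arcs D - Z) (\<beta>' \<circ> \<pi>)) \<and>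
    (\<forall>a\<in>arcs D - Z. \<alpha>' a \<in> X \<or> head D a \<noteq> u \<and> linked Z (tail D (\<alpha>' a)) (head D a)) \<and>
    (\<forall>a\<in>arcs D - Z. a \<notin> X \<longrightarrow> head D (\<beta>' a) \<noteq> u \<and> linked Z (head D (\<beta>' a)) (tail D a)) \<and>
    (\<forall>a\<in>arcs D - Z. \<forall>b\<in>arcs D - Z. b \<in> orbit (\<beta>' \<circ> inv w \<circ> \<alpha>') a \<longleftrightarrow>
      (if head D a = u then b = a else head D b \<noteq> u \<and> linked Z (head D a) (head D b))) \<and>
    cyc (arcs D) (\<beta> \<circ> inv w \<circ> \<alpha>) = cyc (arcs D - Z) (\<beta>' \<circ> inv w \<circ> \<alpha>') + card Z"

text \<open>The predecessor \<open>y\<close> of \<open>z\<close> under \<open>\<alpha>'\<close>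
  enters the component of \<open>tail D z\<close>, so the orbits of \<open>y\<close> and
  \<open>z\<close> that get merged consist of the arcs entering the components of the two ends of
  \<open>z\<close>. These components are distinct by the forest property and become one. If
  \<open>z\<close> ends at the handle, its orbit is \<open>{z}\<close>, and the other orbits merely
  lose nothing.\<close>

lemma contraction_insert:
  assumes IH: "contraction \<alpha> \<beta> w Z \<alpha>' \<beta>'" and w: "w permutes X"
    and Z: "insert z Z \<subseteq> arcs D - X" "z \<notin> Z"
  shows "contraction \<alpha> \<beta> w (insert z Z) (bypass \<alpha>' z) (bypass \<beta>' z)"
proof -
  define A where "A = arcs D - Z"
  have finA: "finite A" by (simp add: A_def)
  have zA: "z \<in> A" "z \<in> arcs D" "z \<notin> X" using Z by (auto simp: A_def)
  then have tz: "tail D z \<noteq> u" by (auto simp: X_iff)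
  have ZD: "Z \<subseteq> arcs D" using Z by auto
  have finZ: "finite Z" using finite_subset[OF ZD finite_arcs] .
  have AZ: "arcs D - insert z Z = A - {z}" by (auto simp: A_def)
  have XA: "X \<subseteq> A - {z}" using Z by (auto simp: A_def X_iff)
  note IH' = IH[unfolded contraction_def, folded A_def]
  have a: "\<alpha>' permutes A" "\<And>\<pi>. \<pi> permutes X \<Longrightarrow> cyc (arcs D) (\<pi> \<circ> \<alpha>) = cyc A (\<pi> \<circ> \<alpha>')"
      "\<And>a. a \<in> A \<Longrightarrow> \<alpha>' a \<in> X \<or> head D a \<noteq> u \<and> linked Z (tail D (\<alpha>' a)) (head D a)"
    and b: "\<beta>' permutes A" "\<And>\<pi>. \<pi> permutes X \<Longrightarrow> cyc (arcs D) (\<beta> \<circ> \<pi>) = cyc A (\<beta>' \<circ> \<pi>)"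
      "\<And>a. a \<in> A \<Longrightarrow> a \<notin> X \<Longrightarrow> head D (\<beta>' a) \<noteq> u \<and> linked Z (head D (\<beta>' a)) (tail D a)"
    and r: "\<And>a b. a \<in> A \<Longrightarrow> b \<in> A \<Longrightarrow> b \<in> orbit (\<beta>' \<circ> inv w \<circ> \<alpha>') a \<longleftrightarrow>
      (if head D a = u then b = a else head D b \<noteq> u \<and> linked Z (head D a) (head D b))"
    and c: "cyc (arcs D) (\<beta> \<circ> inv w \<circ> \<alpha>) = cyc A (\<beta>' \<circ> inv w \<circ> \<alpha>') + card Z"
    using IH' by blast+
  let ?R = "\<beta>' \<circ> inv w \<circ> \<alpha>'"
  have wA: "w permutes A" using w XA by (auto intro: permutes_subset)
  have RA: "?R permutes A" using a(1) b(1) wA by (intro permutes_compose permutes_inv)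
  have notl: "\<not> linked Z (tail D z) (head D z)" if "head D z \<noteq> u"
    using forest_not_linked[OF ZD zA(2) Z(2) tz that] .
  \<comment> \<open>A fixed point \<open>z\<close> of \<open>\<alpha>'\<close> or
    \<open>\<beta>'\<close> would have its two ends linked by deleted arcs.\<close>
  have az: "\<alpha>' z \<noteq> z"
  proof
    assume "\<alpha>' z = z"
    then show False using a(3)[OF zA(1)] zA(3) notl by auto
  qed
  have bz: "\<beta>' z \<noteq> z"
  proof
    assume "\<beta>' z = z"
    then show False using b(3)[OF zA(1,3)] notl linked_sym by auto
  qed
  define y where "y = inv \<alpha>' z"
  have ay: "\<alpha>' y = z" unfolding y_def by (rule permutes_inverses(1)[OF a(1)])
  have yA: "y \<in> A" unfolding y_def using zA(1) permutes_in_image[OF permutes_inv[OF a(1)]] by simp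
  have yz: "y \<noteq> z" using ay az by auto
  have ly: "head D y \<noteq> u" "linked Z (tail D z) (head D y)" using a(3)[OF yA] zA(3) ay by auto
  have yO: "y \<notin> orbit ?R z"
  proof
    assume "y \<in> orbit ?R z"
    then have "head D z \<noteq> u" "linked Z (head D z) (head D y)" using r[OF zA(1) yA] yz by (auto split: if_splits)
    then show False using notl ly(2) linked_sym linked_trans by blast
  qed
  let ?\<alpha> = "bypass \<alpha>' z" and ?\<beta> = "bypass \<beta>' z"
  have R'_eq: "?\<beta> \<circ> inv w \<circ> ?\<alpha> = ?R \<circ> transpose y (inv ?R z) \<circ> transpose z y"
    unfolding y_def by (rule bypass_comp[OF a(1) b(1) w zA(3)])
  note con = contract_orbit[OF finA RA zA(1) yA yO, folded R'_eq]
  have mono: "linked Z s t \<Longrightarrow> linked (insert z Z) s t" for s t by (rule linked_mono) auto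
  have new: "linked (insert z Z) (head D z) (tail D z)" if "head D z \<noteq> u"
    using tz that by (subst linked_insert) auto
  show ?thesis unfolding contraction_def AZ
  proof (intro conjI allI ballI impI)
    show "?\<alpha> permutes A - {z}" "?\<beta> permutes A - {z}" using a(1) b(1) zA(1) by (auto intro: bypass_permutes)
    show "cyc (arcs D) (\<pi> \<circ> \<alpha>) = cyc (A - {z}) (\<pi> \<circ> ?\<alpha>)" if "\<pi> permutes X" for \<pi>
      using a(2)[OF that] cyc_comp_bypass(1)[OF finA a(1) zA(1) az permutes_subset[OF that XA]] by simp
    show "cyc (arcs D) (\<beta> \<circ> \<pi>) = cyc (A - {z}) (?\<beta> \<circ> \<pi>)" if "\<pi> permutes X" for \<pi>
      using b(2)[OF that] cyc_comp_bypass(2)[OF finA b(1) zA(1) bz permutes_subset[OF that XA]] by simp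
    show "cyc (arcs D) (\<beta> \<circ> inv w \<circ> \<alpha>) = cyc (A - {z}) (?\<beta> \<circ> inv w \<circ> ?\<alpha>) + card (insert z Z)"
      using c con(3) finZ Z(2) by simp
  next
    fix x assume x: "x \<in> A - {z}"
    show "?\<alpha> x \<in> X \<or> head D x \<noteq> u \<and> linked (insert z Z) (tail D (?\<alpha> x)) (head D x)"
    proof (cases "\<alpha>' x = z")
      case True
      then have ax: "?\<alpha> x = \<alpha>' z" using x bypass_apply[OF a(1)] by simp
      have lx: "head D x \<noteq> u" "linked Z (tail D z) (head D x)" using a(3)[of x] x True zA(3) by auto
      show ?thesis
        using a(3)[OF zA(1)] lx new mono linked_trans unfolding ax by meson
    next
      case False
      then have "?\<alpha> x = \<alpha>' x" using x bypass_apply[OF a(1)] by simp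
      then show ?thesis using a(3)[of x] x mono by auto
    qed
  next
    fix x assume x: "x \<in> A - {z}" "x \<notin> X"
    have "head D (?\<beta> x) \<noteq> u \<and> linked (insert z Z) (head D (?\<beta> x)) (tail D x)"
    proof (cases "\<beta>' x = z")
      case True
      then have bx: "?\<beta> x = \<beta>' z" using x bypass_apply[OF b(1)] by simp
      have lx: "head D z \<noteq> u" "linked Z (head D z) (tail D x)" using b(3)[of x] x True by auto
      show ?thesis
        using b(3)[OF zA(1,3)] lx new[OF lx(1)] mono linked_trans linked_sym unfolding bx by meson
    next
      case False
      then have "?\<beta> x = \<beta>' x" using x bypass_apply[OF b(1)] by simp
      then show ?thesis using b(3)[of x] x mono by auto
    qed
    then show "head D (?\<beta> x) \<noteq> u" "linked (insert z Z) (head D (?\<beta> x)) (tail D x)" by auto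
  next
    fix x x' assume x: "x \<in> A - {z}" "x' \<in> A - {z}"
    have "x' \<in> orbit (?\<beta> \<circ> inv w \<circ> ?\<alpha>) x \<longleftrightarrow>
      x' \<in> orbit ?R x \<or> x \<in> orbit ?R z \<union> orbit ?R y \<and> x' \<in> orbit ?R z \<union> orbit ?R y"
      using con(2)[OF x] .
    also have "\<dots> \<longleftrightarrow> (if head D x = u then x' = x else head D x' \<noteq> u \<and> linked (insert z Z) (head D x) (head D x'))"
    proof (cases "head D z = u")
      case True
      then have Oz: "x \<notin> orbit ?R z" "x' \<notin> orbit ?R z" using r[OF zA(1)] x by auto
      have li: "linked (insert z Z) s t \<longleftrightarrow> linked Z s t" for s t
        using link_insert_handle[of z Z] True by simp
      have "x' \<in> orbit ?R x" if "x \<in> orbit ?R y" "x' \<in> orbit ?R y"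
      proof -
        have "permutation ?R" using finA RA by (rule permutes_imp_permutation)
        then show ?thesis using that by (metis orbit_eq_iff)
      qed
      then show ?thesis using Oz r[of x x'] x unfolding li by auto
    next
      case False
      have "x \<in> orbit ?R z \<longleftrightarrow> head D x \<noteq> u \<and> linked Z (head D z) (head D x)"
        "x' \<in> orbit ?R z \<longleftrightarrow> head D x' \<noteq> u \<and> linked Z (head D z) (head D x')"
        "x \<in> orbit ?R y \<longleftrightarrow> head D x \<noteq> u \<and> linked Z (head D y) (head D x)"
        "x' \<in> orbit ?R y \<longleftrightarrow> head D x' \<noteq> u \<and> linked Z (head D y) (head D x')"
        using r zA(1) yA x False ly(1) by auto
      moreover have "linked Z (head D y) t \<longleftrightarrow> linked Z (tail D z) t" for t
        using ly(2) linked_sym linked_trans by blast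
      ultimately show ?thesis
        using r[of x x'] x linked_insert[OF tz False, of "head D x" "head D x'" Z] by auto
    qed
    finally show "x' \<in> orbit (?\<beta> \<circ> inv w \<circ> ?\<alpha>) x \<longleftrightarrow>
      (if head D x = u then x' = x else head D x' \<noteq> u \<and> linked (insert z Z) (head D x) (head D x'))" .
  qed
qed

lemma contraction_exists:
  assumes \<alpha>: "\<alpha> permutes arcs D" "\<And>a. a \<in> arcs D \<Longrightarrow> tail D (\<alpha> a) = head D a"
    and \<beta>: "\<beta> permutes arcs D" "\<And>a. a \<in> arcs D \<Longrightarrow> head D (\<beta> a) = tail D a"
    and w: "w permutes X"
    and R: "\<And>a b. a \<in> arcs D \<Longrightarrow> b \<in> arcs D \<Longrightarrow> b \<in> orbit (\<beta> \<circ> inv w \<circ> \<alpha>) a \<longleftrightarrow>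
      (if head D a = u then b = a else head D b = head D a)"
    and Z: "Z \<subseteq> arcs D - X"
  shows "\<exists>\<alpha>' \<beta>'. contraction \<alpha> \<beta> w Z \<alpha>' \<beta>'"
proof -
  have "finite Z" using Z finite_subset[of Z "arcs D"] by auto
  then show ?thesis using Z
  proof (induction Z rule: finite_induct)
    case empty
    have "linked {} x y \<longleftrightarrow> x = y" for x y by (simp add: link_def)
    then have "contraction \<alpha> \<beta> w {} \<alpha> \<beta>"
      unfolding contraction_def using \<alpha> \<beta> R permutes_in_image[OF \<alpha>(1)] by (auto simp: X_iff)
    then show ?case by blast
  next
    case (insert z Z)
    then obtain \<alpha>' \<beta>' where "contraction \<alpha> \<beta> w Z \<alpha>' \<beta>'" by auto
    then show ?case using contraction_insert[OF _ w insert.prems insert.hyps(2)] by blast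
  qed
qed

end

section \<open>From permutations to maps\<close>

lemma cyclic_on_conj:
  assumes "finite X" "s permutes X" "g permutes X"
  shows "cyclic_on (s \<circ> g \<circ> inv s) X \<longleftrightarrow> cyclic_on g X"
  using assms cyclic_on_iff_cyc[of X g] cyclic_on_iff_cyc[of X "s \<circ> g \<circ> inv s"] cyc_conj[of s X g]
  by (simp add: permutes_compose permutes_inv)

context fan_handle
begin

section \<open>Maps that differ only at the handle\<close>

lemma finite_map_pairs: "finite map_pairs"
proof -
  have "map_pairs \<subseteq> {p. p permutes arcs D} \<times> {p. p permutes arcs D}" by (auto simp: map_pairs_def)
  then show ?thesis using finite_permutations[OF finite_arcs] finite_subset by blast
qed

lemma map_pairsD:
  assumes "(\<alpha>, \<beta>) \<in> map_pairs"
  shows "\<alpha> permutes arcs D" "\<beta> permutes arcs D"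
    "\<And>a. a \<in> arcs D \<Longrightarrow> tail D (\<alpha> a) = head D a" "\<And>a. a \<in> arcs D \<Longrightarrow> head D (\<beta> a) = tail D a"
    "\<And>v. v \<in> verts D \<Longrightarrow> in_arcs D v \<noteq> {} \<Longrightarrow> cyclic_on (\<beta> \<circ> \<alpha>) (in_arcs D v)"
  using assms by (auto simp: map_pairs_def)

lemma map_pairs_image:
  assumes "(\<alpha>, \<beta>) \<in> map_pairs"
  shows "\<alpha> ` in_arcs D v = out_arcs D v" "\<beta> ` out_arcs D v = in_arcs D v"
proof -
  note m = map_pairsD[OF assms]
  have "b \<in> \<alpha> ` in_arcs D v" if b: "b \<in> out_arcs D v" for b
  proof
    show "b = \<alpha> (inv \<alpha> b)" using permutes_inverses(1)[OF m(1)] by simp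
    have "inv \<alpha> b \<in> arcs D" using b permutes_in_image[OF permutes_inv[OF m(1)]] by simp
    then show "inv \<alpha> b \<in> in_arcs D v" using b m(3)[of "inv \<alpha> b"] permutes_inverses(1)[OF m(1)] by simp
  qed
  then show "\<alpha> ` in_arcs D v = out_arcs D v" using m(3) permutes_in_image[OF m(1)] by auto
  have "b \<in> \<beta> ` out_arcs D v" if b: "b \<in> in_arcs D v" for b
  proof
    show "b = \<beta> (inv \<beta> b)" using permutes_inverses(1)[OF m(2)] by simp
    have "inv \<beta> b \<in> arcs D" using b permutes_in_image[OF permutes_inv[OF m(2)]] by simp
    then show "inv \<beta> b \<in> out_arcs D v" using b m(4)[of "inv \<beta> b"] permutes_inverses(1)[OF m(2)] by simp
  qed
  then show "\<beta> ` out_arcs D v = in_arcs D v" using m(4) permutes_in_image[OF m(2)] by auto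
qed

lemma X_arcs: "X \<subseteq> arcs D" and finite_X: "finite X"
  by (auto simp: out_arcs_def)

text \<open>Permutations of \<open>X\<close> affect only the turns at the handle, so the rotations
  at all other vertices stay cyclic. At the handle, \<open>\<alpha>\<close> transports the condition
  from the incoming to the outgoing arcs.\<close>

lemma map_pairs_twist_iff:
  assumes m: "(\<alpha>, \<beta>) \<in> map_pairs" and \<pi>: "\<pi> permutes X" and \<kappa>: "\<kappa> permutes X" and X: "X \<noteq> {}"
  shows "(\<pi> \<circ> \<alpha>, \<beta> \<circ> \<kappa>) \<in> map_pairs \<longleftrightarrow> cyclic_on (\<alpha> \<circ> \<beta> \<circ> \<kappa> \<circ> \<pi>) X"
proof -
  note mD = map_pairsD[OF m] and im = map_pairs_image[OF m]
  have perm: "\<pi> permutes arcs D" "\<kappa> permutes arcs D" using \<pi> \<kappa> X_arcs by (auto intro: permutes_subset)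
  have t\<pi>: "tail D (\<pi> a) = tail D a" for a
    using permutes_in_image[OF \<pi>, of a] permutes_not_in[OF \<pi>, of a] by (cases "a \<in> X") auto
  have t\<kappa>: "tail D (\<kappa> a) = tail D a" for a
    using permutes_in_image[OF \<kappa>, of a] permutes_not_in[OF \<kappa>, of a] by (cases "a \<in> X") auto
  have other: "cyclic_on (\<beta> \<circ> \<kappa> \<circ> (\<pi> \<circ> \<alpha>)) (in_arcs D v)" if "v \<in> verts D" "in_arcs D v \<noteq> {}" "v \<noteq> u" for v
  proof (subst cyclic_cong)
    show "cyclic_on (\<beta> \<circ> \<alpha>) (in_arcs D v)" using mD(5) that by blast
    fix a assume "a \<in> in_arcs D v"
    then have "tail D (\<alpha> a) = v" using mD(3) by simp
    then have "\<alpha> a \<notin> X" using that(3) by auto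
    then show "(\<beta> \<circ> \<kappa> \<circ> (\<pi> \<circ> \<alpha>)) a = (\<beta> \<circ> \<alpha>) a"
      using permutes_not_in[OF \<pi>] permutes_not_in[OF \<kappa>] by simp
  qed
  have "in_arcs D u \<noteq> {}" using im(1)[of u] X by auto
  then have "(\<pi> \<circ> \<alpha>, \<beta> \<circ> \<kappa>) \<in> map_pairs \<longleftrightarrow> cyclic_on (\<beta> \<circ> \<kappa> \<circ> (\<pi> \<circ> \<alpha>)) (in_arcs D u)"
    using other u_in_verts mD perm t\<pi> t\<kappa> permutes_in_image[OF perm(2)]
    by (auto simp: map_pairs_def intro!: permutes_compose)
  also have "\<dots> \<longleftrightarrow> cyclic_on (\<alpha> \<circ> \<beta> \<circ> \<kappa> \<circ> \<pi>) X"
  proof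
    assume "cyclic_on (\<beta> \<circ> \<kappa> \<circ> (\<pi> \<circ> \<alpha>)) (in_arcs D u)"
    from cyclic_on_image[OF this, of "\<alpha> \<circ> \<beta> \<circ> \<kappa> \<circ> \<pi>" \<alpha>]
    show "cyclic_on (\<alpha> \<circ> \<beta> \<circ> \<kappa> \<circ> \<pi>) X" unfolding im(1) by simp
  next
    assume "cyclic_on (\<alpha> \<circ> \<beta> \<circ> \<kappa> \<circ> \<pi>) X"
    from cyclic_on_image[OF this, of "\<beta> \<circ> \<kappa> \<circ> (\<pi> \<circ> \<alpha>)" "\<beta> \<circ> \<kappa> \<circ> \<pi>"]
    have "cyclic_on (\<beta> \<circ> \<kappa> \<circ> (\<pi> \<circ> \<alpha>)) ((\<beta> \<circ> \<kappa> \<circ> \<pi>) ` X)" by simp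
    also have "(\<beta> \<circ> \<kappa> \<circ> \<pi>) ` X = in_arcs D u"
      by (simp only: permutes_image[OF \<pi>] permutes_image[OF \<kappa>] im(2) flip: image_comp)
    finally show "cyclic_on (\<beta> \<circ> \<kappa> \<circ> (\<pi> \<circ> \<alpha>)) (in_arcs D u)" .
  qed
  finally show ?thesis .
qed

text \<open>The maps that agree with the given one away from the handle, recorded by how their turns
  at the handle differ from its turns.\<close>

definition twists :: "('b \<Rightarrow> 'b) \<times> ('b \<Rightarrow> 'b) \<Rightarrow> (('b \<Rightarrow> 'b) \<times> ('b \<Rightarrow> 'b)) set" where
  "twists = (\<lambda>(\<alpha>, \<beta>). {(\<pi>, \<kappa>). \<pi> permutes X \<and> \<kappa> permutes X \<and> (\<pi> \<circ> \<alpha>, \<beta> \<circ> \<kappa>) \<in> map_pairs})"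

definition twist where
  "twist = (\<lambda>(\<alpha>, \<beta>) (\<pi>, \<kappa>). (\<pi> \<circ> \<alpha>, \<beta> \<circ> \<kappa> :: 'b \<Rightarrow> 'b) :: ('b \<Rightarrow> 'b) \<times> ('b \<Rightarrow> 'b))"

definition num_faces :: "('b \<Rightarrow> 'b) \<times> ('b \<Rightarrow> 'b) \<Rightarrow> nat" where
  "num_faces = (\<lambda>(\<alpha>, \<beta>). cyc (arcs D) \<alpha> + cyc (arcs D) \<beta>)"

text \<open>The orbits of the contracted permutation, described without reference to a map; hence
  they are the same for every choice of rotations away from the handle.\<close>

definition forest_classes :: "'b set set" where
  "forest_classes = (\<lambda>a. {b \<in> X. if head D a = u then b = a
     else head D b \<noteq> u \<and> linked (arcs D - X) (head D a) (head D b)}) ` X"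

text \<open>\<open>w\<close> rotates the arcs leaving the handle. Inserting \<open>inv w\<close>
  undoes this rotation, so \<open>\<beta> \<circ> inv w \<circ> \<alpha>\<close> fixes the arcs
  entering the handle and still rotates those entering any other vertex. It has
  \<open>card X + card (verts D) - 1\<close> cycles, and each of the
  \<open>card (arcs D) - card X\<close> contracted arcs removes one of them; this is the equation
  for \<open>cyc X \<rho>\<close>.\<close>

lemma twists_cyclic_pairs:
  assumes m: "(\<alpha>, \<beta>) \<in> map_pairs" and X: "X \<noteq> {}"
    and eul: "eulerian_digraph D" and in_ne: "\<And>v. v \<in> verts D - {u} \<Longrightarrow> in_arcs D v \<noteq> {}"
  obtains \<rho> \<alpha>' \<beta>' where "\<rho> permutes X" "orbit \<rho> ` X = forest_classes"
    "cyc X \<rho> + card (arcs D) + 1 = card (verts D) + 2 * card X"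
    "\<alpha>' permutes X" "\<beta>' permutes X"
    "bij_betw (\<lambda>(\<pi>, \<kappa>). (\<beta>' \<circ> \<kappa>, \<pi> \<circ> \<alpha>')) (twists (\<alpha>, \<beta>)) (cyclic_pairs X \<rho>)"
    "\<And>\<pi> \<kappa>. (\<pi>, \<kappa>) \<in> twists (\<alpha>, \<beta>) \<Longrightarrow> num_faces (twist (\<alpha>, \<beta>) (\<pi>, \<kappa>)) = cyc X (\<beta>' \<circ> \<kappa>) + cyc X (\<pi> \<circ> \<alpha>')"
proof -
  note mD = map_pairsD[OF m] and im = map_pairs_image[OF m]
  define w where "w = perm_restrict (\<alpha> \<circ> \<beta>) X"
  have w_app: "w a = \<alpha> (\<beta> a)" if "a \<in> X" for a using that by (simp add: w_def perm_restrict_simps)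
  have "(\<alpha> \<circ> \<beta>) ` X = X" by (simp only: im flip: image_comp)
  moreover have "inj (\<alpha> \<circ> \<beta>)" using permutes_inj[OF mD(1)] permutes_inj[OF mD(2)] by (intro inj_compose)
  ultimately have "bij_betw (\<alpha> \<circ> \<beta>) X X" by (simp add: bij_betw_def inj_on_def inj_def)
  then have "bij_betw w X X" by (subst bij_betw_cong[of _ _ "\<alpha> \<circ> \<beta>"]) (auto simp: w_app)
  then have w: "w permutes X" by (rule bij_imp_permutes) (simp add: w_def perm_restrict_simps)
  have wA: "w permutes arcs D" using w X_arcs by (rule permutes_subset)
  let ?R = "\<beta> \<circ> inv w \<circ> \<alpha>"
  have R_handle: "?R a = a" if a: "a \<in> arcs D" "head D a = u" for a
  proof -
    have "\<alpha> a \<in> X" using a im(1)[of u] by auto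
    then have iX: "inv w (\<alpha> a) \<in> X" using permutes_in_image[OF permutes_inv[OF w]] by simp
    have "\<alpha> (\<beta> (inv w (\<alpha> a))) = \<alpha> a" using w_app[OF iX] permutes_inverses(1)[OF w] by simp
    then show ?thesis using permutes_inj[OF mD(1)] by (simp add: inj_eq)
  qed
  have R_other: "?R a = \<beta> (\<alpha> a)" if a: "a \<in> arcs D" "head D a \<noteq> u" for a
    using a mD(3) permutes_not_in[OF permutes_inv[OF w], of "\<alpha> a"] by simp
  have orbR: "orbit ?R a = (if head D a = u then {a} else in_arcs D (head D a))" if a: "a \<in> arcs D" for a
  proof (cases "head D a = u")
    case True
    have "orbit ?R a = {a}" unfolding orbit_eq_singleton_iff using R_handle[OF a True] .
    then show ?thesis using True by simp
  next
    case False
    have ain: "a \<in> in_arcs D (head D a)" using a by simp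
    have "cyclic_on (\<beta> \<circ> \<alpha>) (in_arcs D (head D a))" using a ain by (intro mD(5)) auto
    then have "cyclic_on ?R (in_arcs D (head D a))"
      using R_other False by (subst cyclic_cong[of _ _ "\<beta> \<circ> \<alpha>"]) auto
    then show ?thesis using ain False by (simp add: orbit_cyclic_eq3)
  qed
  have RA: "?R permutes arcs D" using mD(1,2) wA by (intro permutes_compose permutes_inv)
  have cycR: "cyc (arcs D) ?R = card (in_arcs D u) + (card (verts D) - 1)"
  proof -
    have "orbit ?R ` arcs D = (\<lambda>a. {a}) ` in_arcs D u \<union> in_arcs D ` (verts D - {u})"
    proof (intro equalityI subsetI)
      fix C assume "C \<in> orbit ?R ` arcs D"
      then obtain a where "a \<in> arcs D" "C = orbit ?R a" by blast
      then show "C \<in> (\<lambda>a. {a}) ` in_arcs D u \<union> in_arcs D ` (verts D - {u})"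
        using orbR[of a] by (cases "head D a = u") auto
    next
      fix C assume "C \<in> (\<lambda>a. {a}) ` in_arcs D u \<union> in_arcs D ` (verts D - {u})"
      then show "C \<in> orbit ?R ` arcs D"
      proof
        assume "C \<in> (\<lambda>a. {a}) ` in_arcs D u"
        then obtain a where "a \<in> arcs D" "head D a = u" "C = {a}" by auto
        then show ?thesis using orbR[of a] by (intro image_eqI[of _ _ a]) auto
      next
        assume "C \<in> in_arcs D ` (verts D - {u})"
        then obtain v where v: "v \<in> verts D - {u}" "C = in_arcs D v" by auto
        obtain a where "a \<in> in_arcs D v" using in_ne[OF v(1)] by blast
        then have "a \<in> arcs D" "head D a = v" by auto
        then show ?thesis using orbR[of a] v by (intro image_eqI[of _ _ a]) auto
      qed
    qed
    moreover have "(\<lambda>a. {a}) ` in_arcs D u \<inter> in_arcs D ` (verts D - {u}) = {}"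
    proof (rule ccontr)
      assume "\<not> ?thesis"
      then obtain a v where "a \<in> in_arcs D u" "v \<in> verts D - {u}" "{a} = in_arcs D v" by blast
      then have "a \<in> in_arcs D u" "a \<in> in_arcs D v" "v \<noteq> u" by auto
      then show False by simp
    qed
    moreover have "inj_on (in_arcs D) (verts D - {u})"
    proof (rule inj_onI)
      fix v v' assume v: "v \<in> verts D - {u}" "v' \<in> verts D - {u}" "in_arcs D v = in_arcs D v'"
      obtain a where "a \<in> in_arcs D v" using in_ne[OF v(1)] by blast
      moreover from this have "a \<in> in_arcs D v'" using v(3) by simp
      ultimately show "v = v'" by simp
    qed
    moreover have "card ((\<lambda>a. {a}) ` in_arcs D u) = card (in_arcs D u)" by (simp add: card_image)
    ultimately show ?thesis
      using u_in_verts finite_in_arcs[of u] by (simp add: cyc_def card_Un_disjoint card_image)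
  qed
  have cX: "card (in_arcs D u) = card X"
    using eul u_in_verts by (simp add: eulerian_digraph_def in_degree_def out_degree_def)
  have key: "b \<in> orbit ?R a \<longleftrightarrow> (if head D a = u then b = a else head D b = head D a)"
    if "a \<in> arcs D" "b \<in> arcs D" for a b
    using orbR[OF that(1)] that(2) by simp
  obtain \<alpha>' \<beta>' where "contraction \<alpha> \<beta> w (arcs D - X) \<alpha>' \<beta>'"
    using contraction_exists[OF mD(1,3,2,4) w key, of "arcs D - X"] by blast
  moreover have "arcs D - (arcs D - X) = X" using X_arcs by blast
  ultimately have "contraction \<alpha> \<beta> w (arcs D - X) \<alpha>' \<beta>'" and XX: "arcs D - (arcs D - X) = X" by auto
  then have c: "\<alpha>' permutes X" "\<beta>' permutes X"
    "\<And>\<pi>. \<pi> permutes X \<Longrightarrow> cyc (arcs D) (\<pi> \<circ> \<alpha>) = cyc X (\<pi> \<circ> \<alpha>')"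
    "\<And>\<pi>. \<pi> permutes X \<Longrightarrow> cyc (arcs D) (\<beta> \<circ> \<pi>) = cyc X (\<beta>' \<circ> \<pi>)"
    "\<And>a b. a \<in> X \<Longrightarrow> b \<in> X \<Longrightarrow> b \<in> orbit (\<beta>' \<circ> inv w \<circ> \<alpha>') a \<longleftrightarrow>
      (if head D a = u then b = a else head D b \<noteq> u \<and> linked (arcs D - X) (head D a) (head D b))"
    "cyc (arcs D) ?R = cyc X (\<beta>' \<circ> inv w \<circ> \<alpha>') + card (arcs D - X)"
    unfolding contraction_def XX by blast+
  \<comment> \<open>The permutation to be exhibited is the inverse of this one: \<open>\<beta>'
    \<circ> \<kappa> \<circ> (\<pi> \<circ> \<alpha>') \<circ> inv ?\<rho>\<close> is conjugate to
    \<open>w \<circ> \<kappa> \<circ> \<pi>\<close>, which must be a full cycle for the twist to be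
    a map. Inversion keeps the orbits.\<close>
  let ?\<rho> = "\<beta>' \<circ> inv w \<circ> \<alpha>'"
  have \<rho>0: "?\<rho> permutes X" using c(1,2) w by (intro permutes_compose permutes_inv)
  have inv\<rho>: "inv ?\<rho> = inv \<alpha>' \<circ> w \<circ> inv \<beta>'"
  proof -
    have b: "bij \<alpha>'" "bij \<beta>'" "bij (inv w)" using c(1,2) permutes_inv[OF w] by (auto intro: permutes_bij)
    have "inv ?\<rho> = inv \<alpha>' \<circ> inv (\<beta>' \<circ> inv w)" using b by (intro o_inv_distrib bij_comp)
    also have "inv (\<beta>' \<circ> inv w) = inv (inv w) \<circ> inv \<beta>'" using b by (intro o_inv_distrib)
    finally show ?thesis by (simp only: permutes_inv_inv[OF w] comp_assoc)
  qed
  have orbi: "orbit (inv ?\<rho>) = orbit ?\<rho>"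
    using finite_X \<rho>0 by (intro ext orbit_inv_eq permutes_imp_permutation)
  show ?thesis
  proof (rule that[of "inv ?\<rho>" \<alpha>' \<beta>'])
    show "inv ?\<rho> permutes X" "\<alpha>' permutes X" "\<beta>' permutes X" using \<rho>0 c(1,2) by (auto intro: permutes_inv)
    have "orbit ?\<rho> a = {b \<in> X. if head D a = u then b = a
       else head D b \<noteq> u \<and> linked (arcs D - X) (head D a) (head D b)}" if a: "a \<in> X" for a
      using c(5)[OF a] permutes_orbit_subset[OF \<rho>0 a] by blast
    then show "orbit (inv ?\<rho>) ` X = forest_classes"
      unfolding forest_classes_def orbi by (intro image_cong) auto
    have "cyc X (inv ?\<rho>) = cyc X ?\<rho>" by (simp only: cyc_def orbi)
    moreover have "card (arcs D - X) + card X = card (arcs D)"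
      using card_Diff_subset[OF finite_X X_arcs] card_mono[OF finite_arcs X_arcs] by simp
    moreover have "card (verts D) > 0" using u_in_verts by (auto simp: card_gt_0_iff)
    ultimately show "cyc X (inv ?\<rho>) + card (arcs D) + 1 = card (verts D) + 2 * card X"
      using c(6) cycR cX by linarith
    show "num_faces (twist (\<alpha>, \<beta>) (\<pi>, \<kappa>)) = cyc X (\<beta>' \<circ> \<kappa>) + cyc X (\<pi> \<circ> \<alpha>')"
      if "(\<pi>, \<kappa>) \<in> twists (\<alpha>, \<beta>)" for \<pi> \<kappa>
      using that c(3)[of \<pi>] c(4)[of \<kappa>] by (simp add: twists_def twist_def num_faces_def)
    have iff: "(\<pi>, \<kappa>) \<in> twists (\<alpha>, \<beta>) \<longleftrightarrow> (\<beta>' \<circ> \<kappa>, \<pi> \<circ> \<alpha>') \<in> cyclic_pairs X (inv ?\<rho>)"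
      if p: "\<pi> permutes X" "\<kappa> permutes X" for \<pi> \<kappa>
    proof -
      let ?g = "\<kappa> \<circ> \<pi> \<circ> w"
      have g: "?g permutes X" using p w by (intro permutes_compose)
      have 1: "\<beta>' \<circ> \<kappa> \<circ> (\<pi> \<circ> \<alpha>') \<circ> inv ?\<rho> = \<beta>' \<circ> ?g \<circ> inv \<beta>'"
        unfolding inv\<rho> using permutes_inverses(1)[OF c(1)] by (simp add: fun_eq_iff)
      have 2: "w \<circ> ?g \<circ> inv w = w \<circ> \<kappa> \<circ> \<pi>"
        using permutes_inverses(1)[OF w] by (simp add: fun_eq_iff)
      have "(\<pi>, \<kappa>) \<in> twists (\<alpha>, \<beta>) \<longleftrightarrow> cyclic_on (\<alpha> \<circ> \<beta> \<circ> \<kappa> \<circ> \<pi>) X"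
        using p map_pairs_twist_iff[OF m p X] by (simp add: twists_def)
      also have "\<dots> \<longleftrightarrow> cyclic_on (w \<circ> \<kappa> \<circ> \<pi>) X"
      proof (rule cyclic_cong)
        fix a assume "a \<in> X"
        then have "\<kappa> (\<pi> a) \<in> X" using permutes_in_image[OF p(1)] permutes_in_image[OF p(2)] by simp
        then show "(\<alpha> \<circ> \<beta> \<circ> \<kappa> \<circ> \<pi>) a = (w \<circ> \<kappa> \<circ> \<pi>) a" using w_app by simp
      qed
      also have "\<dots> \<longleftrightarrow> cyclic_on ?g X" unfolding 2[symmetric] by (rule cyclic_on_conj[OF finite_X w g])
      also have "\<dots> \<longleftrightarrow> cyclic_on (\<beta>' \<circ> \<kappa> \<circ> (\<pi> \<circ> \<alpha>') \<circ> inv ?\<rho>) X"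
        unfolding 1 by (rule cyclic_on_conj[OF finite_X c(2) g, symmetric])
      finally show ?thesis using p c(1,2) by (simp add: cyclic_pairs_def permutes_compose)
    qed
    show "bij_betw (\<lambda>(\<pi>, \<kappa>). (\<beta>' \<circ> \<kappa>, \<pi> \<circ> \<alpha>')) (twists (\<alpha>, \<beta>)) (cyclic_pairs X (inv ?\<rho>))"
    proof (rule bij_betwI[where g = "\<lambda>(p, p'). (p' \<circ> inv \<alpha>', inv \<beta>' \<circ> p)"])
      note i = permutes_inverses[OF c(1)] permutes_inverses[OF c(2)]
      show "(\<lambda>(\<pi>, \<kappa>). (\<beta>' \<circ> \<kappa>, \<pi> \<circ> \<alpha>')) \<in> twists (\<alpha>, \<beta>) \<rightarrow> cyclic_pairs X (inv ?\<rho>)"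
      proof
        fix pk assume pk: "pk \<in> twists (\<alpha>, \<beta>)"
        obtain \<pi> \<kappa> where eq: "pk = (\<pi>, \<kappa>)" by (cases pk)
        then have "\<pi> permutes X" "\<kappa> permutes X" using pk by (auto simp: twists_def)
        then show "(case pk of (\<pi>, \<kappa>) \<Rightarrow> (\<beta>' \<circ> \<kappa>, \<pi> \<circ> \<alpha>')) \<in> cyclic_pairs X (inv ?\<rho>)"
          using iff pk unfolding eq by simp
      qed
      show "(\<lambda>(p, p'). (p' \<circ> inv \<alpha>', inv \<beta>' \<circ> p)) \<in> cyclic_pairs X (inv ?\<rho>) \<rightarrow> twists (\<alpha>, \<beta>)"
      proof
        fix pp assume pp: "pp \<in> cyclic_pairs X (inv ?\<rho>)"
        obtain p p' where eq: "pp = (p, p')" by (cases pp)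
        then have perm: "p permutes X" "p' permutes X" using pp by (auto simp: cyclic_pairs_def)
        have "p' \<circ> inv \<alpha>' permutes X" "inv \<beta>' \<circ> p permutes X"
          using perm c(1,2) by (auto intro!: permutes_compose permutes_inv)
        moreover have "\<beta>' \<circ> (inv \<beta>' \<circ> p) = p" "p' \<circ> inv \<alpha>' \<circ> \<alpha>' = p'" using i by (auto simp: fun_eq_iff)
        ultimately show "(case pp of (p, p') \<Rightarrow> (p' \<circ> inv \<alpha>', inv \<beta>' \<circ> p)) \<in> twists (\<alpha>, \<beta>)"
          using iff pp unfolding eq by simp
      qed
    qed (use permutes_inverses[OF c(1)] permutes_inverses[OF c(2)] in \<open>auto simp: fun_eq_iff\<close>)
  qed
qed

lemma twist_id: "m \<in> map_pairs \<Longrightarrow> (id, id) \<in> twists m" "twist m (id, id) = m"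
  by (auto simp: twists_def twist_def split: prod.splits)

text \<open>
  Every map is counted once in each of the classes that contain it, and all the classes have the
  same size and the same polynomial.
\<close>

lemma face_polynomial:
  fixes F :: "complex poly"
  assumes X: "X \<noteq> {}" and eul: "eulerian_digraph D"
    and in_ne: "\<And>v. v \<in> verts D - {u} \<Longrightarrow> in_arcs D v \<noteq> {}" and ne: "map_pairs \<noteq> {}"
  defines "F \<equiv> (\<Sum>m\<in>map_pairs. monom 1 (num_faces m))"
  shows "\<And>z. poly F z = 0 \<Longrightarrow> Re z = 0" "degree F + card (verts D) = card (arcs D) + 2"
    "\<And>m. m \<in> map_pairs \<Longrightarrow> even (num_faces m + degree F)"
proof -
  let ?T = "\<lambda>m. \<Sum>pk\<in>twists m. monom (1 :: complex) (num_faces (twist m pk))"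
  have fin: "finite (twists m)" for m
  proof -
    have "twists m \<subseteq> {p. p permutes X} \<times> {p. p permutes X}" by (auto simp: twists_def)
    then show ?thesis using finite_permutations[OF finite_X] finite_subset by blast
  qed
  have cls: "\<exists>\<rho>. \<rho> permutes X \<and> orbit \<rho> ` X = forest_classes \<and>
     cyc X \<rho> + card (arcs D) + 1 = card (verts D) + 2 * card X \<and> ?T m = cyc_poly X \<rho> \<and>
     (\<exists>p p'. (p, p') \<in> cyclic_pairs X \<rho> \<and> num_faces m = cyc X p + cyc X p')" if m: "m \<in> map_pairs" for m
  proof -
    obtain \<alpha> \<beta> where ab: "m = (\<alpha>, \<beta>)" by (cases m)
    obtain \<rho> \<alpha>' \<beta>' where r: "\<rho> permutes X" "orbit \<rho> ` X = forest_classes"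
      "cyc X \<rho> + card (arcs D) + 1 = card (verts D) + 2 * card X"
      "bij_betw (\<lambda>(\<pi>, \<kappa>). (\<beta>' \<circ> \<kappa>, \<pi> \<circ> \<alpha>')) (twists m) (cyclic_pairs X \<rho>)"
      "\<And>\<pi> \<kappa>. (\<pi>, \<kappa>) \<in> twists m \<Longrightarrow> num_faces (twist m (\<pi>, \<kappa>)) = cyc X (\<beta>' \<circ> \<kappa>) + cyc X (\<pi> \<circ> \<alpha>')"
      using twists_cyclic_pairs[OF m[unfolded ab] X eul in_ne] unfolding ab by metis
    have "?T m = (\<Sum>pk\<in>twists m. case (case pk of (\<pi>, \<kappa>) \<Rightarrow> (\<beta>' \<circ> \<kappa>, \<pi> \<circ> \<alpha>')) of (p, p') \<Rightarrow> monom 1 (cyc X p + cyc X p'))"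
      using r(5) by (intro sum.cong) auto
    also have "\<dots> = cyc_poly X \<rho>" unfolding cyc_poly_def by (rule sum.reindex_bij_betw[OF r(4)])
    finally have "?T m = cyc_poly X \<rho>" .
    moreover have "(\<beta>' \<circ> id, id \<circ> \<alpha>') \<in> cyclic_pairs X \<rho>"
      using bij_betwE[OF r(4)] twist_id(1)[OF m] by auto
    moreover have "num_faces m = cyc X (\<beta>' \<circ> id) + cyc X (id \<circ> \<alpha>')"
      using r(5)[OF twist_id(1)[OF m]] twist_id(2) by simp
    ultimately show ?thesis using r(1-3) by blast
  qed
  obtain m0 where m0: "m0 \<in> map_pairs" using ne by auto
  obtain \<rho> where r: "\<rho> permutes X" "orbit \<rho> ` X = forest_classes"
     "cyc X \<rho> + card (arcs D) + 1 = card (verts D) + 2 * card X" using cls[OF m0] by blast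
  define C where "C = cyc_poly X \<rho>"
  have T: "?T m = C" if m: "m \<in> map_pairs" for m
    using cls[OF m] cyc_poly_cong[OF finite_X _ r(1)] r(2) unfolding C_def by metis
  have card: "of_nat (card (twists m)) = poly C 1" if m: "m \<in> map_pairs" for m
    unfolding T[OF m, symmetric] by (simp add: poly_sum poly_monom)
  \<comment> \<open>\<open>poly C 1\<close> is the common size of the sets of twists, each of which
    contains \<open>(id, id)\<close>.\<close>
  have C1: "poly C 1 \<noteq> 0"
    using card[OF m0] twist_id(1)[OF m0] fin[of m0] by (metis card_eq_0_iff empty_iff of_nat_eq_0_iff)
  let ?S = "Sigma map_pairs twists"
  have "of_nat (card map_pairs) * C = (\<Sum>m\<in>map_pairs. ?T m)" using T by simp
  also have "\<dots> = (\<Sum>(m, pk)\<in>?S. monom 1 (num_faces (twist m pk)))"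
    using finite_map_pairs fin by (intro sum.Sigma) auto
  also have "\<dots> = (\<Sum>(m, pk)\<in>?S. monom 1 (num_faces m))"
  \<comment> \<open>Undoing a twist is a twist of the other map, so this involution exchanges the
    two maps of a pair.\<close>
  proof (rule sum.reindex_bij_witness[where i = "\<lambda>(m, (\<pi>, \<kappa>)). (twist m (\<pi>, \<kappa>), (inv \<pi>, inv \<kappa>))"
        and j = "\<lambda>(m, (\<pi>, \<kappa>)). (twist m (\<pi>, \<kappa>), (inv \<pi>, inv \<kappa>))"])
    fix x assume x: "x \<in> ?S"
    obtain \<alpha> \<beta> \<pi> \<kappa> where eq: "x = ((\<alpha>, \<beta>), (\<pi>, \<kappa>))" by (metis surj_pair)
    have p: "\<pi> permutes X" "\<kappa> permutes X" "(\<alpha>, \<beta>) \<in> map_pairs" "(\<pi> \<circ> \<alpha>, \<beta> \<circ> \<kappa>) \<in> map_pairs"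
      using x unfolding eq by (auto simp: twists_def)
    note i = permutes_inverses[OF p(1)] permutes_inverses[OF p(2)]
    have undo: "inv \<pi> \<circ> (\<pi> \<circ> \<alpha>) = \<alpha>" "\<beta> \<circ> \<kappa> \<circ> inv \<kappa> = \<beta>" using i by (auto simp: fun_eq_iff)
    show "(case case x of (m, (\<pi>, \<kappa>)) \<Rightarrow> (twist m (\<pi>, \<kappa>), (inv \<pi>, inv \<kappa>)) of
        (m, (\<pi>, \<kappa>)) \<Rightarrow> (twist m (\<pi>, \<kappa>), (inv \<pi>, inv \<kappa>))) = x"
      unfolding eq using undo p(1,2) by (simp add: twist_def permutes_inv_inv)
    then show "(case case x of (m, (\<pi>, \<kappa>)) \<Rightarrow> (twist m (\<pi>, \<kappa>), (inv \<pi>, inv \<kappa>)) of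
        (m, (\<pi>, \<kappa>)) \<Rightarrow> (twist m (\<pi>, \<kappa>), (inv \<pi>, inv \<kappa>))) = x" .
    show "(case x of (m, (\<pi>, \<kappa>)) \<Rightarrow> (twist m (\<pi>, \<kappa>), (inv \<pi>, inv \<kappa>))) \<in> ?S"
      unfolding eq using undo p by (simp add: twist_def twists_def permutes_inv)
    then show "(case x of (m, (\<pi>, \<kappa>)) \<Rightarrow> (twist m (\<pi>, \<kappa>), (inv \<pi>, inv \<kappa>))) \<in> ?S" .
    show "(case case x of (m, (\<pi>, \<kappa>)) \<Rightarrow> (twist m (\<pi>, \<kappa>), (inv \<pi>, inv \<kappa>)) of (m, pk) \<Rightarrow> monom 1 (num_faces m)) =
      (case x of (m, pk) \<Rightarrow> monom (1 :: complex) (num_faces (twist m pk)))"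
      by (simp add: eq)
  qed
  also have "\<dots> = (\<Sum>m\<in>map_pairs. \<Sum>pk\<in>twists m. monom 1 (num_faces m))"
    using finite_map_pairs fin by (intro sum.Sigma[symmetric]) auto
  also have "\<dots> = (\<Sum>m\<in>map_pairs. smult (poly C 1) (monom 1 (num_faces m)))"
    by (intro sum.cong refl) (simp add: of_nat_poly flip: card)
  also have "\<dots> = smult (poly C 1) F"
  proof -
    have "smult a (\<Sum>j\<in>A. h j) = (\<Sum>j\<in>A. smult a (h j))" for a :: complex and A and h :: "('b \<Rightarrow> 'b) \<times> ('b \<Rightarrow> 'b) \<Rightarrow> complex poly"
      by (induction A rule: infinite_finite_induct) (simp_all add: smult_add_right)
    then show ?thesis by (simp add: F_def)
  qed
  finally have eq: "smult (of_nat (card map_pairs)) C = smult (poly C 1) F" by (simp add: of_nat_poly)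
  have M0: "card map_pairs \<noteq> 0" using finite_map_pairs ne by simp
  note roots = cyc_poly_roots[OF finite_X X r(1), folded C_def]
  have degF: "degree F = degree C" using arg_cong[OF eq, of degree] M0 C1 by simp
  \<comment> \<open>The bound keeps the subtraction in the degree of \<open>C\<close> from
    truncating; the largest face count is then the one of a sphere.\<close>
  have "cyc X \<rho> \<le> card X" using finite_X by (simp add: cyc_def card_image_le)
  then show "degree F + card (verts D) = card (arcs D) + 2" using roots(2) r(3) unfolding degF by linarith
  show "even (num_faces m + degree F)" if m: "m \<in> map_pairs" for m
  proof -
    obtain \<rho>' p p' where \<rho>': "\<rho>' permutes X" "?T m = cyc_poly X \<rho>'" "(p, p') \<in> cyclic_pairs X \<rho>'"
      "num_faces m = cyc X p + cyc X p'" using cls[OF m] by blast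
    then have "cyc_poly X \<rho>' = C" using T[OF m] by simp
    then show ?thesis using cyc_poly_exponent(2)[OF finite_X X \<rho>'(1,3)] \<rho>'(4) degF by simp
  qed
  fix z assume "poly F z = 0"
  then have "poly (smult (of_nat (card map_pairs)) C) z = 0" unfolding eq by simp
  then show "Re z = 0" using M0 roots(3) by simp
qed

end

section \<open>Rotation systems as pairs of arc permutations\<close>

text \<open>Inverse to \<open>turns\<close> on the alternating rotations; outside the darts it is
  the identity because \<open>permutes\<close> demands this.\<close>

definition rotation :: "'b set \<Rightarrow> ('b \<Rightarrow> 'b) \<times> ('b \<Rightarrow> 'b) \<Rightarrow> 'b \<times> bool \<Rightarrow> 'b \<times> bool" where
  "rotation A = (\<lambda>(\<alpha>, \<beta>) (a, out). if a \<in> A then (if out then (\<beta> a, False) else (\<alpha> a, True)) else (a, out))"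

definition turns :: "('b \<times> bool \<Rightarrow> 'b \<times> bool) \<Rightarrow> ('b \<Rightarrow> 'b) \<times> ('b \<Rightarrow> 'b)" where
  "turns \<sigma> = (\<lambda>a. fst (\<sigma> (a, False)), \<lambda>a. fst (\<sigma> (a, True)))"

lemma (in wf_digraph) connected_incident_arc:
  assumes "connected G" "v \<in> verts G" "verts G \<noteq> {v}"
  obtains a where "a \<in> arcs G" "tail G a = v \<or> head G a = v"
proof -
  obtain x where x: "x \<in> verts G" "x \<noteq> v" using assms(2,3) by auto
  then have "v \<rightarrow>\<^sup>*\<^bsub>mk_symmetric G\<^esub> x"
    using assms(1,2) unfolding connected_def strongly_connected_def by simp
  then have "(v, x) \<in> rtrancl_on (pverts (mk_symmetric G)) (arcs_ends (mk_symmetric G))"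
    by (simp add: reachable_def)
  then obtain y where "(v, y) \<in> arcs_ends (mk_symmetric G)"
    using x(2) by (cases rule: converse_rtrancl_on_cases) auto
  then show ?thesis using that by (auto simp: parcs_mk_symmetric arcs_ends_def arc_to_ends_def)
qed

lemma bipartite_one_black_handle:
  assumes "bipartite_one_black D"
  shows "\<exists>u\<in>verts D. directed_forest (pre_digraph.del_vert D u)"
proof -
  obtain black white where bw: "proper_two_colouring D black white" "card black = 1"
    using assms by (auto simp: bipartite_one_black_def)
  then obtain u where u: "black = {u}" by (auto simp: card_1_singleton_iff)
  have "arcs (pre_digraph.del_vert D u) = {}"
    using bw(1) by (auto simp: u proper_two_colouring_def pre_digraph.del_vert_simps)
  then have "\<not> pre_digraph.cycle (underlying (pre_digraph.del_vert D u)) p" for p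
    by (auto simp: pre_digraph.cycle_def pre_digraph.awalk_def underlying_def darts_def)
  then have "directed_forest (pre_digraph.del_vert D u)" by (simp add: directed_forest_def)
  moreover have "u \<in> verts D" using bw(1) by (auto simp: u proper_two_colouring_def)
  ultimately show ?thesis by blast
qed

context fan_handle
begin

lemma darts_at_iff: "(a, out) \<in> darts_at D v \<longleftrightarrow> a \<in> arcs D \<and> (if out then tail D a else head D a) = v"
  by (simp add: darts_at_def darts_def dart_vert_def)

lemma rotation_simps:
  "a \<in> arcs D \<Longrightarrow> rotation (arcs D) (\<alpha>, \<beta>) (a, False) = (\<alpha> a, True)"
  "a \<in> arcs D \<Longrightarrow> rotation (arcs D) (\<alpha>, \<beta>) (a, True) = (\<beta> a, False)"
  by (simp_all add: rotation_def)

lemma turns_in_map_pairs: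
  assumes \<sigma>: "directed_map D \<sigma>" "face_oriented D \<sigma>"
  shows "turns \<sigma> \<in> map_pairs" "rotation (arcs D) (turns \<sigma>) = \<sigma>"
proof -
  define \<alpha> where "\<alpha> a = fst (\<sigma> (a, False))" for a
  define \<beta> where "\<beta> a = fst (\<sigma> (a, True))" for a
  have perm: "\<sigma> permutes darts D" and cyc: "\<And>v. v \<in> verts D \<Longrightarrow> darts_at D v \<noteq> {} \<Longrightarrow> cyclic_on \<sigma> (darts_at D v)"
    using \<sigma>(1) by (auto simp: directed_map_def)
  have alt: "snd (\<sigma> d) \<noteq> snd d" if "d \<in> darts D" for d
    using face_oriented_iff_alternating[OF fin_digraph_axioms \<sigma>(1)] \<sigma>(2) that by blast
  have s: "\<sigma> (a, False) = (\<alpha> a, True)" "\<sigma> (a, True) = (\<beta> a, False)" if "a \<in> arcs D" for a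
    using alt[of "(a, False)"] alt[of "(a, True)"] that by (auto simp: darts_def \<alpha>_def \<beta>_def prod_eq_iff)
  have at: "\<sigma> d \<in> darts_at D v" if "d \<in> darts_at D v" for d v
  proof -
    obtain a out where d: "d = (a, out)" by (cases d)
    then have "v \<in> verts D" using that by (auto simp: darts_at_iff split: if_splits)
    then show ?thesis using cyclic_on_inI[OF cyc that] that by auto
  qed
  have A: "\<alpha> a \<in> arcs D" "tail D (\<alpha> a) = head D a" "\<beta> a \<in> arcs D" "head D (\<beta> a) = tail D a" if a: "a \<in> arcs D" for a
    using at[of "(a, False)" "head D a"] at[of "(a, True)" "tail D a"] a s[OF a] by (auto simp: darts_at_iff)
  have inj: "inj \<sigma>" using perm by (rule permutes_inj)
  have "inj_on \<alpha> (arcs D)" "inj_on \<beta> (arcs D)"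
    using s injD[OF inj] by (auto intro!: inj_onI) (metis prod.inject)+
  then have "bij_betw \<alpha> (arcs D) (arcs D)" "bij_betw \<beta> (arcs D) (arcs D)"
    using A(1,3) by (simp_all add: bij_betw_def endo_inj_surj image_subset_iff)
  moreover have "\<alpha> a = a" "\<beta> a = a" if "a \<notin> arcs D" for a
    using permutes_not_in[OF perm, of "(a, False)"] permutes_not_in[OF perm, of "(a, True)"] that
    by (auto simp: \<alpha>_def \<beta>_def darts_def)
  ultimately have p: "\<alpha> permutes arcs D" "\<beta> permutes arcs D" by (auto intro: bij_imp_permutes)
  have "cyclic_on (\<beta> \<circ> \<alpha>) (in_arcs D v)" if v: "v \<in> verts D" "in_arcs D v \<noteq> {}" for v
  proof -
    obtain a where a: "a \<in> in_arcs D v" using v(2) by blast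
    then have av: "(a, False) \<in> darts_at D v" by (simp add: darts_at_iff)
    then have orb: "orbit \<sigma> (a, False) = darts_at D v"
      using cyc[OF v(1)] by (intro orbit_cyclic_eq3) auto
    \<comment> \<open>Ends alternate, so two steps of \<open>\<sigma>\<close> make one step of
      \<open>\<beta> \<circ> \<alpha>\<close>. The case \<open>c = a\<close> is separate because
      \<open>orbit\<close> begins only after the first step.\<close>
    have "if snd d then \<exists>c. (c = a \<or> c \<in> orbit (\<beta> \<circ> \<alpha>) a) \<and> fst d = \<alpha> c else fst d \<in> orbit (\<beta> \<circ> \<alpha>) a"
      if "d \<in> orbit \<sigma> (a, False)" for d
      using that
    proof induction
      case base
      then show ?case using a s by auto
    next
      case (step d)
      have "d \<in> darts_at D v" using step.hyps orb by simp
      then obtain b out where d: "d = (b, out)" "b \<in> arcs D" by (cases d) (auto simp: darts_at_iff)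
      show ?case
      proof (cases out)
        case True
        then obtain c where c: "c = a \<or> c \<in> orbit (\<beta> \<circ> \<alpha>) a" "b = \<alpha> c" using step.IH d by auto
        then have "\<beta> b \<in> orbit (\<beta> \<circ> \<alpha>) a" by (auto intro: orbit_eqI)
        then show ?thesis using d True s by simp
      next
        case False
        then show ?thesis using step.IH d s by auto
      qed
    qed
    note * = this
    have "in_arcs D v \<subseteq> orbit (\<beta> \<circ> \<alpha>) a"
    proof
      fix b assume "b \<in> in_arcs D v"
      then have "(b, False) \<in> orbit \<sigma> (a, False)" unfolding orb by (simp add: darts_at_iff)
      from *[OF this] show "b \<in> orbit (\<beta> \<circ> \<alpha>) a" by simp
    qed
    moreover have "b \<in> in_arcs D v" if "b \<in> orbit (\<beta> \<circ> \<alpha>) a" for b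
      using that by induction (use a A in auto)
    ultimately have "orbit (\<beta> \<circ> \<alpha>) a = in_arcs D v" by blast
    then show ?thesis using a by (auto simp: cyclic_on_def)
  qed
  then have "(\<alpha>, \<beta>) \<in> map_pairs" using p A by (auto simp: map_pairs_def)
  moreover have t: "turns \<sigma> = (\<alpha>, \<beta>)" by (simp add: turns_def \<alpha>_def[abs_def] \<beta>_def[abs_def])
  ultimately show "turns \<sigma> \<in> map_pairs" by simp
  show "rotation (arcs D) (turns \<sigma>) = \<sigma>"
  proof
    fix d :: "'b \<times> bool"
    obtain a out where d: "d = (a, out)" by (cases d)
    show "rotation (arcs D) (turns \<sigma>) d = \<sigma> d"
      using s[of a] permutes_not_in[OF perm, of d] unfolding t d
      by (cases "a \<in> arcs D"; cases out) (auto simp: rotation_def darts_def)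
  qed
qed

text \<open>\<open>\<sigma> \<circ> opp\<close> acts as \<open>\<alpha>\<close> on forward
  traversals and as \<open>\<beta>\<close> on backward ones, so the faces are the cycles of
  \<open>\<alpha>\<close> and those of \<open>\<beta>\<close>.\<close>

lemma rotation_directed_map:
  assumes m: "(\<alpha>, \<beta>) \<in> map_pairs"
    and both: "\<And>v. v \<in> verts D \<Longrightarrow> darts_at D v \<noteq> {} \<Longrightarrow> in_arcs D v \<noteq> {}"
  shows "directed_map D (rotation (arcs D) (\<alpha>, \<beta>))" "face_oriented D (rotation (arcs D) (\<alpha>, \<beta>))"
    "turns (rotation (arcs D) (\<alpha>, \<beta>)) = (\<alpha>, \<beta>)"
    "arcs D \<noteq> {} \<Longrightarrow> card (faces D (rotation (arcs D) (\<alpha>, \<beta>))) = num_faces (\<alpha>, \<beta>)"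
proof -
  note mD = map_pairsD[OF m]
  let ?\<sigma> = "rotation (arcs D) (\<alpha>, \<beta>)"
  note s = rotation_simps[where \<alpha> = \<alpha> and \<beta> = \<beta>]
  have in_a: "\<alpha> a \<in> arcs D \<longleftrightarrow> a \<in> arcs D" "\<beta> a \<in> arcs D \<longleftrightarrow> a \<in> arcs D" for a
    using permutes_in_image mD(1,2) by metis+
  have inj: "\<alpha> a = \<alpha> b \<longleftrightarrow> a = b" "\<beta> a = \<beta> b \<longleftrightarrow> a = b" for a b
    using permutes_inj[OF mD(1)] permutes_inj[OF mD(2)] by (simp_all add: inj_eq)
  have "inj_on ?\<sigma> (darts D)"
  proof (rule inj_onI)
    fix d d' assume "d \<in> darts D" "d' \<in> darts D" "?\<sigma> d = ?\<sigma> d'"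
    then show "d = d'" by (cases d; cases d'; cases "snd d"; cases "snd d'") (auto simp: darts_def s inj)
  qed
  moreover have "?\<sigma> ` darts D \<subseteq> darts D"
  proof
    fix d assume "d \<in> ?\<sigma> ` darts D"
    then obtain a out where "a \<in> arcs D" "d = ?\<sigma> (a, out)" by (auto simp: darts_def)
    then show "d \<in> darts D" by (cases out) (auto simp: darts_def s in_a)
  qed
  moreover have "finite (darts D)" by (simp add: darts_def)
  ultimately have "bij_betw ?\<sigma> (darts D) (darts D)" by (simp add: bij_betw_def endo_inj_surj)
  then have perm: "?\<sigma> permutes darts D"
    by (rule bij_imp_permutes) (auto simp: darts_def rotation_def split: if_splits)
  have cyc: "cyclic_on ?\<sigma> (darts_at D v)" if v: "v \<in> verts D" "darts_at D v \<noteq> {}" for v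
  proof -
    obtain a where a: "a \<in> in_arcs D v" using both[OF v] by blast
    then have orb: "orbit (\<beta> \<circ> \<alpha>) a = in_arcs D v" using mD(5)[OF v(1) both[OF v]] by (intro orbit_cyclic_eq3)
    have F: "(b, False) \<in> orbit ?\<sigma> (a, False)" if "b \<in> orbit (\<beta> \<circ> \<alpha>) a" for b
      using that
    proof induction
      case base
      have "(\<alpha> a, True) \<in> orbit ?\<sigma> (a, False)" using a by - (rule orbit_eqI(1); simp add: s)
      then show ?case using a by - (rule orbit_eqI(2)[of _ ?\<sigma> "(\<alpha> a, True)"]; simp add: s in_a)
    next
      case (step b)
      have b: "b \<in> arcs D" using step.hyps orb by simp
      have "(\<alpha> b, True) \<in> orbit ?\<sigma> (a, False)" using b step.IH by - (rule orbit_eqI(2)[of _ ?\<sigma> "(b, False)"]; simp add: s)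
      then show ?case using b by - (rule orbit_eqI(2)[of _ ?\<sigma> "(\<alpha> b, True)"]; simp add: s in_a)
    qed
    have "d \<in> orbit ?\<sigma> (a, False)" if d: "d \<in> darts_at D v" for d
    proof -
      obtain b out where b: "d = (b, out)" by (cases d)
      show ?thesis
      proof (cases out)
        case True
        then have "b \<in> out_arcs D v" using d b by (simp add: darts_at_iff)
        then have "b \<in> \<alpha> ` in_arcs D v" by (simp only: map_pairs_image(1)[OF m])
        then obtain c where c: "c \<in> in_arcs D v" "b = \<alpha> c" by blast
        then have "(c, False) \<in> orbit ?\<sigma> (a, False)" using F orb by simp
        then show ?thesis using c True unfolding b by - (rule orbit_eqI(2)[of _ ?\<sigma> "(c, False)"]; simp add: s)
      next
        case False
        then have "b \<in> in_arcs D v" using d b by (simp add: darts_at_iff)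
        then show ?thesis using F orb b False by simp
      qed
    qed
    moreover have step: "?\<sigma> d \<in> darts_at D v" if "d \<in> darts_at D v" for d
    proof -
      obtain b out where "d = (b, out)" by (cases d)
      then show ?thesis using that mD(3,4) by (cases out) (auto simp: darts_at_iff s in_a)
    qed
    have av: "(a, False) \<in> darts_at D v" using a by (simp add: darts_at_iff)
    have "d \<in> darts_at D v" if "d \<in> orbit ?\<sigma> (a, False)" for d
      using that by induction (use step av in auto)
    ultimately have "orbit ?\<sigma> (a, False) = darts_at D v" by blast
    then show ?thesis using av by (auto simp: cyclic_on_def)
  qed
  show dm: "directed_map D ?\<sigma>" using perm cyc by (simp add: directed_map_def)
  have "snd (?\<sigma> d) \<noteq> snd d" if "d \<in> darts D" for d
    using that by (cases d; cases "snd d") (auto simp: darts_def s)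
  then show "face_oriented D ?\<sigma>" using face_oriented_iff_alternating[OF fin_digraph_axioms dm] by blast
  have "fst (?\<sigma> (a, False)) = \<alpha> a" "fst (?\<sigma> (a, True)) = \<beta> a" for a
    using permutes_not_in[OF mD(1), of a] permutes_not_in[OF mD(2), of a] by (auto simp: rotation_def)
  then show "turns ?\<sigma> = (\<alpha>, \<beta>)" by (simp add: turns_def)
  assume ne: "arcs D \<noteq> {}"
  have orbT: "orbit (?\<sigma> \<circ> opp) (a, True) = (\<lambda>b. (b, True)) ` orbit \<alpha> a" if a: "a \<in> arcs D" for a
  proof (rule orbit_inverse[symmetric])
    show "a \<in> orbit \<alpha> a" using permutes_imp_permutation[OF finite_arcs mD(1)] by (rule permutation_self_in_orbit)
    fix b assume "b \<in> orbit \<alpha> a"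
    then have "b \<in> arcs D" using permutes_orbit_subset[OF mD(1) a] by blast
    then show "(?\<sigma> \<circ> opp) (b, True) = (\<alpha> b, True)" by (simp add: opp_def s)
  qed
  have orbF: "orbit (?\<sigma> \<circ> opp) (a, False) = (\<lambda>b. (b, False)) ` orbit \<beta> a" if a: "a \<in> arcs D" for a
  proof (rule orbit_inverse[symmetric])
    show "a \<in> orbit \<beta> a" using permutes_imp_permutation[OF finite_arcs mD(2)] by (rule permutation_self_in_orbit)
    fix b assume "b \<in> orbit \<beta> a"
    then have "b \<in> arcs D" using permutes_orbit_subset[OF mD(2) a] by blast
    then show "(?\<sigma> \<circ> opp) (b, False) = (\<beta> b, False)" by (simp add: opp_def s)
  qed
  let ?T = "(`) (\<lambda>b. (b, True)) ` orbit \<alpha> ` arcs D" and ?F = "(`) (\<lambda>b. (b, False)) ` orbit \<beta> ` arcs D"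
  have "darts D = (\<lambda>a. (a, True)) ` arcs D \<union> (\<lambda>a. (a, False)) ` arcs D"
    by (auto simp: darts_def image_iff)
  then have "faces D ?\<sigma> = ?T \<union> ?F"
    using ne by (simp add: faces_def image_Un image_image orbT orbF)
  moreover have "card ?T = cyc (arcs D) \<alpha>" "card ?F = cyc (arcs D) \<beta>"
    unfolding cyc_def by (auto intro!: card_image inj_onI simp: inj_image_eq_iff inj_def)
  moreover have "?T \<inter> ?F = {}"
  proof (rule ccontr)
    assume "\<not> ?thesis"
    then obtain a b where ab: "(\<lambda>b. (b, True)) ` orbit \<alpha> a = (\<lambda>b. (b, False)) ` orbit \<beta> b" by auto
    obtain c where "c \<in> orbit \<alpha> a" using orbit_nonempty[of \<alpha> a] by blast
    then have "(c, True) \<in> (\<lambda>b. (b, False)) ` orbit \<beta> b" unfolding ab[symmetric] by (rule imageI)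
    then show False by auto
  qed
  ultimately show "card (faces D ?\<sigma>) = num_faces (\<alpha>, \<beta>)"
    by (simp add: card_Un_disjoint num_faces_def)
qed

lemma log_concave_genus_distribution:
  assumes "connected D" and eul: "eulerian_digraph D"
  shows "log_concave (genus_distribution D)"
proof (cases "X = {}")
  \<comment> \<open>By connectedness the digraph is then a single vertex without arcs, whose only
    map is the sphere with one face of empty boundary.\<close>
  case True
  have "card (in_arcs D u) = card X"
    using eul u_in_verts by (simp add: eulerian_digraph_def in_degree_def out_degree_def)
  then have in_u: "in_arcs D u = {}" using True finite_in_arcs[of u] by simp
  have "verts D = {u}"
  proof (rule ccontr)
    assume "verts D \<noteq> {u}"
    then obtain a where "a \<in> arcs D" "tail D a = u \<or> head D a = u"
      using connected_incident_arc[OF assms(1) u_in_verts] by blast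
    then show False using True in_u by (auto simp: in_arcs_def out_arcs_def)
  qed
  then have arcs: "arcs D = {}" using True tail_in_verts by (force simp: out_arcs_def)
  have "{\<sigma>. directed_map D \<sigma> \<and> face_oriented D \<sigma>} = {id}"
    by (auto simp: directed_map_def face_oriented_def faces_def arcs darts_def darts_at_def)
  then have "genus_polynomial D = monom 1 (map_genus D id)" by (simp add: genus_polynomial_def)
  also have "map_genus D id = 0" by (simp add: map_genus_def \<open>verts D = {u}\<close> arcs faces_def)
  finally show ?thesis by (simp add: genus_distribution_def log_concave_def)
next
  case False
  have both: "in_arcs D v \<noteq> {}" if v: "v \<in> verts D" "a \<in> arcs D" "tail D a = v \<or> head D a = v" for v a
  proof -
    have "card (in_arcs D v) = card (out_arcs D v)"
      using eul v(1) by (simp add: eulerian_digraph_def in_degree_def out_degree_def)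
    moreover have "a \<in> in_arcs D v \<or> a \<in> out_arcs D v" using v(2,3) by auto
    ultimately show ?thesis by (metis card_eq_0_iff card_gt_0_iff empty_iff finite_in_arcs finite_out_arcs)
  qed
  have in_ne: "in_arcs D v \<noteq> {}" if v: "v \<in> verts D - {u}" for v
  proof -
    have "verts D \<noteq> {v}" using v u_in_verts by auto
    then obtain a where "a \<in> arcs D" "tail D a = v \<or> head D a = v"
      using connected_incident_arc[OF assms(1)] v by blast
    then show ?thesis using both v by blast
  qed
  have ne: "arcs D \<noteq> {}" using False by auto
  have rot: "v \<in> verts D \<Longrightarrow> darts_at D v \<noteq> {} \<Longrightarrow> in_arcs D v \<noteq> {}" for v
    using both by (auto simp: darts_at_def darts_def dart_vert_def split: if_splits)
  show ?thesis
  proof (cases "map_pairs = {}")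
    \<comment> \<open>The coefficient list is then empty and log-concavity is vacuous.\<close>
    case True
    then have "{\<sigma>. directed_map D \<sigma> \<and> face_oriented D \<sigma>} = {}" using turns_in_map_pairs(1) by blast
    then have "genus_polynomial D = 0" unfolding genus_polynomial_def by (simp only: sum.empty)
    then show ?thesis by (simp add: genus_distribution_def log_concave_def)
  next
    case ne_pairs: False
    define F where "F = (\<Sum>m\<in>map_pairs. monom (1 :: complex) (num_faces m))"
    note F = face_polynomial[OF False eul in_ne ne_pairs, folded F_def]
    have le: "num_faces m \<le> degree F" if "m \<in> map_pairs" for m
      unfolding F_def using finite_map_pairs that by (rule degree_sum_monom_ge)
    have "genus_polynomial D = (\<Sum>m\<in>map_pairs. monom 1 (map_genus D (rotation (arcs D) m)))"
      unfolding genus_polynomial_def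
      using turns_in_map_pairs rotation_directed_map[OF _ rot]
      by (intro sum.reindex_bij_witness[of _ "rotation (arcs D)" turns]) auto
    also have "\<dots> = (\<Sum>m\<in>map_pairs. monom 1 ((degree F - num_faces m) div 2))"
    proof (rule sum.cong[OF refl])
      fix m assume m: "m \<in> map_pairs"
      obtain \<alpha> \<beta> where ab: "m = (\<alpha>, \<beta>)" by (cases m)
      have "card (faces D (rotation (arcs D) m)) = num_faces m"
        using rotation_directed_map(4)[OF m[unfolded ab] rot ne] ab by simp
      \<comment> \<open>By the degree formula, Euler's equation says that twice the genus is
        \<open>degree F\<close> minus the number of faces.\<close>
      then have "2 - (int (card (verts D)) - int (card (arcs D)) + int (card (faces D (rotation (arcs D) m)))) = int (degree F - num_faces m)"
        using F(2) le[OF m] by linarith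
      then have "map_genus D (rotation (arcs D) m) = (degree F - num_faces m) div 2"
        by (simp add: map_genus_def nat_div_distrib)
      then show "monom 1 (map_genus D (rotation (arcs D) m)) = monom (1 :: real) ((degree F - num_faces m) div 2)" by simp
    qed
    finally show ?thesis
      unfolding genus_distribution_def
      using log_concave_if_imaginary_roots[OF finite_map_pairs ne_pairs, of num_faces "degree F"] F(1,3)
      by (simp add: F_def)
  qed
qed

end

theorem theorem0p1:
  fixes D :: "('a, 'b) pre_digraph"
  assumes "fin_digraph D"
    and "connected D"
    and "eulerian_digraph D"
    and "bipartite_one_black D \<or> eulerian_fan D"
  shows "log_concave (genus_distribution D)"
proof -
  obtain u where "u \<in> verts D" "directed_forest (pre_digraph.del_vert D u)"
    using assms(4) bipartite_one_black_handle by (auto simp: eulerian_fan_def)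
  then interpret fan_handle D u
    using assms(1) by (intro fan_handle.intro) (auto simp: fan_handle_axioms_def)
  show ?thesis using assms(2,3) by (rule log_concave_genus_distribution)
qed

end
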